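(* Let $Q>1$, let $(X,d,\mu)$ be a proper, $Q$-Ahlfors regular metric measure space that supports a $p_0$-Poincaré inequality for some $p_0\in(1,Q)$, and let $(Y,d_Y)$ be a $Q$-Ahlfors regular metric space. Let $f:X\rightarrow Y$ be an $\eta$-quasisymmetric homeomorphism. Then there is $p>Q$, depending only on $\eta(1)$ and $\eta^{-1}(1)$, such that if $E\subset X$ is bounded with $\dim_B E=d_E\in(0,Q)$, then $$0<\frac{(p-Q)d_E}{p-d_E}\leq\dim_B f(E)\leq\frac{p\,d_E}{p-Q+d_E}<Q.$$
   Context: Balls are open: $B(x,r)=\{z\in X: d(x,z)<r\}$, and $\lambda B(x,r)=B(x,\lambda r)$. A metric space is proper if its closed bounded subsets are compact. A metric measure space $(X,d,\mu)$ is a separable metric space $(X,d)$ with a Borel measure $\mu$ that assigns a positive and finite value to every ball. For a ball $B$ and $u\in L^1(B)$, $u_B=\frac{1}{\mu(B)}\int_B u\,d\mu$. $(X,d,\mu)$ is $Q$-Ahlfors regular ($Q>0$) if there is $C_A>0$ such that $\frac{1}{C_A}r^Q\leq\mu(B(x,r))\leq C_A r^Q$ for all $x\in X$ and $r\in(0,\mathrm{diam}\,X)$. A metric space $(X,d)$ is $Q$-Ahlfors regular if there is a measure $\mu$ on $X$ such that $(X,d,\mu)$ is $Q$-Ahlfors regular. Upper gradient: a Borel function $g:X\to[0,\infty]$ is an upper gradient of $u:X\to\mathbb{R}$ if for every rectifiable curve $\gamma:[0,1]\to X$, $|u(\gamma(0))-u(\gamma(1))|\leq\int_\gamma g\,ds$.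 $(X,d,\mu)$ supports a $p_0$-Poincaré inequality if there are $C>0$ and $\lambda\geq1$ such that whenever $u:X\to\mathbb{R}$ is a function with upper gradient $g:X\to[0,\infty]$, then for every open ball $B$ in $X$ $$\frac{1}{\mu(B)}\int_B|u-u_B|\,d\mu\leq C\,\mathrm{diam}(B)\left(\frac{1}{\mu(\lambda B)}\int_{\lambda B}g^{p_0}\,d\mu\right)^{1/p_0}.$$ Quasisymmetric mappings: given a homeomorphism $\eta:[0,\infty)\to[0,\infty)$, an embedding $f:X\to Y$ is $\eta$-quasisymmetric if for all distinct $x,y,z\in X$, $$\frac{d_Y(f(x),f(y))}{d_Y(f(z),f(y))}\leq\eta\left(\frac{d(x,y)}{d(z,y)}\right).$$ Minkowski dimension: for a bounded subset $E$ of a metric space and $r>0$, let $N(E,r)$ be the smallest number of sets of diameter at most $r$ needed to cover $E$. The (upper) Minkowski dimension of $E$ is $\dim_B E=\limsup_{r\to0}\frac{\log N(E,r)}{\log(1/r)}$. *)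

theory Defs
  imports "HOL-Analysis.Analysis"
begin

text \<open>A metric space is the universe of a type of class \<^class>\<open>metric_space\<close>, a Borel measure is a
  measure whose sigma-algebra is that of \<^const>\<open>borel\<close>, and \<^term>\<open>ball x r\<close> is the open ball.\<close>

definition proper_space :: "'a::metric_space itself \<Rightarrow> bool" where
  "proper_space _ \<longleftrightarrow> (\<forall>S :: 'a set. closed S \<and> bounded S \<longrightarrow> compact S)"

definition metric_measure_space :: "'a::metric_space measure \<Rightarrow> bool" where
  "metric_measure_space \<mu> \<longleftrightarrow>
     separable_space (euclidean :: 'a topology) \<and> sets \<mu> = sets borel \<and>
     (\<forall>x r. r > 0 \<longrightarrow> 0 < emeasure \<mu> (ball x r) \<and> emeasure \<mu> (ball x r) < \<infinity>)"

text \<open>The library's real-valued \<^const>\<open>diameter\<close> is unspecified on unbounded sets, hence this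
  extended version.\<close>

definition ediameter :: "'a::metric_space set \<Rightarrow> ennreal" where
  "ediameter S = (SUP x\<in>S. SUP y\<in>S. ennreal (dist x y))"

definition ahlfors_regular :: "real \<Rightarrow> 'a::metric_space measure \<Rightarrow> bool" where
  "ahlfors_regular Q \<mu> \<longleftrightarrow>
     metric_measure_space \<mu> \<and> Q > 0 \<and>
     (\<exists>C>0. \<forall>x r. 0 < r \<and> ennreal r < ediameter (UNIV :: 'a set) \<longrightarrow>
        1 / C * r powr Q \<le> measure \<mu> (ball x r) \<and> measure \<mu> (ball x r) \<le> C * r powr Q)"

definition ahlfors_regular_space :: "real \<Rightarrow> 'a::metric_space itself \<Rightarrow> bool" where
  "ahlfors_regular_space Q _ \<longleftrightarrow> (\<exists>\<mu> :: 'a measure. ahlfors_regular Q \<mu>)"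

definition curve_length :: "(real \<Rightarrow> 'a::metric_space) \<Rightarrow> real \<Rightarrow> real \<Rightarrow> ennreal" where
  "curve_length \<gamma> a b =
     (SUP ts \<in> {ts. sorted ts \<and> set ts \<subseteq> {a..b}}.
        \<Sum>i < length ts - 1. ennreal (dist (\<gamma> (ts ! i)) (\<gamma> (ts ! Suc i))))"

definition rectifiable :: "(real \<Rightarrow> 'a::metric_space) \<Rightarrow> bool" where
  "rectifiable \<gamma> \<longleftrightarrow> path \<gamma> \<and> curve_length \<gamma> 0 1 < \<infinity>"

text \<open>For a rectifiable \<open>\<gamma>\<close> and \<open>s\<close> between 0 and its length, a parameter \<open>t\<close> as below exists, and
  \<open>\<gamma> t\<close> does not depend on its choice, since \<open>\<gamma>\<close> is constant on intervals where it has length 0.\<close>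

definition arclength_param :: "(real \<Rightarrow> 'a::metric_space) \<Rightarrow> real \<Rightarrow> 'a" where
  "arclength_param \<gamma> s = \<gamma> (SOME t. t \<in> {0..1} \<and> curve_length \<gamma> 0 t = ennreal s)"

definition curve_integral :: "(real \<Rightarrow> 'a::metric_space) \<Rightarrow> ('a \<Rightarrow> ennreal) \<Rightarrow> ennreal" where
  "curve_integral \<gamma> g =
     (\<integral>\<^sup>+ s \<in> {0..enn2real (curve_length \<gamma> 0 1)}. g (arclength_param \<gamma> s) \<partial>lborel)"

definition upper_gradient :: "('a::metric_space \<Rightarrow> ennreal) \<Rightarrow> ('a \<Rightarrow> real) \<Rightarrow> bool" where
  "upper_gradient g u \<longleftrightarrow>
     g \<in> borel_measurable borel \<and>
     (\<forall>\<gamma>. rectifiable \<gamma> \<longrightarrow> ennreal \<bar>u (\<gamma> 0) - u (\<gamma> 1)\<bar> \<le> curve_integral \<gamma> g)"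

text \<open>Meant for exponents \<open>a > 0\<close> only.\<close>

definition ennpowr :: "ennreal \<Rightarrow> real \<Rightarrow> ennreal" where
  "ennpowr x a = (if x = \<infinity> then \<infinity> else ennreal (enn2real x powr a))"

definition ball_average :: "'a::metric_space measure \<Rightarrow> 'a set \<Rightarrow> ('a \<Rightarrow> real) \<Rightarrow> real" where
  "ball_average \<mu> B u = 1 / measure \<mu> B * (LINT x:B|\<mu>. u x)"

text \<open>The mean value of \<open>u\<close> on a ball is defined only for \<open>u\<close> integrable there, so the inequality is
  required for such balls. Both sides are compared in \<^typ>\<open>ennreal\<close>, the right one may be infinite.\<close>

definition supports_poincare :: "real \<Rightarrow> 'a::metric_space measure \<Rightarrow> bool" where
  "supports_poincare p \<mu> \<longleftrightarrow>
     (\<exists>C>0. \<exists>\<Lambda>\<ge>1. \<forall>u g. upper_gradient g u \<longrightarrow>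
        (\<forall>x r. r > 0 \<and> set_integrable \<mu> (ball x r) u \<longrightarrow>
           (\<integral>\<^sup>+ z \<in> ball x r. ennreal \<bar>u z - ball_average \<mu> (ball x r) u\<bar> \<partial>\<mu>)
               / emeasure \<mu> (ball x r)
           \<le> ennreal C * ediameter (ball x r) *
             ennpowr ((\<integral>\<^sup>+ z \<in> ball x (\<Lambda> * r). ennpowr (g z) p \<partial>\<mu>)
                         / emeasure \<mu> (ball x (\<Lambda> * r))) (1 / p)))"

definition quasisymmetric ::
  "(real \<Rightarrow> real) \<Rightarrow> ('a::metric_space \<Rightarrow> 'b::metric_space) \<Rightarrow> bool" where
  "quasisymmetric \<eta> f \<longleftrightarrow>
     homeomorphic_map (top_of_set {0..}) (top_of_set {0..}) \<eta> \<and>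
     embedding_map euclidean euclidean f \<and>
     (\<forall>x y z. x \<noteq> y \<and> y \<noteq> z \<and> x \<noteq> z \<longrightarrow>
        dist (f x) (f y) / dist (f z) (f y) \<le> \<eta> (dist x y / dist z y))"

text \<open>The infimum is over \<^typ>\<open>enat\<close>, so it is \<open>\<infinity>\<close> when no finite cover exists.\<close>

definition covering_number :: "'a::metric_space set \<Rightarrow> real \<Rightarrow> enat" where
  "covering_number E r =
     (INF \<C> \<in> {\<C>. finite \<C> \<and> E \<subseteq> \<Union>\<C> \<and> (\<forall>A\<in>\<C>. ediameter A \<le> ennreal r)}. enat (card \<C>))"

definition ln_enat :: "enat \<Rightarrow> ereal" where
  "ln_enat N = (case N of enat n \<Rightarrow> if n = 0 then - \<infinity> else ereal (ln (real n)) | \<infinity> \<Rightarrow> \<infinity>)"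

definition minkowski_dim :: "'a::metric_space set \<Rightarrow> ereal" where
  "minkowski_dim E = Limsup (at_right 0) (\<lambda>r. ln_enat (covering_number E r) / ereal (ln (1 / r)))"

end

theory Submission
  imports Defs
begin

text \<open>Let \<open>\<nu>\<close> be the measure \<open>\<nu> A = \<mu>Y (f A)\<close> on \<open>X\<close>. The theorem says in essence that \<open>\<mu>\<close> and \<open>\<nu>\<close> are
comparable up to powers: there is \<open>\<delta> \<in> (0, 1)\<close> with \<open>\<nu> A \<le> K (\<mu> A)\<^sup>\<delta>\<close> and \<open>\<mu> A \<le> K (\<nu> A)\<^sup>\<delta>\<close> for all
finite unions \<open>A\<close> of balls in a bounded region, and \<open>p = Q / (1 - \<delta>)\<close>. This takes the place of the
higher integrability of the volume derivative of \<open>f\<close>; neither derivatives nor absolute continuity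
occur.

\<^emph>\<open>Only two numbers of \<open>\<eta>\<close> matter.\<close> Since \<open>\<eta>\<close> is increasing, the points with \<open>d(x, y) \<le> d(x, z)\<close> satisfy
\<open>d(f x, f y) \<le> H d(f x, f z)\<close> with \<open>H = max 1 (\<eta> 1)\<close>, and the inverse map satisfies the same with the
constant \<open>max 1 (1 / \<eta>\<^sup>-\<^sup>1(1))\<close>. The proof works with these two weak conditions. In a connected space with bounded
packing a weakly quasisymmetric map distorts balls in a doubling way (\<open>weak_qs_doubling\<close>), so \<open>\<nu>\<close> of a
ball of radius \<open>r\<close> is comparable to the power \<open>Q\<close> of the oscillation of \<open>f\<close> on it; the same statement
for the inverse map says that oscillations decay when the ball shrinks (\<open>f_decay\<close>). Connectedness is
a consequence of the Poincare inequality (\<open>poincare_connected\<close>).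

\<^emph>\<open>The analytic step.\<close> The function \<open>d(f x, f x\<^sub>0)\<close> is replaced, at a small scale \<open>\<delta>\<close>, by a locally
Lipschitz one, which has the upper gradient \<open>diam f(B(w, 8 \<delta>)) / \<delta>\<close>. The Poincare inequality for it
(\<open>energy_lower_bound\<close>) is a discrete reverse Hoelder inequality for \<open>\<nu>\<close>, with the exponent \<open>p\<^sub>0 / Q < 1\<close>.
Letting \<open>\<delta>\<close> tend to 0 one gets a weak A-infinity condition: a closed set that fills only a small
part of a ball in the sense of \<open>\<mu>\<close> misses a definite part of it in the sense of \<open>\<nu>\<close>
(\<open>quasisymmetric_A_inf\<close>). Its constants depend on \<open>f\<close> only through the two numbers above. Passing to
complements exchanges the roles of \<open>\<mu>\<close> and \<open>\<nu>\<close> (\<open>A_inf_swap\<close>); this is how the inverse map is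
treated without a Poincare inequality on \<open>Y\<close>.

\<^emph>\<open>Self-improvement.\<close> Enlarging a set by stopping-time balls, at which its \<open>\<mu>\<close>-density drops below a
threshold, multiplies \<open>\<mu>\<close> by at most a factor \<open>\<Gamma>\<close> and \<open>\<nu>\<close> by at least a factor \<open>\<beta> > 1\<close>
(\<open>A_inf_step\<close>). About \<open>log (1 / \<mu> A) / log \<Gamma>\<close> steps are possible in a bounded region, whence the power
bound with \<open>\<delta> = log \<beta> / log \<Gamma>\<close> (\<open>A_inf_power\<close>).

\<^emph>\<open>Dimension.\<close> Take points of \<open>E\<close> whose images are \<open>s\<close>-separated. Those for which \<open>f\<close> maps the ball of
radius \<open>r\<close> into the ball of radius \<open>s / 2\<close> are \<open>r\<close>-separated, so there are at most about \<open>r\<^sup>-\<^sup>d\<close> of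
them. The \<open>n\<close> others have pairwise disjoint balls of \<open>\<mu>\<close>-measure at most about \<open>r\<^sup>Q\<close> and of
\<open>\<nu>\<close>-measure at least about \<open>s\<^sup>Q\<close>, so the power bound gives \<open>n s\<^sup>Q \<le> K (n r\<^sup>Q)\<^sup>\<delta>\<close>, which is
\<open>n \<le> K' s\<^sup>-\<^sup>p r\<^sup>p\<^sup>-\<^sup>Q\<close>. The choice \<open>r = s powr (p / (p - Q + d))\<close> balances the two counts and gives the upper
bound \<open>p d / (p - Q + d)\<close> (\<open>minkowski_dim_image_le\<close>). The lower bound is the upper bound for the inverse
map, solved for the dimension of \<open>f E\<close>.\<close>

section \<open>Arc length and upper gradients\<close>

definition chain_length :: "(real \<Rightarrow> 'a::metric_space) \<Rightarrow> real list \<Rightarrow> ennreal" where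
  "chain_length \<gamma> ts = (\<Sum>i < length ts - 1. ennreal (dist (\<gamma> (ts ! i)) (\<gamma> (ts ! Suc i))))"

lemma chain_length_simps [simp]:
  "chain_length \<gamma> [] = 0"
  "chain_length \<gamma> [x] = 0"
  "chain_length \<gamma> (x # y # zs) = ennreal (dist (\<gamma> x) (\<gamma> y)) + chain_length \<gamma> (y # zs)"
  by (simp_all add: chain_length_def sum.lessThan_Suc_shift del: sum.lessThan_Suc)

lemma chain_length_append: "chain_length \<gamma> ts + chain_length \<gamma> us \<le> chain_length \<gamma> (ts @ us)"
proof (induction ts rule: induct_list012)
  case (2 x)
  then show ?case by (cases us) (auto simp: add_increasing)
next
  case (3 x y zs)
  then show ?case by (simp add: add.assoc add_left_mono)
qed simp

lemma curve_length_alt: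
  "curve_length \<gamma> a b = (SUP ts \<in> {ts. sorted ts \<and> set ts \<subseteq> {a..b}}. chain_length \<gamma> ts)"
  by (simp add: curve_length_def chain_length_def)

lemma chain_length_le:
  "sorted ts \<Longrightarrow> set ts \<subseteq> {a..b} \<Longrightarrow> chain_length \<gamma> ts \<le> curve_length \<gamma> a b"
  unfolding curve_length_alt by (rule SUP_upper) simp

lemma dist_le_curve_length: "s \<le> t \<Longrightarrow> ennreal (dist (\<gamma> s) (\<gamma> t)) \<le> curve_length \<gamma> s t"
  using chain_length_le[of "[s,t]" s t \<gamma>] by simp

lemma curve_length_superadditive:
  assumes "a \<le> t" "t \<le> b"
  shows "curve_length \<gamma> a t + curve_length \<gamma> t b \<le> curve_length \<gamma> a b"
proof -
  let ?S = "\<lambda>a b. {ts. sorted ts \<and> set ts \<subseteq> {a..b::real}}"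
  have ne: "?S a b \<noteq> {}" for a b by (auto intro!: exI[of _ "[]"])
  have "chain_length \<gamma> ts + chain_length \<gamma> us \<le> curve_length \<gamma> a b"
    if "ts \<in> ?S a t" "us \<in> ?S t b" for ts us
  proof -
    have "sorted (ts @ us)" "set (ts @ us) \<subseteq> {a..b}"
      using that assms by (fastforce simp: sorted_append)+
    from chain_length_le[OF this, of \<gamma>] chain_length_append[of \<gamma> ts us] show ?thesis
      by (rule order_trans[rotated])
  qed
  then have "chain_length \<gamma> ts + curve_length \<gamma> t b \<le> curve_length \<gamma> a b"
    if "ts \<in> ?S a t" for ts
    using that unfolding curve_length_alt[of \<gamma> t b]
    by (subst ennreal_SUP_add_right[OF ne]) (auto intro!: SUP_least)
  then show ?thesis
    unfolding curve_length_alt[of \<gamma> a t]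
    by (subst ennreal_SUP_add_left[OF ne, symmetric]) (auto intro!: SUP_least)
qed

text \<open>The lists of \<open>min\<close> and \<open>max\<close> with \<open>t\<close> are the pieces of the chain before and after \<open>t\<close>, with
\<open>t\<close> inserted; points on the wrong side collapse to \<open>t\<close> and contribute nothing. So no list surgery is
needed to show that length is additive.\<close>

lemma chain_length_split:
  assumes "sorted ts"
  shows "chain_length \<gamma> ts \<le> chain_length \<gamma> (map (min t) ts) + chain_length \<gamma> (map (max t) ts)"
  using assms
proof (induction ts rule: induct_list012)
  case (3 x y zs)
  have "dist (\<gamma> x) (\<gamma> y) \<le> dist (\<gamma> (min t x)) (\<gamma> (min t y)) + dist (\<gamma> (max t x)) (\<gamma> (max t y))"
    using 3(3) dist_triangle[of "\<gamma> x" "\<gamma> y" "\<gamma> t"] by (auto simp: min_def max_def)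
  then have "ennreal (dist (\<gamma> x) (\<gamma> y)) \<le> ennreal (dist (\<gamma> (min t x)) (\<gamma> (min t y)))
      + ennreal (dist (\<gamma> (max t x)) (\<gamma> (max t y)))"
    by (simp flip: ennreal_plus)
  from add_mono[OF this 3(2)] 3(3) show ?case
    by (simp add: ac_simps)
qed simp_all

lemma curve_length_subadditive:
  assumes "a \<le> t" "t \<le> b"
  shows "curve_length \<gamma> a b \<le> curve_length \<gamma> a t + curve_length \<gamma> t b"
  unfolding curve_length_alt[of \<gamma> a b]
proof (rule SUP_least, clarify)
  fix ts assume ts: "sorted ts" "set ts \<subseteq> {a..b}"
  have "chain_length \<gamma> (map (min t) ts) \<le> curve_length \<gamma> a t"
    using ts assms by (intro chain_length_le sorted_map_mono) (auto simp: min_def monotone_on_def)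
  moreover have "chain_length \<gamma> (map (max t) ts) \<le> curve_length \<gamma> t b"
    using ts assms by (intro chain_length_le sorted_map_mono) (auto simp: max_def monotone_on_def)
  ultimately show "chain_length \<gamma> ts \<le> curve_length \<gamma> a t + curve_length \<gamma> t b"
    using chain_length_split[OF ts(1), of \<gamma> t] by (meson add_mono order_trans)
qed

lemma curve_length_add:
  "a \<le> t \<Longrightarrow> t \<le> b \<Longrightarrow> curve_length \<gamma> a b = curve_length \<gamma> a t + curve_length \<gamma> t b"
  by (intro antisym curve_length_subadditive curve_length_superadditive)

lemma curve_length_refl [simp]: "curve_length \<gamma> a a = 0"
proof -
  have "chain_length \<gamma> ts = 0" if "set ts \<subseteq> {a}" for ts
    using that by (induction ts rule: induct_list012) auto
  then have "curve_length \<gamma> a a \<le> 0"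
    unfolding curve_length_alt by (intro SUP_least) auto
  then show ?thesis by simp
qed

lemma tendsto_chain_length_map:
  assumes "\<And>a. a \<in> set ts \<Longrightarrow> ((\<lambda>t. \<gamma> (p t a)) \<longlongrightarrow> \<gamma> a) F"
  shows "((\<lambda>t. chain_length \<gamma> (map (p t) ts)) \<longlongrightarrow> chain_length \<gamma> ts) F"
proof -
  have "((\<lambda>t. ennreal (dist (\<gamma> (map (p t) ts ! i)) (\<gamma> (map (p t) ts ! Suc i))))
      \<longlongrightarrow> ennreal (dist (\<gamma> (ts ! i)) (\<gamma> (ts ! Suc i)))) F" if "i < length ts - 1" for i
    using that assms[of "ts ! i"] assms[of "ts ! Suc i"]
    by (intro tendsto_ennrealI tendsto_dist) (auto simp: less_diff_conv)
  then show ?thesis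
    unfolding chain_length_def length_map by (intro tendsto_sum) auto
qed

text \<open>Length does not jump at \<open>t\<close> from the left: cutting a fixed chain off at \<open>t' < t\<close> changes its length
continuously because the curve is continuous.\<close>

lemma curve_length_left_limit:
  assumes \<gamma>: "continuous_on {a..b} \<gamma>" and t: "a < t" "t \<le> b"
    and le: "\<And>t'. a \<le> t' \<Longrightarrow> t' < t \<Longrightarrow> curve_length \<gamma> a t' \<le> s"
  shows "curve_length \<gamma> a t \<le> s"
  unfolding curve_length_alt[of \<gamma> a t]
proof (rule SUP_least, clarify)
  fix ts assume ts: "sorted ts" "set ts \<subseteq> {a..t}"
  have near: "eventually (\<lambda>t'. t' \<in> {a<..<t}) (at_left t)"
    using t(1) by (rule eventually_at_left_real)
  have "((\<lambda>t'. chain_length \<gamma> (map (min t') ts)) \<longlongrightarrow> chain_length \<gamma> ts) (at_left t)"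
  proof (rule tendsto_chain_length_map)
    fix c assume c: "c \<in> set ts"
    have "((\<lambda>t'. min t' c) \<longlongrightarrow> min t c) (at_left t)" by (intro tendsto_intros)
    then have lim: "((\<lambda>t'. min t' c) \<longlongrightarrow> c) (at_left t)" using c ts by (auto simp: min.absorb2)
    show "((\<lambda>t'. \<gamma> (min t' c)) \<longlongrightarrow> \<gamma> c) (at_left t)"
      using c ts t
      by (intro continuous_on_tendsto_compose[OF \<gamma> lim])
         (auto intro!: eventually_mono[OF near])
  qed
  moreover have "eventually (\<lambda>t'. chain_length \<gamma> (map (min t') ts) \<le> s) (at_left t)"
  proof (rule eventually_mono[OF near])
    fix t' assume t': "t' \<in> {a<..<t}"
    have "chain_length \<gamma> (map (min t') ts) \<le> curve_length \<gamma> a t'"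
      using ts t' by (intro chain_length_le sorted_map_mono) (auto simp: min_def monotone_on_def)
    then show "chain_length \<gamma> (map (min t') ts) \<le> s"
      using le[of t'] t' by auto
  qed
  ultimately show "chain_length \<gamma> ts \<le> s"
    by (intro tendsto_upperbound) auto
qed

lemma curve_length_right_limit:
  assumes \<gamma>: "continuous_on {a..b} \<gamma>" and t: "a \<le> t" "t < b"
    and le: "\<And>t'. t < t' \<Longrightarrow> t' \<le> b \<Longrightarrow> curve_length \<gamma> t' b \<le> s"
  shows "curve_length \<gamma> t b \<le> s"
  unfolding curve_length_alt[of \<gamma> t b]
proof (rule SUP_least, clarify)
  fix ts assume ts: "sorted ts" "set ts \<subseteq> {t..b}"
  have near: "eventually (\<lambda>t'. t' \<in> {t<..<b}) (at_right t)"
    using t(2) by (rule eventually_at_right_real)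
  have "((\<lambda>t'. chain_length \<gamma> (map (max t') ts)) \<longlongrightarrow> chain_length \<gamma> ts) (at_right t)"
  proof (rule tendsto_chain_length_map)
    fix c assume c: "c \<in> set ts"
    have "((\<lambda>t'. max t' c) \<longlongrightarrow> max t c) (at_right t)" by (intro tendsto_intros)
    then have lim: "((\<lambda>t'. max t' c) \<longlongrightarrow> c) (at_right t)" using c ts by (auto simp: max.absorb2)
    show "((\<lambda>t'. \<gamma> (max t' c)) \<longlongrightarrow> \<gamma> c) (at_right t)"
      using c ts t
      by (intro continuous_on_tendsto_compose[OF \<gamma> lim])
         (auto intro!: eventually_mono[OF near])
  qed
  moreover have "eventually (\<lambda>t'. chain_length \<gamma> (map (max t') ts) \<le> s) (at_right t)"
  proof (rule eventually_mono[OF near])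
    fix t' assume t': "t' \<in> {t<..<b}"
    have "chain_length \<gamma> (map (max t') ts) \<le> curve_length \<gamma> t' b"
      using ts t' by (intro chain_length_le sorted_map_mono) (auto simp: max_def monotone_on_def)
    then show "chain_length \<gamma> (map (max t') ts) \<le> s"
      using le[of t'] t' by auto
  qed
  ultimately show "chain_length \<gamma> ts \<le> s"
    by (intro tendsto_upperbound) auto
qed

text \<open>The arc length parameter exists for every \<open>s\<close>: at the last time \<open>T\<close> at which the length is at most
\<open>s\<close>, left continuity bounds the length from above, and right continuity, applied to the length of
the remaining piece, bounds it from below.\<close>

lemma ex_curve_length_eq:
  assumes \<gamma>: "continuous_on {0..1} \<gamma>" and fin: "curve_length \<gamma> 0 1 < \<infinity>"
    and s: "0 \<le> s" "ennreal s \<le> curve_length \<gamma> 0 1"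
  shows "\<exists>t \<in> {0..1}. curve_length \<gamma> 0 t = ennreal s"
proof -
  define S where "S = {t \<in> {0..1}. curve_length \<gamma> 0 t \<le> ennreal s}"
  define T where "T = Sup S"
  have S0: "0 \<in> S" by (simp add: S_def)
  have bdd: "bdd_above S" by (auto simp: S_def bdd_above_def)
  have T01: "0 \<le> T" "T \<le> 1"
    using cSup_upper[OF S0 bdd] by (auto simp: T_def) (use S0 in \<open>auto intro!: cSup_least simp: S_def\<close>)
  have mono: "curve_length \<gamma> 0 t \<le> curve_length \<gamma> 0 t'" if "0 \<le> t" "t \<le> t'" for t t'
    using curve_length_add[OF that, of \<gamma>] by simp
  have low: "curve_length \<gamma> 0 t \<le> ennreal s" if t: "0 \<le> t" "t < T" for t
  proof -
    obtain t' where t': "t' \<in> S" "t < t'"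
      using t less_cSup_iff[OF _ bdd, of t] S0 unfolding T_def by blast
    have "curve_length \<gamma> 0 t \<le> curve_length \<gamma> 0 t'" using t t' by (intro mono) auto
    also have "\<dots> \<le> ennreal s" using t' by (simp add: S_def)
    finally show ?thesis .
  qed
  have "curve_length \<gamma> 0 T \<le> ennreal s"
  proof (cases "T = 0")
    case False
    with T01 have "0 < T" by simp
    from curve_length_left_limit[OF \<gamma> this T01(2) low] show ?thesis .
  qed simp
  moreover have "ennreal s \<le> curve_length \<gamma> 0 T"
  proof (cases "T = 1")
    case True
    then show ?thesis using s by simp
  next
    case False
    have "curve_length \<gamma> t' 1 \<le> curve_length \<gamma> 0 1 - ennreal s" if t': "T < t'" "t' \<le> 1" for t'
    proof -
      have "t' \<notin> S" using t' cSup_upper[OF _ bdd, of t'] unfolding T_def by fastforce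
      then have "ennreal s \<le> curve_length \<gamma> 0 t'" using t' T01 by (auto simp: S_def)
      then have "ennreal s + curve_length \<gamma> t' 1 \<le> curve_length \<gamma> 0 1"
        using curve_length_add[of 0 t' 1 \<gamma>] t' T01 by (auto intro: add_right_mono)
      then show ?thesis
        by (simp add: ennreal_le_minus_iff add.commute)
    qed
    then have "curve_length \<gamma> T 1 \<le> curve_length \<gamma> 0 1 - ennreal s"
      using False T01 by - (rule curve_length_right_limit[OF \<gamma>], auto)
    then have "curve_length \<gamma> 0 1 \<le> curve_length \<gamma> 0 T + (curve_length \<gamma> 0 1 - ennreal s)"
      using curve_length_add[of 0 T 1 \<gamma>] T01 by (auto intro: add_left_mono)
    then have le: "ennreal s + (curve_length \<gamma> 0 1 - ennreal s)
        \<le> curve_length \<gamma> 0 T + (curve_length \<gamma> 0 1 - ennreal s)"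
      using s(2) by (simp add: add_diff_inverse_ennreal)
    have "curve_length \<gamma> 0 1 - ennreal s < \<infinity>" using fin
      by (metis diff_le_self_ennreal le_less_trans)
    with le show ?thesis
      by (simp add: add.commute[of _ "curve_length \<gamma> 0 1 - ennreal s"] ennreal_add_left_cancel_le
        less_top[symmetric])
  qed
  ultimately show ?thesis using T01 by (auto intro!: bexI[of _ T])
qed

lemma arclength_param_point:
  assumes "rectifiable \<gamma>" "0 \<le> s" "s \<le> enn2real (curve_length \<gamma> 0 1)"
  shows "\<exists>t \<in> {0..1}. curve_length \<gamma> 0 t = ennreal s \<and> arclength_param \<gamma> s = \<gamma> t"
proof -
  have "\<exists>t. t \<in> {0..1} \<and> curve_length \<gamma> 0 t = ennreal s"
  proof -
    have "ennreal s \<le> ennreal (enn2real (curve_length \<gamma> 0 1))"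
      using assms by (intro ennreal_leI)
    also have "\<dots> = curve_length \<gamma> 0 1" using assms(1) by (simp add: rectifiable_def)
    finally show ?thesis
      using ex_curve_length_eq[of \<gamma> s] assms
      unfolding rectifiable_def path_def by (simp add: Bex_def top.not_eq_extremum)
  qed
  then show ?thesis
    unfolding arclength_param_def by (metis (mono_tags, lifting) someI_ex)
qed

lemma dist_le_curve_length_diff:
  assumes "0 \<le> t" "0 \<le> t'" "curve_length \<gamma> 0 t = ennreal s" "curve_length \<gamma> 0 t' = ennreal s'"
    "0 \<le> s" "0 \<le> s'"
  shows "dist (\<gamma> t) (\<gamma> t') \<le> \<bar>s - s'\<bar>"
  using assms
proof (induction t t' arbitrary: s s' rule: linorder_wlog)
  case (le t t')
  have "ennreal (s + dist (\<gamma> t) (\<gamma> t')) \<le> ennreal s'"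
    using le curve_length_add[of 0 t t' \<gamma>] dist_le_curve_length[of t t' \<gamma>]
    by (simp add: ennreal_plus) (metis add_left_mono)
  then have "s + dist (\<gamma> t) (\<gamma> t') \<le> s'"
    using le(6,7) by (subst (asm) ennreal_le_iff) auto
  then show ?case by simp
next
  case (sym t t')
  then show ?case by (metis abs_minus_commute dist_commute)
qed

text \<open>A criterion that avoids differentiation along curves. Subdivide the arc length interval finely; on
each piece the increment of \<open>u\<close> is at most its length times \<^emph>\<open>every\<close> value of \<open>g\<close> there, hence at most the
integral of \<open>g\<close> over it.\<close>

lemma upper_gradientI_local:
  fixes u :: "'a::metric_space \<Rightarrow> real"
  assumes g: "g \<in> borel_measurable borel" and \<delta>: "\<delta> > 0"
    and est: "\<And>x x' w. dist x x' \<le> \<delta> \<Longrightarrow> dist w x \<le> \<delta> \<Longrightarrow>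
      ennreal \<bar>u x - u x'\<bar> \<le> ennreal (dist x x') * g w"
  shows "upper_gradient g u"
  unfolding upper_gradient_def
proof (intro conjI g allI impI)
  fix \<gamma> :: "real \<Rightarrow> 'a" assume rect: "rectifiable \<gamma>"
  define L where "L = enn2real (curve_length \<gamma> 0 1)"
  have L0: "0 \<le> L" by (simp add: L_def)
  have L1: "curve_length \<gamma> 0 1 = ennreal L"
    using rect by (simp add: L_def rectifiable_def)
  define \<sigma> where "\<sigma> = arclength_param \<gamma>"
  have point: "\<exists>t \<in> {0..1}. curve_length \<gamma> 0 t = ennreal s \<and> \<sigma> s = \<gamma> t" if "0 \<le> s" "s \<le> L" for s
    using arclength_param_point[OF rect that(1)] that by (simp add: L_def \<sigma>_def)
  have lip: "dist (\<sigma> s) (\<sigma> s') \<le> \<bar>s - s'\<bar>" if s: "0 \<le> s" "s \<le> L" "0 \<le> s'" "s' \<le> L" for s s'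
    using point[OF s(1,2)] point[OF s(3,4)] dist_le_curve_length_diff s by (metis atLeastAtMost_iff)
  have \<sigma>0: "\<sigma> 0 = \<gamma> 0"
  proof -
    obtain t where t: "t \<in> {0..1}" "curve_length \<gamma> 0 t = ennreal 0" "\<sigma> 0 = \<gamma> t"
      using point[of 0] L0 by auto
    from dist_le_curve_length_diff[of t 0 \<gamma> 0 0] t show ?thesis by simp
  qed
  have \<sigma>L: "\<sigma> L = \<gamma> 1"
  proof -
    obtain t where t: "t \<in> {0..1}" "curve_length \<gamma> 0 t = ennreal L" "\<sigma> L = \<gamma> t"
      using point[of L] L0 by auto
    from dist_le_curve_length_diff[of t 1 \<gamma> L L] t L1 L0 show ?thesis by simp
  qed
  show "ennreal \<bar>u (\<gamma> 0) - u (\<gamma> 1)\<bar> \<le> curve_integral \<gamma> g"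
  proof (cases "L = 0")
    case True
    then show ?thesis using \<sigma>0 \<sigma>L by simp
  next
    case False
    then have Lpos: "L > 0" using L0 by simp
    obtain n :: nat where n: "L / \<delta> < real n" using reals_Archimedean2 by blast
    have npos: "n > 0" using n Lpos \<delta> by (metis divide_pos_pos gr0I of_nat_0 order_less_asym)
    define h where "h = L / n"
    have h: "0 < h" "h \<le> \<delta>" "n * h = L"
      using n npos Lpos \<delta> by (auto simp: h_def field_simps)
    define x where "x k = \<sigma> (real k * h)" for k :: nat
    define c where "c k = ennreal (\<bar>u (x k) - u (x (Suc k))\<bar> / h)" for k
    have kh: "real k * h \<le> L" if "k \<le> n" for k
      using that h by (metis mult_right_mono of_nat_le_iff less_imp_le)
    have ptw: "c k \<le> g (\<sigma> s)" if k: "k < n" and s: "real k * h \<le> s" "s \<le> (real k + 1) * h" for k s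
    proof -
      have sL: "(real k + 1) * h \<le> L" using kh[of "Suc k"] k by (simp add: algebra_simps)
      have k0: "0 \<le> real k * h" using h by simp
      have hk: "(real k + 1) * h = real k * h + h" by (simp add: algebra_simps)
      have d1: "dist (x k) (x (Suc k)) \<le> h"
        using lip[of "real k * h" "(real k + 1) * h"] sL k0 h hk by (simp add: x_def add.commute)
      have d2: "dist (\<sigma> s) (x k) \<le> h"
        using lip[of s "real k * h"] sL k0 h hk s by (simp add: x_def)
      have "ennreal \<bar>u (x k) - u (x (Suc k))\<bar> \<le> ennreal (dist (x k) (x (Suc k))) * g (\<sigma> s)"
        using d1 d2 h by (intro est) auto
      also have "\<dots> \<le> ennreal h * g (\<sigma> s)"
        using d1 by (intro mult_right_mono ennreal_leI) auto
      finally have "ennreal (1 / h) * ennreal \<bar>u (x k) - u (x (Suc k))\<bar>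
          \<le> ennreal (1 / h) * (ennreal h * g (\<sigma> s))"
        by (intro mult_left_mono) auto
      also have "\<dots> = g (\<sigma> s)"
        using h by (simp add: mult.assoc[symmetric] ennreal_mult[symmetric])
      finally show ?thesis
        using h by (simp add: c_def ennreal_mult[symmetric])
    qed
    \<comment> \<open>The step function with the value \<open>c k\<close> on \<open>I k\<close> lies below \<open>g\<close> along the curve, and its integral is
      the sum of the increments of \<open>u\<close>.\<close>
    define I where "I k = {real k * h ..< (real k + 1) * h}" for k :: nat
    have "\<bar>u (\<gamma> 0) - u (\<gamma> 1)\<bar> \<le> (\<Sum>k<n. \<bar>u (x k) - u (x (Suc k))\<bar>)"
    proof -
      have "\<bar>u (x 0) - u (x m)\<bar> \<le> (\<Sum>k<m. \<bar>u (x k) - u (x (Suc k))\<bar>)" for m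
        by (induction m) auto
      from this[of n] show ?thesis using \<sigma>0 \<sigma>L h by (simp add: x_def)
    qed
    then have "ennreal \<bar>u (\<gamma> 0) - u (\<gamma> 1)\<bar> \<le> ennreal (\<Sum>k<n. \<bar>u (x k) - u (x (Suc k))\<bar>)"
      by (rule ennreal_leI)
    also have "\<dots> = (\<Sum>k<n. c k * emeasure lborel (I k))"
    proof -
      have "emeasure lborel (I k) = ennreal h" for k
        using h by (simp add: I_def algebra_simps)
      then show ?thesis
        using h by (simp add: c_def ennreal_mult[symmetric] sum_ennreal)
    qed
    also have "\<dots> = (\<integral>\<^sup>+ s. (\<Sum>k<n. c k * indicator (I k) s) \<partial>lborel)"
      by (subst nn_integral_sum) (auto simp: I_def nn_integral_cmult_indicator)
    also have "\<dots> \<le> (\<integral>\<^sup>+ s. g (\<sigma> s) * indicator {0..L} s \<partial>lborel)"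
    proof (rule nn_integral_mono)
      fix s :: real
      show "(\<Sum>k<n. c k * indicator (I k) s) \<le> g (\<sigma> s) * indicator {0..L} s"
      proof (cases "\<exists>j<n. s \<in> I j")
        case True
        then obtain j where j: "j < n" "s \<in> I j" by blast
        have uniq: "k = j" if "s \<in> I k" for k
        proof -
          have "real k \<le> s / h" "s / h < real k + 1" "real j \<le> s / h" "s / h < real j + 1"
            using that j h by (auto simp: I_def field_simps)
          then show ?thesis by linarith
        qed
        have "(\<Sum>k<n. c k * indicator (I k) s) = (\<Sum>k<n. if k = j then c j else 0)"
        proof (rule sum.cong[OF refl])
          fix k show "c k * indicator (I k) s = (if k = j then c j else 0)"
          proof (cases "k = j")
            case True
            with j(2) show ?thesis by simp
          next
            case False
            then have "s \<notin> I k" using uniq by blast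
            with False show ?thesis by simp
          qed
        qed
        also have "\<dots> = c j" using j by simp
        also have "\<dots> \<le> g (\<sigma> s)" using ptw[of j s] j by (auto simp: I_def)
        finally have le: "(\<Sum>k<n. c k * indicator (I k) s) \<le> g (\<sigma> s)" .
        show ?thesis
        proof -
          have "0 \<le> real j * h" "real (Suc j) * h \<le> L" using h j kh[of "Suc j"] by simp_all
          moreover have "real j * h \<le> s" "s < real (Suc j) * h"
            using j by (simp_all add: I_def add.commute)
          ultimately have "s \<in> {0..L}" by simp
          with le show ?thesis by (simp del: sum_mult_indicator)
        qed
      next
        case False
        then have "(\<Sum>k<n. c k * indicator (I k) s) = 0" by (intro sum.neutral) auto
        then show ?thesis by simp
      qed
    qed
    finally show ?thesis
      by (simp add: curve_integral_def L_def \<sigma>_def)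
  qed
qed

section \<open>Measures on balls, regularity and packing\<close>

definition finite_on_balls :: "'a::metric_space measure \<Rightarrow> bool" where
  "finite_on_balls m \<longleftrightarrow> sets m = sets borel \<and> (\<forall>x r. emeasure m (ball x r) < \<infinity>)"

lemma finite_on_balls_fmeasurable:
  assumes "finite_on_balls m" "S \<in> sets borel" "bounded S"
  shows "S \<in> fmeasurable m"
proof -
  obtain x r where sub: "S \<subseteq> ball x r"
    using bounded_subset_ballD[OF assms(3)] by blast
  have "ball x r \<in> fmeasurable m"
    using assms(1) by (auto simp: finite_on_balls_def fmeasurable_def)
  then show ?thesis
    using sub by (rule fmeasurableI2) (use assms(1,2) in \<open>simp add: finite_on_balls_def\<close>)
qed

lemma measure_mono_balls:
  assumes "finite_on_balls m" "S \<subseteq> T" "S \<in> sets borel" "T \<in> sets borel" "bounded T"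
  shows "measure m S \<le> measure m T"
proof (rule measure_mono_fmeasurable[OF assms(2)])
  show "S \<in> sets m" using assms(1,3) by (simp add: finite_on_balls_def)
  show "T \<in> fmeasurable m" using assms(1,4,5) by (rule finite_on_balls_fmeasurable)
qed

lemma sum_measure_disjoint_le:
  assumes m: "finite_on_balls m" and "finite I" "\<And>i. i \<in> I \<Longrightarrow> A i \<in> sets borel"
    and sub: "\<And>i. i \<in> I \<Longrightarrow> A i \<subseteq> B" and B: "B \<in> sets borel" "bounded B"
    and disj: "disjoint_family_on A I"
  shows "(\<Sum>i\<in>I. measure m (A i)) \<le> measure m B"
proof -
  have fm: "A i \<in> fmeasurable m" if "i \<in> I" for i
    using m assms(3)[OF that] bounded_subset[OF B(2) sub[OF that]]
    by (rule finite_on_balls_fmeasurable)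
  have "(\<Sum>i\<in>I. measure m (A i)) = measure m (\<Union>i\<in>I. A i)"
    using assms(2) fm disj by (intro measure_UNION'[symmetric])
      (auto simp: disjoint_family_on_def pairwise_def disjnt_def)
  also have "\<dots> \<le> measure m B"
    using assms(2,3) sub by (intro measure_mono_balls[OF m _ _ B] sets.finite_UN UN_least) simp_all
  finally show ?thesis .
qed

lemma measure_finite_union_le:
  assumes m: "finite_on_balls m" and "finite I" "\<And>i. i \<in> I \<Longrightarrow> A i \<in> sets borel"
    "\<And>i. i \<in> I \<Longrightarrow> bounded (A i)" and sub: "S \<subseteq> (\<Union>i\<in>I. A i)" and S: "S \<in> sets borel"
  shows "measure m S \<le> (\<Sum>i\<in>I. measure m (A i))"
proof -
  have "measure m S \<le> measure m (\<Union>i\<in>I. A i)"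
    using assms(2-4) by (intro measure_mono_balls[OF m sub S] sets.finite_UN bounded_UN) simp_all
  also have "\<dots> \<le> (\<Sum>i\<in>I. measure m (A i))"
    using assms(2,3) m by (intro measure_UNION_le) (simp_all add: finite_on_balls_def)
  finally show ?thesis .
qed

text \<open>Ahlfors regularity with the constant made explicit and the upper bound extended to all radii. The
radius in the lower bound is compared with a single distance, which is what one has at hand in
applications.\<close>

definition regular_bounds :: "real \<Rightarrow> real \<Rightarrow> 'a::metric_space measure \<Rightarrow> bool" where
  "regular_bounds Q C m \<longleftrightarrow> finite_on_balls m \<and> Q > 0 \<and> C \<ge> 1 \<and>
     (\<forall>x r. 0 < r \<longrightarrow> measure m (ball x r) \<le> C * r powr Q) \<and>
     (\<forall>x r. \<forall>a b :: 'a. 0 < r \<and> r < dist a b \<longrightarrow> r powr Q / C \<le> measure m (ball x r))"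

lemma regular_boundsD:
  assumes "regular_bounds Q C (m :: 'a::metric_space measure)"
  shows "finite_on_balls m" "Q > 0" "C \<ge> 1"
    "0 < r \<Longrightarrow> measure m (ball x r) \<le> C * r powr Q"
    "0 < r \<Longrightarrow> r < dist a (b :: 'a) \<Longrightarrow> r powr Q / C \<le> measure m (ball x r)"
  using assms unfolding regular_bounds_def by (simp, simp, simp, simp, blast)

lemma regular_bounds_mono:
  assumes "regular_bounds Q C m" "C \<le> C'"
  shows "regular_bounds Q C' m"
proof -
  have "C * r powr Q \<le> C' * r powr Q" for r using assms by (simp add: mult_right_mono)
  moreover have "r powr Q / C' \<le> r powr Q / C" for r
    using assms(2) regular_boundsD(3)[OF assms(1)] by (intro divide_left_mono mult_pos_pos) auto
  ultimately show ?thesis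
    using regular_boundsD[OF assms(1)] assms(2) unfolding regular_bounds_def
    by (intro conjI allI impI) (blast intro: order_trans)+
qed

lemma dist_le_ediameter: "x \<in> S \<Longrightarrow> y \<in> S \<Longrightarrow> ennreal (dist x y) \<le> ediameter S"
  unfolding ediameter_def by (rule SUP_upper2[of x], assumption, rule SUP_upper)

lemma ediameter_leI:
  "(\<And>x y. x \<in> S \<Longrightarrow> y \<in> S \<Longrightarrow> ennreal (dist x y) \<le> d) \<Longrightarrow> ediameter S \<le> d"
  unfolding ediameter_def by (intro SUP_least)

text \<open>Only the upper bound for radii beyond the diameter \<open>D\<close> needs an argument: such a ball is the whole
space, which has finite measure, and this measure is absorbed into the constant. Two different points
are needed for \<open>D > 0\<close>.\<close>

lemma ahlfors_regular_bounds:
  fixes m :: "'a::metric_space measure"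
  assumes reg: "ahlfors_regular Q m" and ab: "a0 \<noteq> (b0 :: 'a)"
  shows "\<exists>C. regular_bounds Q C m"
proof -
  obtain C where C: "C > 0" and bds: "\<And>x r. 0 < r \<Longrightarrow> ennreal r < ediameter (UNIV :: 'a set) \<Longrightarrow>
        1 / C * r powr Q \<le> measure m (ball x r) \<and> measure m (ball x r) \<le> C * r powr Q"
    using reg unfolding ahlfors_regular_def by blast
  have Q: "Q > 0" and fin: "finite_on_balls m"
  proof -
    have "emeasure m (ball x r) < \<infinity>" for x r
      using reg by (cases "r > 0") (auto simp: ahlfors_regular_def metric_measure_space_def ball_empty)
    then show "Q > 0" "finite_on_balls m"
      using reg by (auto simp: ahlfors_regular_def metric_measure_space_def finite_on_balls_def)
  qed
  define D where "D = enn2real (ediameter (UNIV :: 'a set))"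
  define C' where "C' = max (max C 1) (measure m UNIV / D powr Q)"
  have up: "measure m (ball x r) \<le> C' * r powr Q" if r: "0 < r" for x r
  proof (cases "ennreal r < ediameter (UNIV :: 'a set)")
    case True
    then have "measure m (ball x r) \<le> C * r powr Q" using bds r by blast
    also have "\<dots> \<le> C' * r powr Q" by (intro mult_right_mono) (auto simp: C'_def)
    finally show ?thesis .
  next
    case False
    then have le: "ediameter (UNIV :: 'a set) \<le> ennreal r" by simp
    then have Dr: "D \<le> r" using r unfolding D_def
      by (metis enn2real_mono enn2real_ennreal ennreal_less_top less_imp_le)
    have dD: "dist a b \<le> D" for a b :: 'a
    proof -
      have "enn2real (ennreal (dist a b)) \<le> D" unfolding D_def
        using dist_le_ediameter[of a UNIV b] le
        by (intro enn2real_mono) (auto intro: le_less_trans)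
      then show ?thesis by simp
    qed
    have D0: "0 < D" using dD[of a0 b0] ab by (metis order_less_le_trans zero_less_dist_iff)
    have bdd: "bounded (UNIV :: 'a set)" using dD by (auto simp: bounded_def)
    have "measure m (ball x r) \<le> measure m UNIV"
      using fin bdd by (intro measure_mono_balls) auto
    also have "\<dots> = measure m UNIV / D powr Q * D powr Q" using D0 by simp
    also have "\<dots> \<le> C' * r powr Q"
      using Dr D0 Q C by (intro mult_mono powr_mono2) (auto simp: C'_def)
    finally show ?thesis .
  qed
  have lo: "r powr Q / C' \<le> measure m (ball x r)" if r: "0 < r" "r < dist a b" for x r and a b :: 'a
  proof -
    have "ennreal r < ediameter (UNIV :: 'a set)"
      using r dist_le_ediameter[of a UNIV b] by (intro order_less_le_trans[OF ennreal_lessI]) auto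
    then have "1 / C * r powr Q \<le> measure m (ball x r)" using bds r by blast
    moreover have "r powr Q / C' \<le> r powr Q / C"
      using C by (intro divide_left_mono) (auto simp: C'_def)
    ultimately show ?thesis by simp
  qed
  have "C' \<ge> 1" by (auto simp: C'_def)
  then show ?thesis
    using fin Q up lo by (auto simp: regular_bounds_def intro!: exI[of _ C'])
qed

definition separated :: "real \<Rightarrow> 'a::metric_space set \<Rightarrow> bool" where
  "separated r F \<longleftrightarrow> (\<forall>a\<in>F. \<forall>b\<in>F. a \<noteq> b \<longrightarrow> r \<le> dist a b)"

lemma disjoint_balls_separated:
  "separated r F \<Longrightarrow> s \<le> r / 2 \<Longrightarrow> disjoint_family_on (\<lambda>a. ball a s) F"
proof (clarsimp simp: disjoint_family_on_def separated_def)
  fix a b assume "\<forall>a\<in>F. \<forall>b\<in>F. a \<noteq> b \<longrightarrow> r \<le> dist a b" "s * 2 \<le> r" "a \<in> F" "b \<in> F" "a \<noteq> b"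
  then show "ball a s \<inter> ball b s = {}" by (intro disjoint_ballI) force
qed

text \<open>Volume comparison: the balls of radius \<open>r / 2\<close> around the points are disjoint subsets of a ball of
radius \<open>3 r\<close>. The case of at most one point is separate because the lower volume bound needs a
distance that exceeds the radius.\<close>

lemma card_separated_le:
  fixes m :: "'a::metric_space measure" and F :: "'a set"
  assumes reg: "regular_bounds Q C m" and F: "finite F" "F \<subseteq> cball x (2 * r)" "separated r F" and r: "r > 0"
  shows "card F \<le> C\<^sup>2 * 6 powr Q"
proof (cases "card F \<le> 1")
  case True
  have "1 * 1 \<le> C\<^sup>2 * 6 powr Q"
    using regular_boundsD(2,3)[OF reg] by (intro mult_mono ge_one_powr_ge_zero) auto
  moreover have "real (card F) \<le> 1" using True by simp
  ultimately show ?thesis by linarith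
next
  case False
  then obtain a b where ab: "a \<in> F" "b \<in> F" "a \<noteq> b"
    by (metis F(1) card_le_Suc0_iff_eq One_nat_def)
  then have rab: "r / 2 < dist a b" using F(3) r by (force simp: separated_def)
  have C1: "C \<ge> 1" "Q > 0" and fin: "finite_on_balls m" using regular_boundsD[OF reg] by blast+
  have sub: "ball y (r/2) \<subseteq> ball x (3 * r)" if "y \<in> F" for y
  proof
    fix z assume "z \<in> ball y (r/2)"
    then show "z \<in> ball x (3 * r)"
      using that F(2) r dist_triangle[of x z y] by force
  qed
  have "real (card F) * ((r/2) powr Q / C) \<le> (\<Sum>y\<in>F. measure m (ball y (r/2)))"
    using regular_boundsD(5)[OF reg _ rab] r by (intro sum_bounded_below) simp
  also have "\<dots> \<le> measure m (ball x (3 * r))"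
    using F sub fin by (intro sum_measure_disjoint_le disjoint_balls_separated[OF F(3)]) auto
  also have "\<dots> \<le> C * (3 * r) powr Q" using r by (intro regular_boundsD(4)[OF reg]) simp
  also have "\<dots> = C * 6 powr Q * (r/2) powr Q"
    using r by (simp add: powr_mult[symmetric])
  finally have "real (card F) * (r/2) powr Q \<le> C\<^sup>2 * 6 powr Q * (r/2) powr Q"
    using C1 by (simp add: field_simps power2_eq_square)
  then show ?thesis using r by (simp add: mult_le_cancel_right)
qed

section \<open>Weak quasisymmetry in connected spaces\<close>

definition weak_qs :: "real \<Rightarrow> ('a::metric_space \<Rightarrow> 'b::metric_space) \<Rightarrow> bool" where
  "weak_qs H f \<longleftrightarrow> (\<forall>x y z. dist x y \<le> dist x z \<longrightarrow> dist (f x) (f y) \<le> H * dist (f x) (f z))"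

lemma weak_qsD: "weak_qs H f \<Longrightarrow> dist x y \<le> dist x z \<Longrightarrow> dist (f x) (f y) \<le> H * dist (f x) (f z)"
  by (simp add: weak_qs_def)

lemma connected_frontier_point:
  fixes U :: "'a::metric_space set"
  assumes "connected (UNIV :: 'a set)" "open U" "U \<noteq> {}" "U \<noteq> UNIV"
  shows "\<exists>w. w \<in> closure U \<and> w \<notin> U"
proof (rule ccontr)
  assume "\<nexists>w. w \<in> closure U \<and> w \<notin> U"
  then have "closure U \<subseteq> U" by blast
  then have "closed U" by (simp add: closure_subset_eq)
  with assms show False using connected_clopen[of "UNIV :: 'a set"] by auto
qed

lemma connected_sphere_point:
  fixes x z :: "'a::metric_space"
  assumes "connected (UNIV :: 'a set)" "0 \<le> r" "r \<le> dist x z"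
  shows "\<exists>w. dist x w = r"
proof -
  have "connected (range (dist x))"
    using assms(1) by (intro connected_continuous_image continuous_intros)
  then have "r \<in> range (dist x)"
    using rangeI[of "dist x" x] rangeI[of "dist x" z] assms(2,3)
    by (intro connectedD_interval[of "range (dist x)" 0 "dist x z" r]) simp_all
  then show ?thesis by auto
qed

text \<open>The estimate can only be propagated along steps whose lengths do not increase. So consider finite
\<open>r\<close>-separated sets near \<open>x\<close>, grown from \<open>x\<close> by adding points at distance \<^emph>\<open>exactly\<close> \<open>r\<close> from an old one;
each addition costs a constant factor. Packing bounds their size. Around a largest one the balls of
radius \<open>r\<close> either cover the space, and then they contain \<open>y\<close>, or by connectedness their union has a
frontier point \<open>w\<close>. The latter has distance \<open>r\<close> from the set and could be added unless it is at least
as far from \<open>x\<close> as \<open>y\<close> is, and then weak quasisymmetry compares \<open>f y\<close> with \<open>f w\<close>.\<close>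

lemma weak_qs_doubling:
  fixes f :: "'a::metric_space \<Rightarrow> 'b::metric_space"
  assumes conn: "connected (UNIV :: 'a set)" and qs: "weak_qs H f" and H: "H \<ge> 1" and r: "r > 0"
    and pack: "\<And>F. finite F \<Longrightarrow> F \<subseteq> cball x (2 * r) \<Longrightarrow> separated r F \<Longrightarrow> card F \<le> N"
    and M: "\<And>b. dist x b \<le> r \<Longrightarrow> dist (f x) (f b) \<le> M" and y: "dist x y \<le> 2 * r"
  shows "dist (f x) (f y) \<le> 2 * max 2 H ^ Suc N * M"
proof -
  define K where "K = max 2 H"
  have K: "K \<ge> 2" "K \<ge> H" by (auto simp: K_def)
  have M0: "M \<ge> 0" using M[of x] r by simp
  have KM: "M \<le> K ^ n * M" for n
    using K M0 by (simp add: mult_le_cancel_right1 one_le_power)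
  have Kmono: "K ^ n * M \<le> K ^ m * M" if "n \<le> m" for n m
    using K M0 that by (intro mult_right_mono power_increasing) auto
  show ?thesis
  proof (cases "dist x y \<le> r")
    case True
    have "dist (f x) (f y) \<le> 1 * (K ^ Suc N * M)"
      using M[OF True] KM[of "Suc N"] by simp
    also have "\<dots> \<le> 2 * (K ^ Suc N * M)"
      using K M0 by (intro mult_right_mono) auto
    finally show ?thesis by (simp add: K_def)
  next
    case False
    define good where "good F \<longleftrightarrow> finite F \<and> x \<in> F \<and> F \<subseteq> ball x (dist x y) \<and> separated r F \<and>
      (\<forall>a\<in>F. dist (f x) (f a) \<le> K ^ card F * M \<and>
         (\<forall>b. dist a b \<le> r \<longrightarrow> dist (f a) (f b) \<le> K ^ card F * M))" for F
    have "good {x}"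
      using False M KM[of 1] M0 r K by (auto simp: good_def separated_def intro: order_trans)
    moreover have goodN: "card F \<le> N" if "good F" for F
      using that y by (intro pack) (auto simp: good_def)
    ultimately obtain F where F: "good F" and max: "\<And>F'. good F' \<Longrightarrow> card F' \<le> card F"
      using ex_has_greatest_nat[of good "{x}" card "Suc N"] by (metis le_imp_less_Suc)
    let ?D = "K ^ card F * M"
    have finF: "finite F" using F by (simp add: good_def)
    have D: "dist (f x) (f a) \<le> ?D" "dist a b \<le> r \<Longrightarrow> dist (f a) (f b) \<le> ?D" if "a \<in> F" for a b
      using F that by (auto simp: good_def)
    have D2: "dist (f x) (f w) \<le> 2 * ?D" if "a \<in> F" "dist a w \<le> r" for a w
      using D(1)[OF that(1)] D(2)[OF that] dist_triangle[of "f x" "f w" "f a"] by linarith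
    have cN: "card F \<le> N" using goodN F .
    define U where "U = (\<Union>a\<in>F. ball a r)"
    show ?thesis
    proof (cases "U = UNIV")
      case True
      then have "y \<in> U" by simp
      then obtain a where "a \<in> F" "dist a y < r" by (auto simp: U_def)
      then have "dist (f x) (f y) \<le> 2 * ?D" by (intro D2) auto
      also have "\<dots> \<le> 2 * (K ^ Suc N * M)" using Kmono[of "card F" "Suc N"] cN by simp
      finally show ?thesis by (simp add: K_def)
    next
      case nU: False
      have "U \<noteq> {}" using F r by (auto simp: U_def good_def)
      moreover have "open U" by (auto simp: U_def)
      ultimately obtain w where w: "w \<in> closure U" "w \<notin> U"
        using connected_frontier_point[OF conn] nU by blast
      have "closure U \<subseteq> (\<Union>a\<in>F. cball a r)"
        unfolding U_def using finF by (intro closure_minimal closed_UN) auto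
      then obtain a where a: "a \<in> F" "dist a w \<le> r" using w by auto
      have wout: "r \<le> dist b w" if "b \<in> F" for b
        using w that by (force simp: U_def)
      then have aw: "dist a w = r" using a by (simp add: order_antisym)
      have fw: "dist (f x) (f w) \<le> 2 * ?D" using D2[of a w] a aw by simp
      have "w \<notin> ball x (dist x y)"
      proof
        assume wb: "w \<in> ball x (dist x y)"
        have nw: "w \<notin> F" using wout[of w] r by auto
        have c: "card (insert w F) = Suc (card F)" using finF nw by simp
        have D': "?D \<le> K ^ Suc (card F) * M" "2 * ?D \<le> K ^ Suc (card F) * M"
          "H * ?D \<le> K ^ Suc (card F) * M"
          using K M0 Kmono[of "card F" "Suc (card F)"] by (auto intro!: mult_right_mono)
        have "dist (f w) (f b) \<le> H * ?D" if "dist w b \<le> r" for b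
        proof -
          have "dist (f w) (f b) \<le> H * dist (f w) (f a)"
            using that aw by (intro weak_qsD[OF qs]) (simp add: dist_commute)
          also have "\<dots> \<le> H * ?D"
            using D(2)[of a w] a aw H by (intro mult_left_mono) (simp_all add: dist_commute)
          finally show ?thesis .
        qed
        moreover have "dist (f a) (f b) \<le> K ^ Suc (card F) * M" if "a \<in> F" "dist a b \<le> r" for a b
          using D(2)[OF that] D'(1) by (rule order_trans)
        ultimately have "good (insert w F)"
          using F c wb D(1) D' fw wout unfolding good_def separated_def
          by (auto simp: dist_commute intro: order_trans)
        from max[OF this] c show False by simp
      qed
      then have "dist x y \<le> dist x w" by simp
      then have "dist (f x) (f y) \<le> H * dist (f x) (f w)" by (rule weak_qsD[OF qs])
      also have "\<dots> \<le> K * (2 * ?D)"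
        using K fw M0 by (intro mult_mono) auto
      also have "\<dots> = 2 * (K ^ Suc (card F) * M)" by simp
      also have "\<dots> \<le> 2 * (K ^ Suc N * M)" using Kmono[of "Suc (card F)" "Suc N"] cN by simp
      finally show ?thesis by (simp add: K_def)
    qed
  qed
qed

text \<open>The floor is the packing bound of \<open>card_separated_le\<close>.\<close>

definition doubling_const :: "real \<Rightarrow> real \<Rightarrow> real \<Rightarrow> real" where
  "doubling_const Q C H = 2 * max 2 H ^ Suc (nat \<lfloor>C\<^sup>2 * 6 powr Q\<rfloor>)"

lemma doubling_const_ge: "doubling_const Q C H \<ge> 2"
proof -
  have "1 \<le> max 2 H ^ Suc (nat \<lfloor>C\<^sup>2 * 6 powr Q\<rfloor>)" by (rule one_le_power) simp
  then show ?thesis by (simp add: doubling_const_def)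
qed

lemma weak_qs_doubling_regular:
  fixes f :: "'a::metric_space \<Rightarrow> 'b::metric_space" and m :: "'a measure"
  assumes "connected (UNIV :: 'a set)" "regular_bounds Q C m" "weak_qs H f" "H \<ge> 1" "r > 0"
    and "\<And>b. dist x b \<le> r \<Longrightarrow> dist (f x) (f b) \<le> M" and "dist x y \<le> 2 * r"
  shows "dist (f x) (f y) \<le> doubling_const Q C H * M"
  unfolding doubling_const_def
proof (rule weak_qs_doubling[OF assms(1,3,4,5) _ assms(6,7)])
  fix F :: "'a set" assume F: "finite F" "F \<subseteq> cball x (2 * r)" "separated r F"
  have "real (card F) \<le> C\<^sup>2 * 6 powr Q"
    by (rule card_separated_le[OF assms(2) F assms(5)])
  then show "card F \<le> nat \<lfloor>C\<^sup>2 * 6 powr Q\<rfloor>" by (simp add: le_nat_floor)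
qed

section \<open>The measure induced by a quasisymmetric map\<close>

text \<open>The two maps are inverse to each other. The radius \<open>R\<^sub>0\<close> is a scale that is small compared with the
diameter of \<open>X\<close>: spheres of radius up to \<open>4 R\<^sub>0\<close> are nonempty and the lower volume bound holds below
\<open>4 R\<^sub>0\<close>. Working at scales comparable to \<open>R\<^sub>0\<close> and below suffices because dimension is a local
notion.\<close>

locale qs_setting =
  fixes Q C H H' R\<^sub>0 :: real and \<mu> :: "'a::metric_space measure" and \<mu>Y :: "'b::metric_space measure"
    and f :: "'a \<Rightarrow> 'b" and g :: "'b \<Rightarrow> 'a"
  assumes regX: "regular_bounds Q C \<mu>" and regY: "regular_bounds Q C \<mu>Y"
    and conn: "connected (UNIV :: 'a set)" and proper: "proper_space TYPE('a)"
    and contf: "continuous_on UNIV f" and contg: "continuous_on UNIV g"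
    and gf [simp]: "\<And>x. g (f x) = x" and fg [simp]: "\<And>y. f (g y) = y"
    and qsf: "weak_qs H f" and qsg: "weak_qs H' g" and H1: "H \<ge> 1" and H'1: "H' \<ge> 1"
    and R0: "R\<^sub>0 > 0" and far: "\<And>x :: 'a. \<exists>z. dist x z \<ge> 4 * R\<^sub>0"
begin

abbreviation A where "A \<equiv> doubling_const Q C H"
abbreviation A' where "A' \<equiv> doubling_const Q C H'"

lemmas Q0 = regular_boundsD(2)[OF regX] and C1 = regular_boundsD(3)[OF regX]

lemma A2: "A \<ge> 2" and A'2: "A' \<ge> 2"
  by (rule doubling_const_ge)+

lemma f_eq_iff [simp]: "f x = f y \<longleftrightarrow> x = y"
  by (metis gf)

lemma connY: "connected (UNIV :: 'b set)"
proof -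
  have "f ` UNIV = UNIV" by (metis fg surjI)
  then show ?thesis using connected_continuous_image[OF contf conn] by simp
qed

lemma g_doubling:
  assumes "s > 0" "\<And>b. dist y b \<le> s \<Longrightarrow> dist (g y) (g b) \<le> M" "dist y b \<le> 2 * s"
  shows "dist (g y) (g b) \<le> A' * M"
  using weak_qs_doubling_regular[OF connY regY qsg H'1 assms] .

lemma g_doubling_iter:
  assumes "s > 0" "\<And>b. dist y b \<le> s \<Longrightarrow> dist (g y) (g b) \<le> M" "dist y b \<le> 2 ^ k * s"
  shows "dist (g y) (g b) \<le> A' ^ k * M"
  using assms(3)
proof (induction k arbitrary: b)
  case 0
  then show ?case using assms(2) by simp
next
  case (Suc k)
  have "dist (g y) (g b) \<le> A' * (A' ^ k * M)"
    using Suc.IH Suc.prems assms(1) by (intro g_doubling[of "2 ^ k * s"]) auto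
  then show ?case by simp
qed

text \<open>This is doubling of the inverse map read backwards. If \<open>f b\<close> were farther from \<open>f x\<close> than \<open>2\<^sup>-\<^sup>k\<close> times
the distance of \<open>f z\<close>, then the inverse map would send the ball with this radius around \<open>f x\<close> into a
ball of radius \<open>H' d(x, b)\<close>, and \<open>k\<close> doublings would bring \<open>z\<close> too close to \<open>x\<close>.\<close>

lemma f_decay:
  assumes "A' ^ k * H' * dist x b < dist x z"
  shows "dist (f x) (f b) \<le> dist (f x) (f z) / 2 ^ k"
proof (rule ccontr)
  assume less: "\<not> dist (f x) (f b) \<le> dist (f x) (f z) / 2 ^ k"
  let ?s = "dist (f x) (f z) / 2 ^ k"
  have "0 \<le> A' ^ k * H' * dist x b" using A'2 H'1 by simp
  then have "x \<noteq> z" using assms by auto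
  then have s: "?s > 0" by simp
  have "dist (g (f x)) (g (f z)) \<le> A' ^ k * (H' * dist x b)"
  proof (rule g_doubling_iter[OF s])
    fix y assume "dist (f x) y \<le> ?s"
    then have "dist (f x) y \<le> dist (f x) (f b)" using less by simp
    from weak_qsD[OF qsg this] show "dist (g (f x)) (g y) \<le> H' * dist x b" by simp
  qed simp
  then show False using assms by (simp add: mult.assoc)
qed

definition osc :: "'a \<Rightarrow> real \<Rightarrow> real" where
  "osc x r = (SUP b\<in>cball x r. dist (f x) (f b))"

lemma bounded_image: "bounded S \<Longrightarrow> bounded (f ` S)"
proof -
  assume "bounded S"
  then have "compact (closure S)" using proper by (auto simp: proper_space_def)
  then have "compact (f ` closure S)"
    using contf by (intro compact_continuous_image) (auto intro: continuous_on_subset)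
  then have "bounded (f ` closure S)" by (rule compact_imp_bounded)
  then show ?thesis using closure_subset by (meson bounded_subset image_mono)
qed

lemma compact_cball_X: "compact (cball (x::'a) r)"
  using proper by (simp add: proper_space_def)

lemma bdd_osc: "bdd_above ((\<lambda>b. dist (f x) (f b)) ` cball x r)"
proof -
  have "bounded (f ` cball x r)" by (rule bounded_image) simp
  then obtain e where "\<forall>y\<in>f ` cball x r. dist (f x) y \<le> e"
    using bounded_any_center[of _ "f x"] by auto
  then show ?thesis by (auto simp: bdd_above_def)
qed

lemma dist_le_osc: "dist x b \<le> r \<Longrightarrow> dist (f x) (f b) \<le> osc x r"
  unfolding osc_def by (rule cSUP_upper[OF _ bdd_osc]) simp

lemma osc_leI: "0 \<le> r \<Longrightarrow> (\<And>b. dist x b \<le> r \<Longrightarrow> dist (f x) (f b) \<le> M) \<Longrightarrow> osc x r \<le> M"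
  unfolding osc_def by (rule cSUP_least) auto

lemma osc_mono: "0 \<le> r \<Longrightarrow> r \<le> s \<Longrightarrow> osc x r \<le> osc x s"
  by (rule osc_leI) (auto intro: dist_le_osc)

lemma osc_le_far: "0 \<le> r \<Longrightarrow> r \<le> dist x z \<Longrightarrow> osc x r \<le> H * dist (f x) (f z)"
  by (rule osc_leI) (auto intro: weak_qsD[OF qsf])

lemma sphere_point: "0 \<le> r \<Longrightarrow> r \<le> 4 * R\<^sub>0 \<Longrightarrow> \<exists>w. dist x w = r" for x :: 'a
  using far[of x] connected_sphere_point[OF conn] by (meson order_trans)

lemma osc_pos: "r > 0 \<Longrightarrow> osc x r > 0"
proof -
  assume r: "r > 0"
  obtain w where w: "dist x w = min r R\<^sub>0" using sphere_point[of "min r R\<^sub>0" x] r R0 by (auto simp: min_le_iff_disj)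
  then have "dist (f x) (f w) \<le> osc x r" by (intro dist_le_osc) auto
  moreover have "dist (f x) (f w) > 0" using w r R0 by (auto simp: min_def split: if_splits)
  ultimately show ?thesis by linarith
qed

lemma osc_doubling: "r > 0 \<Longrightarrow> osc x (2 * r) \<le> A * osc x r"
  by (rule osc_leI, simp, rule weak_qs_doubling_regular[OF conn regX qsf H1])
     (auto intro: dist_le_osc)

lemma osc_doubling_iter: "r > 0 \<Longrightarrow> osc x (2 ^ k * r) \<le> A ^ k * osc x r"
proof (induction k)
  case (Suc k)
  have "osc x (2 * (2 ^ k * r)) \<le> A * osc x (2 ^ k * r)"
    using Suc.prems by (intro osc_doubling) simp
  also have "\<dots> \<le> A * (A ^ k * osc x r)"
    using Suc A2 by (intro mult_left_mono) auto
  finally show ?case by (simp add: mult.assoc)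
qed simp

lemma image_ball_subset: "f ` ball x r \<subseteq> cball (f x) (osc x r)"
  by (force intro!: dist_le_osc)

lemma ball_subset_image: "0 \<le> r \<Longrightarrow> ball (f x) (osc x r / H) \<subseteq> f ` ball x r"
proof
  fix y assume r: "0 \<le> r" and y: "y \<in> ball (f x) (osc x r / H)"
  have "dist x (g y) < r"
  proof (rule ccontr)
    assume "\<not> dist x (g y) < r"
    then have "osc x r \<le> H * dist (f x) (f (g y))" using r by (intro osc_le_far) auto
    then show False using y H1 by (simp add: field_simps)
  qed
  then show "y \<in> f ` ball x r" by (auto intro!: image_eqI[of _ _ "g y"])
qed

text \<open>The measure \<open>\<nu> A = \<mu>Y (f A)\<close>, as the image of \<open>\<mu>Y\<close> under the inverse map.\<close>

definition \<nu> :: "'a measure" where "\<nu> = distr \<mu>Y borel g"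

lemma sets_\<mu>Y: "sets \<mu>Y = sets borel" and sets_\<mu>: "sets \<mu> = sets borel"
  using regular_boundsD(1)[OF regY] regular_boundsD(1)[OF regX] by (simp_all add: finite_on_balls_def)

lemma sets_\<nu> [simp]: "sets \<nu> = sets borel"
  by (simp add: \<nu>_def)

lemma g_measurable: "g \<in> measurable \<mu>Y borel"
proof -
  have "g \<in> borel_measurable borel" by (rule borel_measurable_continuous_onI[OF contg])
  then show ?thesis using measurable_cong_sets[OF sets_\<mu>Y refl] by blast
qed

lemma emeasure_\<nu>: "S \<in> sets borel \<Longrightarrow> emeasure \<nu> S = emeasure \<mu>Y (f ` S)"
proof -
  assume S: "S \<in> sets borel"
  have "space \<mu>Y = UNIV" using sets_eq_imp_space_eq[OF sets_\<mu>Y] by simp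
  then have "g -` S \<inter> space \<mu>Y = f ` S" by (auto intro: image_eqI[of _ _ "g _"])
  then show ?thesis using emeasure_distr[OF g_measurable S] by (simp add: \<nu>_def)
qed

lemma measure_\<nu>: "S \<in> sets borel \<Longrightarrow> measure \<nu> S = measure \<mu>Y (f ` S)"
  by (simp add: measure_def emeasure_\<nu>)

lemma image_borel: "S \<in> sets borel \<Longrightarrow> f ` S \<in> sets borel"
proof -
  assume S: "S \<in> sets borel"
  have "g \<in> borel_measurable borel" by (rule borel_measurable_continuous_onI[OF contg])
  from measurable_sets_borel[OF this S] have "g -` S \<in> sets borel" .
  moreover have "g -` S = f ` S" by (auto intro: image_eqI[of _ _ "g _"])
  ultimately show ?thesis by simp
qed

lemmas finX = regular_boundsD(1)[OF regX] and finY = regular_boundsD(1)[OF regY]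

lemma fin\<nu>: "finite_on_balls \<nu>"
  unfolding finite_on_balls_def
proof (intro conjI allI)
  fix x :: 'a and r :: real
  have "f ` ball x r \<in> fmeasurable \<mu>Y"
    by (rule finite_on_balls_fmeasurable[OF finY image_borel bounded_image]) auto
  then show "emeasure \<nu> (ball x r) < \<infinity>" by (simp add: emeasure_\<nu> fmeasurable_def)
qed simp

lemma \<nu>_upper: "r > 0 \<Longrightarrow> measure \<nu> (ball x r) \<le> C * (2 * osc x r) powr Q"
proof -
  assume r: "r > 0"
  have "f ` ball x r \<subseteq> ball (f x) (2 * osc x r)"
    using image_ball_subset[of x r] osc_pos[OF r, of x] by force
  then have "measure \<nu> (ball x r) \<le> measure \<mu>Y (ball (f x) (2 * osc x r))"
    by (subst measure_\<nu>) (auto intro!: measure_mono_balls[OF finY] image_borel)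
  also have "\<dots> \<le> C * (2 * osc x r) powr Q"
    using osc_pos[OF r] by (intro regular_boundsD(4)[OF regY]) simp
  finally show ?thesis .
qed

text \<open>The factor 2 in the denominator keeps the radius below a distance that is actually attained in \<open>Y\<close>, as
the lower volume bound requires.\<close>

lemma \<nu>_lower: "r > 0 \<Longrightarrow> (osc x r / (2 * H)) powr Q / C \<le> measure \<nu> (ball x r)"
proof -
  assume r: "r > 0"
  note p = osc_pos[OF r, of x]
  have "\<exists>b. dist x b \<le> r \<and> osc x r / 2 < dist (f x) (f b)"
  proof (rule ccontr)
    assume "\<nexists>b. dist x b \<le> r \<and> osc x r / 2 < dist (f x) (f b)"
    then have "osc x r \<le> osc x r / 2" using r by (intro osc_leI) (auto simp: not_less)
    then show False using p by simp
  qed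
  then obtain b where b: "osc x r / 2 < dist (f x) (f b)" by blast
  have "osc x r / (2 * H) \<le> osc x r / 2"
    using p H1 by (intro divide_left_mono) auto
  then have "(osc x r / (2 * H)) powr Q / C \<le> measure \<mu>Y (ball (f x) (osc x r / (2 * H)))"
    using b p H1 by (intro regular_boundsD(5)[OF regY, of _ "f x" "f b"]) auto
  also have "\<dots> \<le> measure \<mu>Y (f ` ball x r)"
  proof (rule measure_mono_balls[OF finY])
    have "osc x r / (2 * H) \<le> osc x r / H" using p H1 by (intro divide_left_mono) auto
    then show "ball (f x) (osc x r / (2 * H)) \<subseteq> f ` ball x r"
      using ball_subset_image[of r x] r by (meson less_imp_le order_trans subset_ball)
  qed (auto intro: image_borel bounded_image)
  finally show ?thesis by (simp add: measure_\<nu>)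
qed

lemma \<nu>_pos: "r > 0 \<Longrightarrow> measure \<nu> (ball x r) > 0"
proof -
  assume r: "r > 0"
  have "0 < (osc x r / (2 * H)) powr Q / C" using osc_pos[OF r, of x] H1 C1 by simp
  also have "\<dots> \<le> measure \<nu> (ball x r)" using \<nu>_lower[OF r] .
  finally show ?thesis .
qed

abbreviation D\<nu> where "D\<nu> \<equiv> C\<^sup>2 * (4 * A * H) powr Q"
abbreviation D\<mu> where "D\<mu> \<equiv> C\<^sup>2 * 2 powr Q"

lemma \<nu>_doubling: "r > 0 \<Longrightarrow> measure \<nu> (ball x (2 * r)) \<le> D\<nu> * measure \<nu> (ball x r)"
proof -
  assume r: "r > 0"
  note p = osc_pos[OF r, of x]
  have p2: "osc x (2 * r) > 0" using r by (intro osc_pos) simp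
  have "measure \<nu> (ball x (2 * r)) \<le> C * (2 * osc x (2 * r)) powr Q"
    using r by (intro \<nu>_upper) simp
  also have "\<dots> \<le> C * (2 * (A * osc x r)) powr Q"
    using osc_doubling[OF r, of x] p2 C1 Q0 by (intro mult_left_mono powr_mono2) auto
  also have "2 * (A * osc x r) = (4 * A * H) * (osc x r / (2 * H))" using H1 by simp
  also have "((4 * A * H) * (osc x r / (2 * H))) powr Q
      = (4 * A * H) powr Q * (osc x r / (2 * H)) powr Q"
    by (rule powr_mult)
  also have "C * ((4 * A * H) powr Q * (osc x r / (2 * H)) powr Q)
      = D\<nu> * ((osc x r / (2 * H)) powr Q / C)"
    using C1 by (simp add: power2_eq_square)
  also have "\<dots> \<le> D\<nu> * measure \<nu> (ball x r)"
    using \<nu>_lower[OF r] C1 by (intro mult_left_mono) auto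
  finally show ?thesis .
qed

lemma \<mu>_lower: "0 < r \<Longrightarrow> r < 4 * R\<^sub>0 \<Longrightarrow> r powr Q / C \<le> measure \<mu> (ball x r)"
  using far[of x] regular_boundsD(5)[OF regX, of r] by (meson order_less_le_trans)

lemma \<mu>_upper: "0 < r \<Longrightarrow> measure \<mu> (ball x r) \<le> C * r powr Q"
  by (rule regular_boundsD(4)[OF regX])

lemma \<mu>_doubling: "0 < r \<Longrightarrow> r < 4 * R\<^sub>0 \<Longrightarrow> measure \<mu> (ball x (2 * r)) \<le> D\<mu> * measure \<mu> (ball x r)"
proof -
  assume r: "0 < r" "r < 4 * R\<^sub>0"
  have "measure \<mu> (ball x (2 * r)) \<le> C * (2 * r) powr Q" using r by (intro \<mu>_upper) simp
  also have "\<dots> = D\<mu> * (r powr Q / C)" using r C1 by (simp add: powr_mult power2_eq_square)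
  also have "\<dots> \<le> D\<mu> * measure \<mu> (ball x r)"
    using \<mu>_lower[OF r] C1 by (intro mult_left_mono) auto
  finally show ?thesis .
qed

lemma \<mu>_pos: "r > 0 \<Longrightarrow> measure \<mu> (ball x r) > 0"
proof -
  assume r: "r > 0"
  have "0 < (min r R\<^sub>0) powr Q / C" using r R0 C1 by simp
  also have "\<dots> \<le> measure \<mu> (ball x (min r R\<^sub>0))" using r R0 by (intro \<mu>_lower) auto
  also have "\<dots> \<le> measure \<mu> (ball x r)"
    by (intro measure_mono_balls[OF finX]) auto
  finally show ?thesis .
qed

end

section \<open>A locally Lipschitz replacement of the distance to an image point\<close>

lemma borel_measurable_ediameter_image:
  fixes f :: "'a::metric_space \<Rightarrow> 'b::metric_space"
  shows "(\<lambda>w. ediameter (f ` ball w s)) \<in> borel_measurable borel"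
proof (rule borel_measurableI_greater)
  fix t :: ennreal
  have "{w. t < ediameter (f ` ball w s)}
      = (\<Union>(a, b) \<in> {(a, b). t < ennreal (dist (f a) (f b))}. ball a s \<inter> ball b s)"
    by (fastforce simp: ediameter_def less_SUP_iff dist_commute)
  moreover have "open \<dots>" by (intro open_UN) auto
  ultimately show "{w \<in> space borel. t < ediameter (f ` ball w s)} \<in> sets borel"
    by simp
qed

lemma ennpowr_mono: "a \<ge> 0 \<Longrightarrow> x \<le> y \<Longrightarrow> ennpowr x a \<le> ennpowr y a"
  by (auto simp: ennpowr_def top_unique less_top intro!: ennreal_leI powr_mono2 enn2real_mono)

lemma ennpowr_ennreal: "x \<ge> 0 \<Longrightarrow> ennpowr (ennreal x) a = ennreal (x powr a)"
  by (simp add: ennpowr_def)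

text \<open>A linear bound for a concave power, with a free parameter. It replaces Hoelder's inequality: choosing
\<open>t\<close> well after summation gives the same estimates.\<close>

lemma powr_le_split:
  fixes x t \<theta> :: real
  assumes "x \<ge> 0" "t > 0" "0 < \<theta>" "\<theta> < 1"
  shows "x powr \<theta> \<le> t powr \<theta> + t powr (\<theta> - 1) * x"
proof (cases "x \<le> t")
  case True
  then have "x powr \<theta> \<le> t powr \<theta>" using assms by (intro powr_mono2) auto
  moreover have "0 \<le> t powr (\<theta> - 1) * x" using assms by simp
  ultimately show ?thesis by linarith
next
  case False
  then have "x powr \<theta> = x powr (\<theta> - 1) * x"
    using assms by (simp add: powr_mult_base[symmetric] mult.commute powr_diff)
  also have "\<dots> \<le> t powr (\<theta> - 1) * x"
    using False assms by (intro mult_right_mono powr_mono2') auto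
  finally show ?thesis using powr_ge_zero[of t \<theta>] by linarith
qed

lemma ex_maximal_separated:
  assumes "\<And>F. finite F \<Longrightarrow> F \<subseteq> S \<Longrightarrow> separated r F \<Longrightarrow> card F \<le> N" and r: "r > 0"
  shows "\<exists>F. finite F \<and> F \<subseteq> S \<and> separated r F \<and> S \<subseteq> (\<Union>a\<in>F. ball a r)"
proof -
  define P where "P F \<longleftrightarrow> finite F \<and> F \<subseteq> S \<and> separated r F" for F
  have "P {}" by (simp add: P_def separated_def)
  moreover have "card F \<le> N" if "P F" for F using that assms(1) by (simp add: P_def)
  ultimately obtain F where F: "P F" and max: "\<And>F'. P F' \<Longrightarrow> card F' \<le> card F"
    using ex_has_greatest_nat[of P "{}" card "Suc N"] by (metis le_imp_less_Suc)
  have "S \<subseteq> (\<Union>a\<in>F. ball a r)"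
  proof (rule ccontr)
    assume "\<not> S \<subseteq> (\<Union>a\<in>F. ball a r)"
    then obtain w where wS: "w \<in> S" "w \<notin> (\<Union>a\<in>F. ball a r)" by blast
    then have w: "w \<in> S" "\<And>a. a \<in> F \<Longrightarrow> r \<le> dist a w" by (auto simp: not_less)
    then have "w \<notin> F" using r by force
    moreover have "P (insert w F)"
      using F w by (auto simp: P_def separated_def dist_commute)
    ultimately show False using max[of "insert w F"] F by (simp add: P_def)
  qed
  then show ?thesis using F by (auto simp: P_def)
qed

lemma compact_maximal_separated:
  fixes K :: "'a::metric_space set"
  assumes "compact K" "S \<subseteq> K" "r > 0"
  shows "\<exists>F. finite F \<and> F \<subseteq> S \<and> separated r F \<and> S \<subseteq> (\<Union>a\<in>F. ball a r)"
proof -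
  obtain k where k: "finite k" "K \<subseteq> (\<Union>x\<in>k. ball x (r/2))"
    using assms(1,3) unfolding compact_eq_totally_bounded by (metis half_gt_zero)
  show ?thesis
  proof (rule ex_maximal_separated[OF _ assms(3)])
    fix F assume F: "finite F" "F \<subseteq> S" "separated r F"
    have "\<forall>a\<in>F. \<exists>x\<in>k. dist x a < r / 2" using F k assms(2) by fastforce
    then obtain c where c: "\<And>a. a \<in> F \<Longrightarrow> c a \<in> k \<and> dist (c a) a < r / 2" by metis
    have "inj_on c F"
    proof (rule inj_onI, rule ccontr)
      fix a b assume ab: "a \<in> F" "b \<in> F" "c a = c b" "a \<noteq> b"
      then have "r \<le> dist a b" using F by (simp add: separated_def)
      moreover have "dist a b < r"
        using c[OF ab(1)] c[OF ab(2)] ab(3) by (metis dist_commute dist_triangle_half_r)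
      ultimately show False by simp
    qed
    then show "card F \<le> card k" using c k by (intro card_inj_on_le[of c]) auto
  qed
qed

locale qs_poincare = qs_setting +
  fixes p\<^sub>0 C\<^sub>P \<Lambda> :: real
  assumes p0: "1 < p\<^sub>0" "p\<^sub>0 < Q" and CP: "C\<^sub>P > 0" and \<Lambda>1: "\<Lambda> \<ge> 1"
    and poincare: "\<And>u h x r. upper_gradient h u \<Longrightarrow> r > 0 \<Longrightarrow> set_integrable \<mu> (ball x r) u \<Longrightarrow>
      (\<integral>\<^sup>+ z \<in> ball x r. ennreal \<bar>u z - ball_average \<mu> (ball x r) u\<bar> \<partial>\<mu>) / emeasure \<mu> (ball x r)
        \<le> ennreal C\<^sub>P * ediameter (ball x r) *
          ennpowr ((\<integral>\<^sup>+ z \<in> ball x (\<Lambda> * r). ennpowr (h z) p\<^sub>0 \<partial>\<mu>)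
                     / emeasure \<mu> (ball x (\<Lambda> * r))) (1 / p\<^sub>0)"

context qs_setting begin

lemma ediameter_image_finite: "bounded S \<Longrightarrow> ediameter (f ` S) < \<infinity>"
proof -
  assume "bounded S"
  then obtain e x where e: "\<forall>y\<in>f ` S. dist x y \<le> e" using bounded_image bounded_def by metis
  have "ediameter (f ` S) \<le> ennreal (2 * e)"
  proof (rule ediameter_leI, rule ennreal_leI)
    fix a b assume "a \<in> f ` S" "b \<in> f ` S"
    then have "dist x a \<le> e" "dist x b \<le> e" using e by auto
    then show "dist a b \<le> 2 * e" using dist_triangle3[of a b x] by linarith
  qed
  then show ?thesis using ennreal_less_top le_less_trans by fastforce
qed

definition diam_image :: "'a \<Rightarrow> real \<Rightarrow> real" where
  "diam_image x s = enn2real (ediameter (f ` ball x s))"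

lemma ediameter_image: "ediameter (f ` ball x s) = ennreal (diam_image x s)"
  using ediameter_image_finite[OF bounded_ball, of x s] by (simp add: diam_image_def)

lemma diam_image_nonneg [simp]: "0 \<le> diam_image x s"
  by (simp add: diam_image_def)

lemma dist_le_diam_image: "dist x a < s \<Longrightarrow> dist x b < s \<Longrightarrow> dist (f a) (f b) \<le> diam_image x s"
proof -
  assume "dist x a < s" "dist x b < s"
  then have "ennreal (dist (f a) (f b)) \<le> ennreal (diam_image x s)"
    unfolding ediameter_image[symmetric] by (intro dist_le_ediameter) auto
  then show ?thesis by (simp add: ennreal_le_iff)
qed

lemma diam_image_le:
  assumes "\<And>a b. dist x a < s \<Longrightarrow> dist x b < s \<Longrightarrow> dist (f a) (f b) \<le> M" "M \<ge> 0"
  shows "diam_image x s \<le> M"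
proof -
  have "ennreal (diam_image x s) \<le> ennreal M"
    unfolding ediameter_image[symmetric] by (intro ediameter_leI ennreal_leI) (auto intro: assms(1))
  then show ?thesis using assms(2) by (simp add: ennreal_le_iff)
qed

text \<open>The supremum of \<open>d(f y, f x\<^sub>0)\<close> over the ball of radius \<open>2 \<delta>\<close> around \<open>x\<close> would jump when a point \<open>y\<close>
enters the ball. The penalty grows linearly from 0 at distance \<open>\<delta>\<close> to the oscillation of \<open>f\<close> near \<open>y\<close> at
distance \<open>2 \<delta>\<close>, so that a point which has just entered cannot exceed the value at the centre.\<close>

definition penalised :: "'a \<Rightarrow> real \<Rightarrow> 'a \<Rightarrow> 'a \<Rightarrow> real" where
  "penalised x\<^sub>0 \<delta> x y =
     dist (f y) (f x\<^sub>0) - diam_image y (4 * \<delta>) * (max 0 (dist x y - \<delta>) / \<delta>)"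

definition smoothed :: "'a \<Rightarrow> real \<Rightarrow> 'a \<Rightarrow> real" where
  "smoothed x\<^sub>0 \<delta> x = (SUP y\<in>ball x (2 * \<delta>). penalised x\<^sub>0 \<delta> x y)"

context
  fixes x\<^sub>0 :: 'a and \<delta> :: real assumes \<delta>: "\<delta> > 0"
begin

lemma penalised_le: "penalised x\<^sub>0 \<delta> x y \<le> dist (f y) (f x\<^sub>0)"
  using \<delta> by (simp add: penalised_def)

lemma bdd_penalised: "bdd_above (penalised x\<^sub>0 \<delta> x ` ball x (2 * \<delta>))"
proof -
  have "bounded (f ` ball x (2 * \<delta>))" by (rule bounded_image) simp
  then obtain e where e: "\<forall>y\<in>f ` ball x (2 * \<delta>). dist (f x\<^sub>0) y \<le> e"
    using bounded_any_center[of _ "f x\<^sub>0"] by auto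
  have "penalised x\<^sub>0 \<delta> x y \<le> e" if "y \<in> ball x (2 * \<delta>)" for y
  proof -
    have "dist (f y) (f x\<^sub>0) \<le> e" using e that by (subst dist_commute) blast
    with penalised_le[of x y] show ?thesis by (rule order_trans)
  qed
  then show ?thesis by (rule bdd_aboveI2)
qed

lemma penalised_le_smoothed: "dist x y < 2 * \<delta> \<Longrightarrow> penalised x\<^sub>0 \<delta> x y \<le> smoothed x\<^sub>0 \<delta> x"
  unfolding smoothed_def by (rule cSUP_upper[OF _ bdd_penalised]) simp

lemma smoothed_leI:
  "(\<And>y. dist x y < 2 * \<delta> \<Longrightarrow> penalised x\<^sub>0 \<delta> x y \<le> M) \<Longrightarrow> smoothed x\<^sub>0 \<delta> x \<le> M"
  unfolding smoothed_def using \<delta> by (intro cSUP_least) auto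

lemma dist_le_smoothed: "dist (f x) (f x\<^sub>0) \<le> smoothed x\<^sub>0 \<delta> x"
  using penalised_le_smoothed[of x x] \<delta> by (simp add: penalised_def)

lemma smoothed_le:
  "(\<And>y. dist x y < 2 * \<delta> \<Longrightarrow> dist (f y) (f x\<^sub>0) \<le> M) \<Longrightarrow> smoothed x\<^sub>0 \<delta> x \<le> M"
  using penalised_le by (intro smoothed_leI) (meson order_trans)

text \<open>For \<open>y\<close> competing in \<open>smoothed x\<close>: if it also competes in \<open>smoothed x'\<close>, its penalty changes by at most
the claimed amount; otherwise it is almost fully penalised, and the
point \<open>x'\<close> itself does as well up to that amount.\<close>

lemma smoothed_diff_le:
  assumes h: "dist x x' \<le> \<delta>" and w: "dist w x \<le> 2 * \<delta>"
  shows "smoothed x\<^sub>0 \<delta> x \<le> smoothed x\<^sub>0 \<delta> x' + dist x x' / \<delta> * diam_image w (8 * \<delta>)"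
proof (rule smoothed_leI)
  fix y assume y: "dist x y < 2 * \<delta>"
  let ?h = "dist x x'" and ?M = "diam_image y (4 * \<delta>)"
  have wy: "dist w y < 4 * \<delta>" using w y dist_triangle[of w y x] by linarith
  have "?M \<le> diam_image w (8 * \<delta>)"
  proof (rule diam_image_le)
    fix a b assume "dist y a < 4 * \<delta>" "dist y b < 4 * \<delta>"
    then have "dist w a < 8 * \<delta>" "dist w b < 8 * \<delta>"
      using wy dist_triangle[of w a y] dist_triangle[of w b y] by linarith+
    then show "dist (f a) (f b) \<le> diam_image w (8 * \<delta>)" by (rule dist_le_diam_image)
  qed simp
  then have M: "?h / \<delta> * ?M \<le> ?h / \<delta> * diam_image w (8 * \<delta>)"
    using \<delta> by (intro mult_left_mono) auto
  have tri: "dist x' y \<le> ?h + dist x y" "dist x y \<le> ?h + dist x' y"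
    using dist_triangle[of x' y x] dist_triangle[of x y x'] by (auto simp: dist_commute)
  have "penalised x\<^sub>0 \<delta> x y \<le> smoothed x\<^sub>0 \<delta> x' + ?h / \<delta> * ?M"
  proof (cases "dist x' y < 2 * \<delta>")
    case True
    have "max 0 (dist x' y - \<delta>) / \<delta> \<le> max 0 (dist x y - \<delta>) / \<delta> + ?h / \<delta>"
      using tri \<delta> by (simp add: divide_right_mono flip: add_divide_distrib)
    then have "?M * (max 0 (dist x' y - \<delta>) / \<delta>) \<le> ?M * (max 0 (dist x y - \<delta>) / \<delta> + ?h / \<delta>)"
      by (rule mult_left_mono) simp
    then have "penalised x\<^sub>0 \<delta> x y \<le> penalised x\<^sub>0 \<delta> x' y + ?h / \<delta> * ?M"
      by (simp add: penalised_def algebra_simps)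
    then show ?thesis using penalised_le_smoothed[OF True] by linarith
  next
    case False
    have "(\<delta> - ?h) / \<delta> \<le> max 0 (dist x y - \<delta>) / \<delta>"
      using False tri \<delta> by (intro divide_right_mono) auto
    then have "?M * ((\<delta> - ?h) / \<delta>) \<le> ?M * (max 0 (dist x y - \<delta>) / \<delta>)"
      by (rule mult_left_mono) simp
    then have "penalised x\<^sub>0 \<delta> x y \<le> dist (f y) (f x\<^sub>0) - ?M + ?h / \<delta> * ?M"
      using \<delta> by (simp add: penalised_def diff_divide_distrib algebra_simps)
    moreover have "dist (f y) (f x\<^sub>0) \<le> dist (f x') (f x\<^sub>0) + ?M"
    proof -
      have "dist (f y) (f x') \<le> ?M"
        using \<delta> tri y h by (intro dist_le_diam_image) (auto simp: dist_commute)
      then show ?thesis using dist_triangle[of "f y" "f x\<^sub>0" "f x'"] by linarith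
    qed
    ultimately show ?thesis using dist_le_smoothed[of x'] by linarith
  qed
  with M show "penalised x\<^sub>0 \<delta> x y \<le> smoothed x\<^sub>0 \<delta> x' + ?h / \<delta> * diam_image w (8 * \<delta>)" by linarith
qed

lemma smoothed_lipschitz:
  assumes h: "dist x x' \<le> \<delta>" and w: "dist w x \<le> \<delta>"
  shows "\<bar>smoothed x\<^sub>0 \<delta> x - smoothed x\<^sub>0 \<delta> x'\<bar> \<le> dist x x' / \<delta> * diam_image w (8 * \<delta>)"
proof -
  have "dist w x' \<le> 2 * \<delta>" using h w dist_triangle[of w x' x] by linarith
  then show ?thesis
    using smoothed_diff_le[of x x' w] smoothed_diff_le[of x' x w] h w \<delta> by (simp add: dist_commute abs_le_iff)
qed

lemma upper_gradient_smoothed: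
  "upper_gradient (\<lambda>w. ennreal (1 / \<delta>) * ediameter (f ` ball w (8 * \<delta>))) (smoothed x\<^sub>0 \<delta>)"
proof (rule upper_gradientI_local[OF _ \<delta>])
  show "(\<lambda>w. ennreal (1 / \<delta>) * ediameter (f ` ball w (8 * \<delta>))) \<in> borel_measurable borel"
    by (intro borel_measurable_times_ennreal borel_measurable_ediameter_image) simp
next
  fix x x' w :: 'a assume "dist x x' \<le> \<delta>" "dist w x \<le> \<delta>"
  from ennreal_leI[OF smoothed_lipschitz[OF this]]
  show "ennreal \<bar>smoothed x\<^sub>0 \<delta> x - smoothed x\<^sub>0 \<delta> x'\<bar>
      \<le> ennreal (dist x x') * (ennreal (1 / \<delta>) * ediameter (f ` ball w (8 * \<delta>)))"
    using \<delta> by (simp add: ediameter_image ennreal_mult[symmetric])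
qed

lemma continuous_smoothed: "continuous_on UNIV (smoothed x\<^sub>0 \<delta>)"
  unfolding continuous_on_iff
proof (intro ballI allI impI)
  fix x :: 'a and e :: real assume e: "e > 0"
  define G where "G = diam_image x (8 * \<delta>) + 1"
  have G: "G > 0" by (simp add: G_def add_nonneg_pos)
  show "\<exists>d>0. \<forall>x'\<in>UNIV. dist x' x < d \<longrightarrow> dist (smoothed x\<^sub>0 \<delta> x') (smoothed x\<^sub>0 \<delta> x) < e"
  proof (intro exI[of _ "min \<delta> (e * \<delta> / G)"] conjI ballI impI)
    show "min \<delta> (e * \<delta> / G) > 0" using e \<delta> G by simp
    fix x' assume d: "dist x' x < min \<delta> (e * \<delta> / G)"
    have "\<bar>smoothed x\<^sub>0 \<delta> x - smoothed x\<^sub>0 \<delta> x'\<bar> \<le> dist x x' / \<delta> * diam_image x (8 * \<delta>)"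
      using d \<delta> by (intro smoothed_lipschitz) (auto simp: dist_commute)
    also have "\<dots> \<le> dist x x' / \<delta> * G" using \<delta> by (intro mult_left_mono) (auto simp: G_def)
    also have "\<dots> < e" using d \<delta> G by (simp add: field_simps dist_commute)
    finally show "dist (smoothed x\<^sub>0 \<delta> x') (smoothed x\<^sub>0 \<delta> x) < e"
      by (simp add: dist_real_def abs_minus_commute)
  qed
qed

lemma integrable_smoothed: "set_integrable \<mu> (ball x r) (smoothed x\<^sub>0 \<delta>)"
proof -
  have "bounded (f ` ball x (r + 2 * \<delta>))" by (rule bounded_image) simp
  then obtain e where e: "\<forall>y\<in>f ` ball x (r + 2 * \<delta>). dist (f x\<^sub>0) y \<le> e"
    using bounded_any_center[of _ "f x\<^sub>0"] by auto
  have le: "\<bar>smoothed x\<^sub>0 \<delta> z\<bar> \<le> e" if z: "z \<in> ball x r" for z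
  proof -
    have "smoothed x\<^sub>0 \<delta> z \<le> e"
    proof (rule smoothed_le)
      fix y assume "dist z y < 2 * \<delta>"
      then have "y \<in> ball x (r + 2 * \<delta>)" using z dist_triangle[of x y z] by auto
      then show "dist (f y) (f x\<^sub>0) \<le> e" using e by (auto simp: dist_commute)
    qed
    moreover have "0 \<le> smoothed x\<^sub>0 \<delta> z" using dist_le_smoothed[of z] by (meson order_trans zero_le_dist)
    ultimately show ?thesis by simp
  qed
  have meas: "smoothed x\<^sub>0 \<delta> \<in> borel_measurable \<mu>"
    using borel_measurable_continuous_onI[OF continuous_smoothed] measurable_cong_sets[OF sets_\<mu> refl] by blast
  have bm: "ball x r \<in> sets \<mu>" by (simp add: sets_\<mu>)
  show ?thesis
    unfolding set_integrable_def
  proof (rule integrableI_bounded_set[of "ball x r" _ _ e])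
    show "emeasure \<mu> (ball x r) < \<infinity>" using finX by (simp add: finite_on_balls_def)
    show "(\<lambda>x'. indicat_real (ball x r) x' *\<^sub>R smoothed x\<^sub>0 \<delta> x') \<in> borel_measurable \<mu>"
      using meas bm by simp
  qed (use bm le in \<open>auto simp: indicator_def\<close>)
qed

end

end

section \<open>The energy estimate\<close>

text \<open>The ratio of the radii of two concentric balls for which the oscillation of \<open>f\<close> on the smaller one is
at most \<open>1 / (2 H A\<^sup>2)\<close> times that on the larger one. The exponent \<open>k\<close> satisfies \<open>2\<^sup>k \<ge> 2 H A\<^sup>2\<close>, and by
\<open>f_decay\<close> each halving of the oscillation costs a factor \<open>A'\<close> of the radius.\<close>

definition scale_ratio :: "real \<Rightarrow> real \<Rightarrow> real \<Rightarrow> real \<Rightarrow> real" where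
  "scale_ratio Q C H H' =
     1 / (4 * doubling_const Q C H' ^ nat \<lceil>2 * H * (doubling_const Q C H)\<^sup>2\<rceil> * H')"

text \<open>What \<open>energy_lower_bound\<close> yields; the point is that it depends on the map only through \<open>H\<close> and \<open>H'\<close>.\<close>

definition energy_const :: "real \<Rightarrow> real \<Rightarrow> real \<Rightarrow> real \<Rightarrow> real \<Rightarrow> real \<Rightarrow> real" where
  "energy_const Q C H H' p\<^sub>0 C\<^sub>P =
     (scale_ratio Q C H H' powr Q / (8 * H * (doubling_const Q C H)\<^sup>2 * C\<^sup>2 * C\<^sub>P)) powr p\<^sub>0 / C"

text \<open>A function that is small on one set and large on another deviates from any constant on one of the two.\<close>

lemma nn_integral_deviation_ge:
  assumes sets: "Lo \<in> sets m" "Hi \<in> sets m" and sub: "Lo \<subseteq> B" "Hi \<subseteq> B" and \<tau>: "\<tau> \<ge> 0"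
    and lo: "\<And>z. z \<in> Lo \<Longrightarrow> u z \<le> \<tau>" and hi: "\<And>z. z \<in> Hi \<Longrightarrow> 2 * \<tau> \<le> u z"
    and m0: "c \<le> emeasure m Lo" "c \<le> emeasure m Hi"
  shows "ennreal (\<tau> / 2) * c \<le> (\<integral>\<^sup>+ z \<in> B. ennreal \<bar>u z - a\<bar> \<partial>m)"
proof -
  have *: "ennreal (\<tau> / 2) * c \<le> (\<integral>\<^sup>+ z \<in> B. ennreal \<bar>u z - a\<bar> \<partial>m)"
    if S: "S \<in> sets m" "S \<subseteq> B" "c \<le> emeasure m S" and le: "\<And>z. z \<in> S \<Longrightarrow> \<tau> / 2 \<le> \<bar>u z - a\<bar>" for S
  proof -
    have "ennreal (\<tau> / 2) * c \<le> ennreal (\<tau> / 2) * emeasure m S"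
      using S(3) by (rule mult_left_mono) simp
    also have "\<dots> = (\<integral>\<^sup>+ z. ennreal (\<tau> / 2) * indicator S z \<partial>m)"
      using S(1) by (simp add: nn_integral_cmult_indicator)
    also have "\<dots> \<le> (\<integral>\<^sup>+ z \<in> B. ennreal \<bar>u z - a\<bar> \<partial>m)"
    proof (rule nn_integral_mono)
      fix z show "ennreal (\<tau> / 2) * indicator S z \<le> ennreal \<bar>u z - a\<bar> * indicator B z"
      proof (cases "z \<in> S")
        case True
        then show ?thesis using ennreal_leI[OF le[OF True]] S(2) by auto
      qed simp
    qed
    finally show ?thesis .
  qed
  show ?thesis
  proof (cases "3 * \<tau> / 2 \<le> a")
    case True
    then show ?thesis using lo by (intro *[OF sets(1) sub(1) m0(1)]) (force simp: abs_if)
  next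
    case False
    then show ?thesis using hi by (intro *[OF sets(2) sub(2) m0(2)]) (force simp: abs_if)
  qed
qed

context qs_setting begin

abbreviation \<kappa> where "\<kappa> \<equiv> scale_ratio Q C H H'"

lemma \<kappa>_bounds: "0 < \<kappa>" "\<kappa> \<le> 1 / 4"
proof -
  have "0 \<le> A' ^ n" "1 \<le> A' ^ n" for n using A'2 by (auto intro: one_le_power)
  then have "1 * 1 \<le> A' ^ nat \<lceil>2 * H * A\<^sup>2\<rceil> * H'" using H'1 by (intro mult_mono) auto
  then show "0 < \<kappa>" "\<kappa> \<le> 1 / 4" by (auto simp: scale_ratio_def field_simps)
qed

lemma smoothed_small:
  assumes r: "0 < r" "r \<le> R\<^sub>0" and \<delta>: "0 < \<delta>" "2 * \<delta> \<le> \<kappa> * r" and v: "dist x v < \<kappa> * r"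
  shows "smoothed x \<delta> v \<le> osc x r / (2 * H * A\<^sup>2)"
proof (rule smoothed_le[OF \<delta>(1)])
  fix y assume y: "dist v y < 2 * \<delta>"
  define k where "k = nat \<lceil>2 * H * A\<^sup>2\<rceil>"
  have HA: "2 * H * A\<^sup>2 > 0" using H1 A2 by simp
  obtain z where z: "dist x z = r" using sphere_point[of r x] r R0 by auto
  have Ak: "A' ^ k > 0" "H' > 0" using A'2 H'1 by auto
  have "dist x y < 2 * \<kappa> * r" using v y \<delta> dist_triangle[of x y v] by linarith
  then have "A' ^ k * H' * dist x y < A' ^ k * H' * (2 * \<kappa> * r)"
    using Ak by (intro mult_strict_left_mono) auto
  also have "\<kappa> = 1 / (4 * A' ^ k * H')" by (simp add: scale_ratio_def k_def)
  also have "A' ^ k * H' * (2 * (1 / (4 * A' ^ k * H')) * r) = r / 2" using Ak A'2 by simp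
  also have "\<dots> < dist x z" using z r by simp
  finally have "dist (f x) (f y) \<le> dist (f x) (f z) / 2 ^ k" by (rule f_decay)
  also have "\<dots> \<le> osc x r / (2 * H * A\<^sup>2)"
  proof (rule frac_le)
    have "2 * H * A\<^sup>2 \<le> real k" unfolding k_def using HA by linarith
    also have "real k \<le> 2 ^ k" by (metis less_exp less_imp_le of_nat_le_iff of_nat_numeral of_nat_power)
    finally show "2 * H * A\<^sup>2 \<le> 2 ^ k" .
    show "dist (f x) (f z) \<le> osc x r" using z by (intro dist_le_osc) simp
    show "0 \<le> osc x r" using osc_pos[OF r(1), of x] by simp
  qed (rule HA)
  finally show "dist (f y) (f x) \<le> osc x r / (2 * H * A\<^sup>2)" by (simp add: dist_commute)
qed

lemma smoothed_large:
  assumes r: "0 < r" and \<delta>: "0 < \<delta>" and v: "r / 4 \<le> dist x v"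
  shows "osc x r / (H * A\<^sup>2) \<le> smoothed x \<delta> v"
proof -
  have "osc x (2 ^ 2 * (r / 4)) \<le> A ^ 2 * osc x (r / 4)" using r by (intro osc_doubling_iter) simp
  also have "\<dots> \<le> A ^ 2 * (H * dist (f x) (f v))"
    using r v A2 by (intro mult_left_mono osc_le_far) auto
  finally have "osc x r / (H * A\<^sup>2) \<le> dist (f x) (f v)"
    using H1 A2 by (simp add: field_simps)
  also have "\<dots> \<le> smoothed x \<delta> v" using dist_le_smoothed[OF \<delta>, of v x] by (simp add: dist_commute)
  finally show ?thesis .
qed

lemma emeasure_ball_\<mu>: "emeasure \<mu> (ball x r) = ennreal (measure \<mu> (ball x r))"
  using finX by (intro emeasure_eq_ennreal_measure) (auto simp: finite_on_balls_def less_top[symmetric])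

end

text \<open>The smoothed distance to \<open>f x\<close> is small near \<open>x\<close> and comparable to the full oscillation on a ball around
a point \<open>w\<close> at distance \<open>r / 2\<close>. Both regions have measure comparable to \<open>r\<^sup>Q\<close>, so the mean
deviation is at least a constant times the oscillation, and the Poincare inequality turns this into a
lower bound for the energy of the upper gradient.\<close>

lemma (in qs_poincare) energy_lower_bound:
  assumes r: "0 < r" "r \<le> R\<^sub>0" and \<delta>: "0 < \<delta>" "2 * \<delta> \<le> \<kappa> * r" and V0: "V \<ge> 0"
    and V: "(\<integral>\<^sup>+ z \<in> ball x (\<Lambda> * r).
      ennpowr (ennreal (1 / \<delta>) * ediameter (f ` ball z (8 * \<delta>))) p\<^sub>0 \<partial>\<mu>) \<le> ennreal V"
  shows "energy_const Q C H H' p\<^sub>0 C\<^sub>P * (osc x r / r) powr p\<^sub>0 * r powr Q \<le> V"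
proof -
  define L where "L = osc x r"
  have L: "L > 0" using osc_pos r by (simp add: L_def)
  define \<tau> where "\<tau> = L / (2 * H * A\<^sup>2)"
  have \<tau>: "\<tau> > 0" using L H1 A2 by (simp add: \<tau>_def)
  obtain w where w: "dist x w = r / 2" using sphere_point[of "r / 2" x] r R0 by auto
  let ?B = "ball x r" and ?Lo = "ball x (\<kappa> * r)" and ?Hi = "ball w (r / 4)"
  let ?b = "measure \<mu> ?B" and ?b' = "measure \<mu> (ball x (\<Lambda> * r))"
  let ?c = "(\<kappa> * r) powr Q / C"
  have \<kappa>r: "0 < \<kappa> * r" "\<kappa> * r \<le> r / 4" using \<kappa>_bounds r by (auto simp: mult_le_cancel_right)
  have b: "0 < ?b" "?b \<le> C * r powr Q" "r powr Q / C \<le> ?b"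
    using \<mu>_pos[of r x] \<mu>_upper[of r x] \<mu>_lower[of r x] r R0 by auto
  have "?b \<le> ?b'"
    using r \<Lambda>1 by (intro measure_mono_balls[OF finX] subset_ball) auto
  then have b': "r powr Q / C \<le> ?b'" "0 < ?b'" using b by auto
  have "?c \<le> measure \<mu> ?Lo" using \<kappa>r r R0 by (intro \<mu>_lower) linarith+
  moreover have "?c \<le> measure \<mu> ?Hi"
  proof -
    have "?c \<le> (r / 4) powr Q / C"
      using \<kappa>r Q0 C1 by (intro divide_right_mono powr_mono2) auto
    also have "\<dots> \<le> measure \<mu> ?Hi" using r R0 by (intro \<mu>_lower) auto
    finally show ?thesis .
  qed
  ultimately have "ennreal (\<tau> / 2) * ennreal ?c
      \<le> (\<integral>\<^sup>+ z \<in> ?B. ennreal \<bar>smoothed x \<delta> z - ball_average \<mu> ?B (smoothed x \<delta>)\<bar> \<partial>\<mu>)" (is "_ \<le> ?I")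
  proof (intro nn_integral_deviation_ge[where Lo = ?Lo and Hi = ?Hi])
    fix z assume "z \<in> ?Lo"
    then show "smoothed x \<delta> z \<le> \<tau>"
      using smoothed_small[OF r \<delta>, of x z] by (simp add: \<tau>_def L_def)
  next
    fix z assume "z \<in> ?Hi"
    then have "r / 4 \<le> dist x z" using w dist_triangle[of x w z] by (auto simp: dist_commute)
    from smoothed_large[OF r(1) \<delta>(1) this] show "2 * \<tau> \<le> smoothed x \<delta> z"
      by (simp add: \<tau>_def L_def)
  next
    show "?Lo \<subseteq> ?B" using \<kappa>r r by (intro subset_ball) linarith
  next
    show "?Hi \<subseteq> ?B"
    proof
      fix z assume "z \<in> ?Hi"
      then show "z \<in> ?B" using w r dist_triangle[of x z w] by auto
    qed
  qed (use \<kappa>r r \<tau> in \<open>auto simp: sets_\<mu> emeasure_ball_\<mu> intro!: ennreal_leI\<close>)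
  then have "ennreal (\<tau> / 2 * ?c) \<le> ?I"
    by (subst ennreal_mult) (use \<tau> C1 in auto)
  then have "ennreal (\<tau> / 2 * ?c) / ennreal ?b \<le> ?I / ennreal ?b" by (rule divide_right_mono_ennreal)
  then have "ennreal (\<tau> / 2 * ?c / ?b) \<le> ?I / emeasure \<mu> ?B"
    using b \<tau> C1 by (simp add: divide_ennreal emeasure_ball_\<mu>)
  also have "\<dots> \<le> ennreal C\<^sub>P * ediameter ?B *
          ennpowr ((\<integral>\<^sup>+ z \<in> ball x (\<Lambda> * r).
              ennpowr (ennreal (1 / \<delta>) * ediameter (f ` ball z (8 * \<delta>))) p\<^sub>0 \<partial>\<mu>)
                     / emeasure \<mu> (ball x (\<Lambda> * r))) (1 / p\<^sub>0)"
    by (rule poincare[OF upper_gradient_smoothed[OF \<delta>(1)] r(1) integrable_smoothed[OF \<delta>(1)]])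
  also have "\<dots> \<le> ennreal C\<^sub>P * ennreal (2 * r) * ennreal ((V * C / r powr Q) powr (1 / p\<^sub>0))"
  proof (intro mult_mono)
    show "ediameter ?B \<le> ennreal (2 * r)"
    proof (rule ediameter_leI, rule ennreal_leI)
      fix a c assume "a \<in> ?B" "c \<in> ?B"
      then show "dist a c \<le> 2 * r" using dist_triangle3[of a c x] by auto
    qed
    have "(\<integral>\<^sup>+ z \<in> ball x (\<Lambda> * r).
        ennpowr (ennreal (1 / \<delta>) * ediameter (f ` ball z (8 * \<delta>))) p\<^sub>0 \<partial>\<mu>)
        / emeasure \<mu> (ball x (\<Lambda> * r)) \<le> ennreal V / ennreal ?b'" (is "?W \<le> _")
      unfolding emeasure_ball_\<mu> by (rule divide_right_mono_ennreal[OF V])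
    also have "\<dots> = ennreal (V / ?b')" using b' V0 by (simp add: divide_ennreal)
    also have "\<dots> \<le> ennreal (V / (r powr Q / C))"
      using b' V0 r C1 by (intro ennreal_leI divide_left_mono mult_pos_pos) auto
    also have "V / (r powr Q / C) = V * C / r powr Q" by simp
    finally have "ennpowr ?W (1 / p\<^sub>0) \<le> ennpowr (ennreal (V * C / r powr Q)) (1 / p\<^sub>0)"
      using p0 by (intro ennpowr_mono) auto
    also have "\<dots> = ennreal ((V * C / r powr Q) powr (1 / p\<^sub>0))"
      using V0 C1 by (intro ennpowr_ennreal) simp
    finally show "ennpowr ?W (1 / p\<^sub>0) \<le> ennreal ((V * C / r powr Q) powr (1 / p\<^sub>0))" .
  qed auto
  also have "\<dots> = ennreal (C\<^sub>P * (2 * r) * (V * C / r powr Q) powr (1 / p\<^sub>0))"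
    using CP r by (simp add: ennreal_mult)
  finally have main: "\<tau> / 2 * ?c / ?b \<le> C\<^sub>P * (2 * r) * (V * C / r powr Q) powr (1 / p\<^sub>0)"
    using CP r by (subst (asm) ennreal_le_iff) auto
  define K where "K = \<kappa> powr Q / (8 * H * A\<^sup>2 * C\<^sup>2 * C\<^sub>P)"
  have K: "K > 0" using \<kappa>_bounds H1 A2 C1 CP by (simp add: K_def)
  have "\<tau> / 2 * ?c / (C * r powr Q) \<le> \<tau> / 2 * ?c / ?b"
    using b \<tau> C1 by (intro divide_left_mono) auto
  also note main
  also have "\<tau> / 2 * ?c / (C * r powr Q) = K * (L / r) * (C\<^sub>P * (2 * r))"
    using r C1 H1 A2 CP \<kappa>_bounds
    by (simp add: K_def \<tau>_def powr_mult field_simps power2_eq_square)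
  finally have "K * (L / r) * (C\<^sub>P * (2 * r)) \<le> (V * C / r powr Q) powr (1 / p\<^sub>0) * (C\<^sub>P * (2 * r))"
    by (simp add: mult.commute)
  then have "K * (L / r) \<le> (V * C / r powr Q) powr (1 / p\<^sub>0)"
    using CP r by (subst (asm) mult_le_cancel_right) auto
  then have "(K * (L / r)) powr p\<^sub>0 \<le> ((V * C / r powr Q) powr (1 / p\<^sub>0)) powr p\<^sub>0"
    using K L r p0 by (intro powr_mono2) auto
  also have "\<dots> = V * C / r powr Q" using p0 V0 C1 by (simp add: powr_powr)
  finally have "K powr p\<^sub>0 * (L / r) powr p\<^sub>0 \<le> V * C / r powr Q" by (simp only: powr_mult)
  then show ?thesis
    using r C1 by (simp add: energy_const_def K_def L_def field_simps)
qed

text \<open>The energy from above: on a ball of radius \<open>\<delta>\<close> around a point \<open>a\<close> of a \<open>\<delta>\<close>-net the upper gradient is at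
most \<open>2 / \<delta>\<close> times the oscillation on the ball of radius \<open>16 \<delta>\<close> around \<open>a\<close>.\<close>

lemma (in qs_setting) net_energy:
  assumes \<delta>: "\<delta> > 0" and p: "p \<ge> 0"
  shows "\<exists>F. finite F \<and> F \<subseteq> ball x R \<and> separated \<delta> F \<and>
    (\<integral>\<^sup>+ z \<in> ball x R. ennpowr (ennreal (1 / \<delta>) * ediameter (f ` ball z (8 * \<delta>))) p \<partial>\<mu>)
      \<le> ennreal (\<Sum>a\<in>F. (2 * osc a (16 * \<delta>) / \<delta>) powr p * (C * \<delta> powr Q))"
proof -
  obtain F where F: "finite F" "F \<subseteq> ball x R" "separated \<delta> F" "ball x R \<subseteq> (\<Union>a\<in>F. ball a \<delta>)"
    using compact_maximal_separated[OF compact_cball_X[of x R] ball_subset_cball \<delta>] by blast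
  let ?h = "\<lambda>z. ennpowr (ennreal (1 / \<delta>) * ediameter (f ` ball z (8 * \<delta>))) p"
  let ?M = "\<lambda>a. (2 * osc a (16 * \<delta>) / \<delta>) powr p"
  have h: "?h z \<le> ennreal (?M a)" if z: "dist a z < \<delta>" for a z
  proof -
    have "diam_image z (8 * \<delta>) \<le> 2 * osc a (16 * \<delta>)"
    proof (rule diam_image_le)
      fix b c assume "dist z b < 8 * \<delta>" "dist z c < 8 * \<delta>"
      then have "dist a b \<le> 16 * \<delta>" "dist a c \<le> 16 * \<delta>"
        using z \<delta> dist_triangle[of a b z] dist_triangle[of a c z] by linarith+
      then have "dist (f a) (f b) \<le> osc a (16 * \<delta>)" "dist (f a) (f c) \<le> osc a (16 * \<delta>)"
        by (auto intro: dist_le_osc)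
      then show "dist (f b) (f c) \<le> 2 * osc a (16 * \<delta>)"
        using dist_triangle3[of "f b" "f c" "f a"] by linarith
    qed (use osc_pos[of "16 * \<delta>" a] \<delta> in simp)
    then have "1 / \<delta> * diam_image z (8 * \<delta>) \<le> 2 * osc a (16 * \<delta>) / \<delta>"
      using \<delta> by (simp add: divide_right_mono)
    then have "ennreal (1 / \<delta>) * ediameter (f ` ball z (8 * \<delta>)) \<le> ennreal (2 * osc a (16 * \<delta>) / \<delta>)"
      using \<delta> by (simp add: ediameter_image ennreal_mult[symmetric] ennreal_leI)
    from ennpowr_mono[OF p this] show ?thesis
      using osc_pos[of "16 * \<delta>" a] \<delta> by (simp add: ennpowr_ennreal)
  qed
  have "(\<integral>\<^sup>+ z \<in> ball x R. ?h z \<partial>\<mu>) \<le> (\<integral>\<^sup>+ z. (\<Sum>a\<in>F. ennreal (?M a) * indicator (ball a \<delta>) z) \<partial>\<mu>)"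
  proof (rule nn_integral_mono)
    fix z
    show "?h z * indicator (ball x R) z \<le> (\<Sum>a\<in>F. ennreal (?M a) * indicator (ball a \<delta>) z)"
    proof (cases "z \<in> ball x R")
      case True
      then obtain a where a: "a \<in> F" "dist a z < \<delta>" using F(4) by auto
      have "?h z \<le> ennreal (?M a) * indicator (ball a \<delta>) z" using h[OF a(2)] a(2) by simp
      also have "\<dots> \<le> (\<Sum>a\<in>F. ennreal (?M a) * indicator (ball a \<delta>) z)"
        using a(1) F(1) by (intro member_le_sum) auto
      finally show ?thesis using True by simp
    qed simp
  qed
  also have "\<dots> = (\<Sum>a\<in>F. ennreal (?M a) * emeasure \<mu> (ball a \<delta>))"
  proof -
    have b: "ball a \<delta> \<in> sets \<mu>" for a :: 'a by (simp add: sets_\<mu>)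
    have "(\<lambda>z. ennreal (?M a) * indicator (ball a \<delta>) z) \<in> borel_measurable \<mu>" for a
      using b by (intro borel_measurable_times_ennreal borel_measurable_indicator) simp_all
    then have "(\<integral>\<^sup>+ z. (\<Sum>a\<in>F. ennreal (?M a) * indicator (ball a \<delta>) z) \<partial>\<mu>)
        = (\<Sum>a\<in>F. (\<integral>\<^sup>+ z. ennreal (?M a) * indicator (ball a \<delta>) z \<partial>\<mu>))"
      by (rule nn_integral_sum)
    then show ?thesis by (simp only: nn_integral_cmult_indicator[OF b])
  qed
  also have "\<dots> \<le> (\<Sum>a\<in>F. ennreal (?M a * (C * \<delta> powr Q)))"
  proof (rule sum_mono)
    fix a
    have "ennreal (?M a) * emeasure \<mu> (ball a \<delta>) = ennreal (?M a * measure \<mu> (ball a \<delta>))"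
      unfolding emeasure_ball_\<mu> by (rule ennreal_mult[symmetric]) auto
    also have "\<dots> \<le> ennreal (?M a * (C * \<delta> powr Q))"
      by (intro ennreal_leI mult_left_mono \<mu>_upper[OF \<delta>]) simp
    finally show "ennreal (?M a) * emeasure \<mu> (ball a \<delta>) \<le> ennreal (?M a * (C * \<delta> powr Q))" .
  qed
  also have "\<dots> = ennreal (\<Sum>a\<in>F. ?M a * (C * \<delta> powr Q))"
    using C1 by (intro sum_ennreal) simp
  finally show ?thesis using F by blast
qed

section \<open>The weak A-infinity condition\<close>

text \<open>The constant of \<open>energy_lower_bound\<close> on the ball of radius \<open>r / (2 \<Lambda>)\<close>, rescaled to the ball of radius
\<open>r\<close>: the factor \<open>A\<close> to the power \<open>\<lceil>2 \<Lambda>\<rceil>\<close> compares the two oscillations.\<close>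

definition A_inf_energy :: "real \<Rightarrow> real \<Rightarrow> real \<Rightarrow> real \<Rightarrow> real \<Rightarrow> real \<Rightarrow> real \<Rightarrow> real" where
  "A_inf_energy Q C H H' p\<^sub>0 C\<^sub>P \<Lambda> =
     energy_const Q C H H' p\<^sub>0 C\<^sub>P / (doubling_const Q C H ^ nat \<lceil>2 * \<Lambda>\<rceil>) powr p\<^sub>0 / (2 * \<Lambda>) powr Q"

context qs_setting begin

abbreviation C\<^sub>3 where "C\<^sub>3 \<equiv> (2 * H * A ^ 5) powr Q * C"

lemma osc_powr_le:
  assumes "\<delta> > 0"
  shows "osc y (16 * \<delta>) powr Q \<le> C\<^sub>3 * measure \<nu> (ball y (\<delta> / 2))"
proof -
  let ?o = "osc y (\<delta> / 2)"
  have o: "?o > 0" using assms by (intro osc_pos) simp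
  have "0 < osc y (16 * \<delta>)" using assms by (intro osc_pos) simp
  moreover have "osc y (2 ^ 5 * (\<delta> / 2)) \<le> A ^ 5 * ?o"
    using assms by (intro osc_doubling_iter) simp
  ultimately have "osc y (16 * \<delta>) powr Q \<le> ((2 * H * A ^ 5) * (?o / (2 * H))) powr Q"
    using H1 Q0 by (intro powr_mono2) auto
  also have "\<dots> = C\<^sub>3 * ((?o / (2 * H)) powr Q / C)"
    using C1 by (subst powr_mult) simp
  also have "\<dots> \<le> C\<^sub>3 * measure \<nu> (ball y (\<delta> / 2))"
    using assms C1 by (intro mult_left_mono \<nu>_lower) auto
  finally show ?thesis .
qed

text \<open>One term of the discrete energy. Here \<open>powr_le_split\<close> is applied with the threshold \<open>a (\<delta> L / r)\<^sup>Q\<close>, the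
size that the volume of an image ball of radius \<open>\<delta>\<close> would have, up to the factor \<open>a\<close>, if the volume
were spread evenly over the ball of radius \<open>r\<close>.\<close>

lemma osc_powr_term:
  assumes p: "0 < p" "p < Q" and pos: "a > 0" "\<delta> > 0" "r > 0" "L > 0"
  shows "(2 * osc y (16 * \<delta>) / \<delta>) powr p * (C * \<delta> powr Q) \<le>
    C * 2 powr p * (L / r) powr p * (a powr (p / Q) * \<delta> powr Q
      + a powr (p / Q - 1) * (C\<^sub>3 * (r / L) powr Q) * measure \<nu> (ball y (\<delta> / 2)))"
proof -
  let ?o = "osc y (16 * \<delta>)" and ?\<theta> = "p / Q" and ?m = "measure \<nu> (ball y (\<delta> / 2))"
  define \<rho> where "\<rho> = \<delta> * (L / r)"
  have \<rho>: "\<rho> > 0" using pos by (simp add: \<rho>_def)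
  have \<rho>s: "\<rho> powr s = \<delta> powr s * (L / r) powr s" for s
    unfolding \<rho>_def by (rule powr_mult)
  have o: "?o > 0" using pos by (intro osc_pos) simp
  have \<theta>: "0 < ?\<theta>" "?\<theta> < 1" "Q * ?\<theta> = p" "Q * (?\<theta> - 1) = p - Q"
    using p by (auto simp: field_simps)
  define t where "t = a * \<rho> powr Q"
  have t: "t > 0" using pos \<rho> by (simp add: t_def)
  have t1: "t powr ?\<theta> = a powr ?\<theta> * \<rho> powr p"
    by (simp only: t_def powr_mult powr_powr \<theta>)
  have t2: "t powr (?\<theta> - 1) = a powr (?\<theta> - 1) * \<rho> powr (p - Q)"
    by (simp only: t_def powr_mult powr_powr \<theta>)
  have "?o powr p = (?o powr Q) powr ?\<theta>" by (simp only: powr_powr \<theta>)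
  also have "\<dots> \<le> t powr ?\<theta> + t powr (?\<theta> - 1) * ?o powr Q"
    using t \<theta> by (intro powr_le_split) auto
  also have "\<dots> \<le> t powr ?\<theta> + t powr (?\<theta> - 1) * (C\<^sub>3 * ?m)"
    using pos by (intro add_left_mono mult_left_mono osc_powr_le) auto
  finally have main: "?o powr p \<le> a powr ?\<theta> * \<rho> powr p + a powr (?\<theta> - 1) * \<rho> powr (p - Q) * (C\<^sub>3 * ?m)"
    by (simp only: t1 t2)
  have "(2 * ?o / \<delta>) powr p * (C * \<delta> powr Q) = C * 2 powr p * (\<delta> powr (Q - p) * ?o powr p)"
    using pos o by (simp add: powr_mult powr_divide powr_diff field_simps)
  also have "\<dots> \<le> C * 2 powr p * (\<delta> powr (Q - p) *
      (a powr ?\<theta> * \<rho> powr p + a powr (?\<theta> - 1) * \<rho> powr (p - Q) * (C\<^sub>3 * ?m)))"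
    using main C1 by (intro mult_left_mono) auto
  also have "\<delta> powr (Q - p) * (a powr ?\<theta> * \<rho> powr p + a powr (?\<theta> - 1) * \<rho> powr (p - Q) * (C\<^sub>3 * ?m))
      = a powr ?\<theta> * (\<delta> powr (Q - p) * \<rho> powr p)
        + a powr (?\<theta> - 1) * (\<delta> powr (Q - p) * \<rho> powr (p - Q)) * (C\<^sub>3 * ?m)"
    by (simp add: algebra_simps)
  also have "\<delta> powr (Q - p) * \<rho> powr p = (L / r) powr p * \<delta> powr Q"
    using pos by (simp add: \<rho>s powr_diff)
  also have "\<delta> powr (Q - p) * \<rho> powr (p - Q) = (L / r) powr p * (r / L) powr Q"
    using pos by (simp add: \<rho>s powr_diff powr_divide)
  finally show ?thesis by (simp add: algebra_simps)
qed

lemma sum_osc_powr_le: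
  assumes p: "0 < p" "p < Q" and pos: "a > 0" "\<delta> > 0" "r > 0" "L > 0" and \<delta>R: "\<delta> \<le> R\<^sub>0"
    and G: "finite G" "separated \<delta> G"
    and S: "S \<in> sets borel" "bounded S" "\<And>y. y \<in> G \<Longrightarrow> ball y (\<delta> / 2) \<subseteq> S"
    and T: "T \<in> sets borel" "bounded T" "\<And>y. y \<in> G \<Longrightarrow> ball y (\<delta> / 2) \<subseteq> T"
  shows "(\<Sum>y\<in>G. (2 * osc y (16 * \<delta>) / \<delta>) powr p * (C * \<delta> powr Q)) \<le>
    C * 2 powr p * (L / r) powr p * (a powr (p / Q) * (2 powr Q * C * measure \<mu> S)
      + a powr (p / Q - 1) * (C\<^sub>3 * (r / L) powr Q) * measure \<nu> T)"
proof -
  have disj: "disjoint_family_on (\<lambda>y. ball y (\<delta> / 2)) G"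
    by (rule disjoint_balls_separated[OF G(2)]) simp
  have nuT: "(\<Sum>y\<in>G. measure \<nu> (ball y (\<delta> / 2))) \<le> measure \<nu> T"
    by (rule sum_measure_disjoint_le[OF fin\<nu> G(1) _ T(3) T(1,2) disj]) auto
  have "(\<Sum>y\<in>G. measure \<mu> (ball y (\<delta> / 2))) \<le> measure \<mu> S"
    by (rule sum_measure_disjoint_le[OF finX G(1) _ S(3) S(1,2) disj]) auto
  moreover have "\<delta> powr Q \<le> 2 powr Q * C * measure \<mu> (ball y (\<delta> / 2))" for y :: 'a
  proof -
    have "\<delta> powr Q = 2 powr Q * C * ((\<delta> / 2) powr Q / C)" using C1 pos by (simp add: powr_divide)
    also have "\<dots> \<le> 2 powr Q * C * measure \<mu> (ball y (\<delta> / 2))"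
      using pos \<delta>R R0 C1 by (intro mult_left_mono \<mu>_lower) auto
    finally show ?thesis .
  qed
  ultimately have muS: "(\<Sum>y\<in>G. \<delta> powr Q) \<le> 2 powr Q * C * measure \<mu> S"
    using C1 by (intro order_trans[OF sum_mono[of G "\<lambda>_. \<delta> powr Q" "\<lambda>y. 2 powr Q * C * measure \<mu> (ball y (\<delta> / 2))"]])
      (auto simp: sum_distrib_left[symmetric] simp del: sum_constant)
  have "(\<Sum>y\<in>G. (2 * osc y (16 * \<delta>) / \<delta>) powr p * (C * \<delta> powr Q)) \<le>
     (\<Sum>y\<in>G. C * 2 powr p * (L / r) powr p * (a powr (p / Q) * \<delta> powr Q
      + a powr (p / Q - 1) * (C\<^sub>3 * (r / L) powr Q) * measure \<nu> (ball y (\<delta> / 2))))"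
    using p pos by (intro sum_mono osc_powr_term)
  also have "\<dots> = C * 2 powr p * (L / r) powr p * (a powr (p / Q) * (\<Sum>y\<in>G. \<delta> powr Q)
      + a powr (p / Q - 1) * (C\<^sub>3 * (r / L) powr Q) * (\<Sum>y\<in>G. measure \<nu> (ball y (\<delta> / 2))))"
    by (simp only: sum_distrib_left[symmetric] sum.distrib)
  also have "\<dots> \<le> C * 2 powr p * (L / r) powr p * (a powr (p / Q) * (2 powr Q * C * measure \<mu> S)
      + a powr (p / Q - 1) * (C\<^sub>3 * (r / L) powr Q) * measure \<nu> T)"
    using muS nuT C1 by (intro mult_left_mono add_mono) auto
  finally show ?thesis .
qed

end

text \<open>The discrete reverse Hoelder inequality, split at the set \<open>E\<close>. Net points near \<open>E\<close> are few if \<open>E\<close> has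
small \<open>\<mu>\<close>-measure, and are treated with the parameter \<open>a\<^sub>1\<close>, to be chosen large; the others have image
balls that avoid the image of \<open>E\<close>, and are treated with \<open>a\<^sub>2\<close>, to be chosen small. Everything is
normalised so that the scale \<open>\<delta>\<close> survives only in the thickening of \<open>E\<close>.\<close>

lemma (in qs_poincare) A_inf_core:
  assumes r: "0 < r" "r \<le> R\<^sub>0" and \<delta>: "0 < \<delta>" "2 * \<delta> \<le> \<kappa> * (r / (2 * \<Lambda>))"
    and a: "a\<^sub>1 > 0" "a\<^sub>2 > 0" and E: "E \<in> sets borel"
  shows "A_inf_energy Q C H H' p\<^sub>0 C\<^sub>P \<Lambda> \<le> C * 2 powr p\<^sub>0 *
    (a\<^sub>1 powr (p\<^sub>0 / Q) * (2 powr Q * C * (measure \<mu> {z \<in> ball x r. \<exists>e\<in>E. dist z e < \<delta>} / r powr Q))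
     + a\<^sub>1 powr (p\<^sub>0 / Q - 1) * (C\<^sub>3 * C * 2 powr Q)
     + a\<^sub>2 powr (p\<^sub>0 / Q) * (2 powr Q * C\<^sup>2)
     + a\<^sub>2 powr (p\<^sub>0 / Q - 1) * (C\<^sub>3 * (measure \<nu> (ball x r - E) / osc x r powr Q)))"
proof -
  define r' L L' where "r' = r / (2 * \<Lambda>)" and "L = osc x r" and "L' = osc x r'"
  define m where "m = nat \<lceil>2 * \<Lambda>\<rceil>"
  define w where "w = (L / r) powr p\<^sub>0"
  define En where "En = {z \<in> ball x r. \<exists>e\<in>E. dist z e < \<delta>}"
  let ?e = "energy_const Q C H H' p\<^sub>0 C\<^sub>P" and ?\<theta> = "p\<^sub>0 / Q"
  have r': "0 < r'" "r' \<le> r" "r' \<le> R\<^sub>0" "\<Lambda> * r' = r / 2" "r = 2 * \<Lambda> * r'"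
  proof -
    show "0 < r'" "\<Lambda> * r' = r / 2" "r = 2 * \<Lambda> * r'" using r \<Lambda>1 by (simp_all add: r'_def)
    have "r / (2 * \<Lambda>) \<le> r / 1" using r \<Lambda>1 by (intro divide_left_mono) auto
    then show le: "r' \<le> r" by (simp only: r'_def div_by_1)
    from this r(2) show "r' \<le> R\<^sub>0" by (rule order_trans)
  qed
  have L: "L > 0" "L' > 0" unfolding L_def L'_def by (rule osc_pos[OF r(1)], rule osc_pos[OF r'(1)])
  have w: "w > 0" unfolding w_def using L(1) r(1) by simp
  have "\<kappa> * (r / (2 * \<Lambda>)) \<le> 1 / 4 * r"
    using \<kappa>_bounds r'(1,2) unfolding r'_def[symmetric] by (intro mult_mono) simp_all
  then have \<delta>r: "\<delta> \<le> r / 2" "\<delta> \<le> R\<^sub>0" using \<delta>(2) r by linarith+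
  obtain F where F: "finite F" "F \<subseteq> ball x (\<Lambda> * r')" "separated \<delta> F"
    "(\<integral>\<^sup>+ z \<in> ball x (\<Lambda> * r'). ennpowr (ennreal (1 / \<delta>) * ediameter (f ` ball z (8 * \<delta>))) p\<^sub>0 \<partial>\<mu>)
      \<le> ennreal (\<Sum>a\<in>F. (2 * osc a (16 * \<delta>) / \<delta>) powr p\<^sub>0 * (C * \<delta> powr Q))"
    using net_energy[OF \<delta>(1), of p\<^sub>0 x "\<Lambda> * r'"] p0 by auto
  let ?t = "\<lambda>a. (2 * osc a (16 * \<delta>) / \<delta>) powr p\<^sub>0 * (C * \<delta> powr Q)"
  let ?V = "\<Sum>a\<in>F. ?t a"
  have e0: "?e \<ge> 0" using C1 by (simp add: energy_const_def)
  have lowV: "?e * (L' / r') powr p\<^sub>0 * r' powr Q \<le> ?V"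
    unfolding L'_def
  proof (rule energy_lower_bound[OF r'(1,3) \<delta>(1) _ _ F(4)])
    show "2 * \<delta> \<le> \<kappa> * r'" using \<delta>(2) by (simp only: r'_def)
    show "0 \<le> ?V" using C1 by (intro sum_nonneg) simp
  qed
  have "L \<le> A ^ m * L'"
  proof -
    have "2 * \<Lambda> \<le> real m" unfolding m_def using \<Lambda>1 by linarith
    also have "real m \<le> 2 ^ m" by (metis less_exp less_imp_le of_nat_le_iff of_nat_numeral of_nat_power)
    finally have "r \<le> 2 ^ m * r'" using r' by (metis mult_le_cancel_right_pos)
    then have "L \<le> osc x (2 ^ m * r')" using r by (auto simp: L_def intro: osc_mono)
    also have "\<dots> \<le> A ^ m * L'" unfolding L'_def using r' by (intro osc_doubling_iter)
    finally show ?thesis .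
  qed
  then have "L / r / A ^ m \<le> L' / r'"
  proof -
    have Am: "A ^ m > 0" using A2 by simp
    have "L / r / A ^ m = L / A ^ m / r" by simp
    also have "\<dots> \<le> L' / r" using \<open>L \<le> A ^ m * L'\<close> Am r by (intro divide_right_mono) (auto simp: field_simps)
    also have "\<dots> \<le> L' / r'" using r(1) r'(1,2) L(2) by (intro divide_left_mono) simp_all
    finally show ?thesis .
  qed
  then have "(L / r / A ^ m) powr p\<^sub>0 \<le> (L' / r') powr p\<^sub>0"
    using L(1) r(1) A2 p0 by (intro powr_mono2) simp_all
  moreover have "(L / r / A ^ m) powr p\<^sub>0 = w / (A ^ m) powr p\<^sub>0" by (simp only: w_def powr_divide)
  moreover have "r' powr Q = r powr Q / (2 * \<Lambda>) powr Q" by (simp only: r'_def powr_divide)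
  ultimately have "?e * (w / (A ^ m) powr p\<^sub>0) * (r powr Q / (2 * \<Lambda>) powr Q) \<le> ?V"
    using e0 w by (intro order_trans[OF _ lowV] mult_mono) auto
  then have low: "A_inf_energy Q C H H' p\<^sub>0 C\<^sub>P \<Lambda> * (w * r powr Q) \<le> ?V"
    by (simp add: A_inf_energy_def m_def)
  define FE where "FE = {y \<in> F. ball y (\<delta> / 2) \<inter> E \<noteq> {}}"
  have sep: "separated \<delta> FE" "separated \<delta> (F - FE)" using F(3) by (auto simp: separated_def FE_def)
  have sub: "ball y (\<delta> / 2) \<subseteq> ball x r" if "y \<in> F" for y
  proof
    fix z assume "z \<in> ball y (\<delta> / 2)"
    moreover have "dist x y < r / 2" using F(2) that r'(4) by auto
    ultimately show "z \<in> ball x r" using \<delta>r dist_triangle[of x z y] r by auto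
  qed
  have "open (\<Union>e\<in>E. ball e \<delta>)" by auto
  moreover have "En = ball x r \<inter> (\<Union>e\<in>E. ball e \<delta>)" by (auto simp: En_def dist_commute)
  ultimately have "open En" "bounded En" by (auto simp: bounded_Int)
  then have En: "En \<in> sets borel" "bounded En" by auto
  have subE: "ball y (\<delta> / 2) \<subseteq> En" if y: "y \<in> FE" for y
  proof
    fix z assume z: "z \<in> ball y (\<delta> / 2)"
    obtain e where "e \<in> E" "dist y e < \<delta> / 2" using y by (auto simp: FE_def)
    then have "dist z e < \<delta>" using z dist_triangle3[of z e y] by auto
    then show "z \<in> En" using \<open>e \<in> E\<close> z sub[of y] y by (auto simp: En_def FE_def)
  qed
  have "?V = (\<Sum>a\<in>FE. ?t a) + (\<Sum>a\<in>F - FE. ?t a)"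
    using F(1) sum.subset_diff[of FE F ?t] by (auto simp: FE_def add.commute)
  moreover have "(\<Sum>a\<in>FE. ?t a) \<le> C * 2 powr p\<^sub>0 * w * (a\<^sub>1 powr ?\<theta> * (2 powr Q * C * measure \<mu> En)
      + a\<^sub>1 powr (?\<theta> - 1) * (C\<^sub>3 * (r / L) powr Q) * measure \<nu> (ball x r))"
    unfolding w_def using p0 a \<delta> r L \<delta>r F(1) sep En subE sub
    by (intro sum_osc_powr_le) (auto simp: FE_def)
  moreover have "(\<Sum>a\<in>F - FE. ?t a) \<le> C * 2 powr p\<^sub>0 * w * (a\<^sub>2 powr ?\<theta> * (2 powr Q * C * measure \<mu> (ball x r))
      + a\<^sub>2 powr (?\<theta> - 1) * (C\<^sub>3 * (r / L) powr Q) * measure \<nu> (ball x r - E))"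
  proof -
    have "bounded (ball x r - E)" by (rule bounded_subset[OF bounded_ball]) auto
    moreover have "ball y (\<delta> / 2) \<subseteq> ball x r - E" if "y \<in> F - FE" for y
      using that sub[of y] by (auto simp: FE_def)
    ultimately show ?thesis
      unfolding w_def using p0 a \<delta> r L \<delta>r F(1) sep E sub
      by (intro sum_osc_powr_le) auto
  qed
  moreover have "a\<^sub>1 powr (?\<theta> - 1) * (C\<^sub>3 * (r / L) powr Q) * measure \<nu> (ball x r)
      \<le> a\<^sub>1 powr (?\<theta> - 1) * (C\<^sub>3 * (r / L) powr Q) * (C * (2 * L) powr Q)"
    using \<nu>_upper[OF r(1), of x] C1 by (intro mult_left_mono) (auto simp: L_def)
  moreover have "a\<^sub>1 powr (?\<theta> - 1) * (C\<^sub>3 * (r / L) powr Q) * (C * (2 * L) powr Q)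
      = a\<^sub>1 powr (?\<theta> - 1) * (C\<^sub>3 * C * 2 powr Q) * r powr Q"
    using L by (simp add: powr_mult powr_divide)
  moreover have "a\<^sub>2 powr ?\<theta> * (2 powr Q * C * measure \<mu> (ball x r))
      \<le> a\<^sub>2 powr ?\<theta> * (2 powr Q * C * (C * r powr Q))"
    using \<mu>_upper[OF r(1), of x] C1 by (intro mult_left_mono) auto
  moreover define W where "W = C * 2 powr p\<^sub>0 * w"
  moreover have "W > 0" using C1 w by (simp add: W_def)
  ultimately have "?V \<le> W * (a\<^sub>1 powr ?\<theta> * (2 powr Q * C * measure \<mu> En)
      + a\<^sub>1 powr (?\<theta> - 1) * (C\<^sub>3 * C * 2 powr Q) * r powr Q)
      + W * (a\<^sub>2 powr ?\<theta> * (2 powr Q * C * (C * r powr Q))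
      + a\<^sub>2 powr (?\<theta> - 1) * (C\<^sub>3 * (r / L) powr Q) * measure \<nu> (ball x r - E))"
    by (smt (verit, ccfv_SIG) mult_left_mono)
  also have "\<dots> = (C * 2 powr p\<^sub>0 *
    (a\<^sub>1 powr ?\<theta> * (2 powr Q * C * (measure \<mu> En / r powr Q))
     + a\<^sub>1 powr (?\<theta> - 1) * (C\<^sub>3 * C * 2 powr Q)
     + a\<^sub>2 powr ?\<theta> * (2 powr Q * C\<^sup>2)
     + a\<^sub>2 powr (?\<theta> - 1) * (C\<^sub>3 * (measure \<nu> (ball x r - E) / L powr Q)))) * (w * r powr Q)"
    using r by (simp add: W_def powr_divide power2_eq_square field_simps)
  finally have up: "?V \<le> (C * 2 powr p\<^sub>0 *
    (a\<^sub>1 powr ?\<theta> * (2 powr Q * C * (measure \<mu> En / r powr Q))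
     + a\<^sub>1 powr (?\<theta> - 1) * (C\<^sub>3 * C * 2 powr Q)
     + a\<^sub>2 powr ?\<theta> * (2 powr Q * C\<^sup>2)
     + a\<^sub>2 powr (?\<theta> - 1) * (C\<^sub>3 * (measure \<nu> (ball x r - E) / L powr Q)))) * (w * r powr Q)" .
  have "0 < w * r powr Q" using w r(1) by simp
  with order_trans[OF low up] show ?thesis
    unfolding En_def L_def by (rule mult_right_le_imp_le)
qed

lemma thickening_tendsto:
  assumes m: "finite_on_balls m" and E: "closed E" and \<delta>: "\<delta> > 0"
  shows "(\<lambda>n. measure m {z \<in> ball x r. \<exists>e\<in>E. dist z e < \<delta> / real (Suc n)})
    \<longlonglongrightarrow> measure m (E \<inter> ball x r)"
proof -
  let ?S = "\<lambda>n. {z \<in> ball x r. \<exists>e\<in>E. dist z e < \<delta> / real (Suc n)}"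
  have S: "?S n = ball x r \<inter> (\<Union>e\<in>E. ball e (\<delta> / real (Suc n)))" for n
    by (auto simp: dist_commute)
  have meas: "?S n \<in> sets borel" for n unfolding S by (intro borel_open open_Int open_UN) auto
  have fm: "?S n \<in> fmeasurable m" for n
    using meas[of n] by (intro finite_on_balls_fmeasurable[OF m]) (auto intro: bounded_subset[OF bounded_ball])
  have "decseq ?S"
  proof (rule decseq_SucI, safe)
    fix n z e assume "e \<in> E" "dist z e < \<delta> / real (Suc (Suc n))"
    moreover have "\<delta> / real (Suc (Suc n)) \<le> \<delta> / real (Suc n)"
      using \<delta> by (intro divide_left_mono) auto
    ultimately show "\<exists>e\<in>E. dist z e < \<delta> / real (Suc n)" by (meson order_less_le_trans)
  qed
  moreover have "(\<Inter>n. ?S n) = E \<inter> ball x r"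
  proof (intro equalityI subsetI)
    fix z assume z: "z \<in> (\<Inter>n. ?S n)"
    have "z \<in> closure E"
      unfolding closure_approachable
    proof (intro allI impI)
      fix e :: real assume "0 < e"
      then obtain n where n: "\<delta> / e < real n" using reals_Archimedean2 by blast
      then have "\<delta> < real (Suc n) * e"
        using \<open>0 < e\<close> by (simp add: field_simps)
      then have "\<delta> / real (Suc n) < e" by (simp add: divide_less_eq mult.commute)
      moreover obtain y where "y \<in> E" "dist z y < \<delta> / real (Suc n)" using z by blast
      ultimately show "\<exists>y\<in>E. dist y z < e" by (metis dist_commute order_less_trans)
    qed
    then show "z \<in> E \<inter> ball x r" using E z by auto
  next
    fix z assume z: "z \<in> E \<inter> ball x r"
    have "dist z z < \<delta> / real (Suc n)" for n using \<delta> by simp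
    then show "z \<in> (\<Inter>n. ?S n)" using z by blast
  qed
  ultimately show ?thesis
    using Lim_measure_decseq[of ?S m] fm by (auto simp: fmeasurable_def less_top[symmetric])
qed

text \<open>A weak form of the A-infinity condition from the theory of Muckenhoupt weights, with \<open>m\<^sub>1\<close> as the
reference measure.\<close>

definition A_inf :: "real \<Rightarrow> real \<Rightarrow> real \<Rightarrow> 'a::metric_space measure \<Rightarrow> 'a measure \<Rightarrow> bool" where
  "A_inf \<alpha> c R m\<^sub>1 m\<^sub>2 \<longleftrightarrow> (\<forall>x r E. 0 < r \<and> r \<le> R \<and> closed E \<and>
     measure m\<^sub>1 (E \<inter> ball x r) \<le> \<alpha> * measure m\<^sub>1 (ball x r) \<longrightarrow>
     c * measure m\<^sub>2 (ball x r) \<le> measure m\<^sub>2 (ball x r - E))"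

text \<open>The contrapositive for complements. The complement of \<open>E\<close> is not closed, so it is exhausted by the closed
sets of points at distance at least \<open>1 / (n + 1)\<close> from \<open>E\<close>. The factor \<open>1 / 2\<close> makes the inequality that
is to be contradicted strict.\<close>

lemma A_inf_swap:
  fixes m\<^sub>1 m\<^sub>2 :: "'a::metric_space measure"
  assumes A: "A_inf \<alpha> c R m\<^sub>1 m\<^sub>2" and c: "c > 0"
    and m1: "finite_on_balls m\<^sub>1" and m2: "finite_on_balls m\<^sub>2"
    and pos: "\<And>x r. r > 0 \<Longrightarrow> measure m\<^sub>2 (ball x r) > 0"
  shows "A_inf (c / 2) \<alpha> R m\<^sub>2 m\<^sub>1"
  unfolding A_inf_def
proof (intro allI impI, elim conjE)
  fix x :: 'a and r and E :: "'a set"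
  let ?B = "ball x r"
  assume r: "0 < r" "r \<le> R" and E: "closed E"
    and le: "measure m\<^sub>2 (E \<inter> ?B) \<le> c / 2 * measure m\<^sub>2 ?B"
  show "\<alpha> * measure m\<^sub>1 ?B \<le> measure m\<^sub>1 (?B - E)"
  proof (rule ccontr)
    assume less: "\<not> \<alpha> * measure m\<^sub>1 ?B \<le> measure m\<^sub>1 (?B - E)"
    have "c * measure m\<^sub>2 ?B \<le> measure m\<^sub>2 {z \<in> ?B. \<exists>e\<in>E. dist z e < 1 / real (Suc n)}" for n
    proof -
      define E' where "E' = - (\<Union>e\<in>E. ball e (1 / real (Suc n)))"
      have E': "closed E'" unfolding E'_def by (intro closed_Compl open_UN) auto
      have "e \<notin> E'" if "e \<in> E" for e using that by (force simp: E'_def)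
      then have "measure m\<^sub>1 (E' \<inter> ?B) \<le> measure m\<^sub>1 (?B - E)"
        using E E' by (intro measure_mono_balls[OF m1]) (auto intro: bounded_subset[OF bounded_ball])
      then have "c * measure m\<^sub>2 ?B \<le> measure m\<^sub>2 (?B - E')"
        using A r E' less unfolding A_inf_def by auto
      also have "?B - E' = {z \<in> ?B. \<exists>e\<in>E. dist z e < 1 / real (Suc n)}"
        by (auto simp: E'_def dist_commute)
      finally show ?thesis .
    qed
    then have "c * measure m\<^sub>2 ?B \<le> measure m\<^sub>2 (E \<inter> ?B)"
      by (intro LIMSEQ_le_const[OF thickening_tendsto[OF m2 E zero_less_one]]) auto
    then have "c * measure m\<^sub>2 ?B \<le> c / 2 * measure m\<^sub>2 ?B" using le by simp
    moreover have "c * measure m\<^sub>2 ?B > 0" using c pos[OF r(1)] by simp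
    ultimately show False by simp
  qed
qed

lemma A_inf_energy_pos:
  assumes "C \<ge> 1" "H \<ge> 1" "H' \<ge> 1" "C\<^sub>P > 0" "\<Lambda> \<ge> 1"
  shows "A_inf_energy Q C H H' p\<^sub>0 C\<^sub>P \<Lambda> > 0"
proof -
  have A: "doubling_const Q C h > 0" for h using doubling_const_ge[of Q C h] by linarith
  then have "scale_ratio Q C H H' > 0" using assms by (simp add: scale_ratio_def)
  then show ?thesis
    using assms A[of H] by (simp add: A_inf_energy_def energy_const_def less_imp_neq[symmetric])
qed

text \<open>The uniformity in the last quantifier is the reason for carrying explicit constants so far: \<open>\<alpha>\<close> and
\<open>c\<close> are fixed before the measures and the map.\<close>

lemma quasisymmetric_A_inf:
  assumes const: "C \<ge> 1" "H \<ge> 1" "H' \<ge> 1" "C\<^sub>P > 0" "\<Lambda> \<ge> 1" and p0: "0 < p\<^sub>0" "p\<^sub>0 < Q"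
  shows "\<exists>\<alpha>>0. \<exists>c>0. \<forall>R (\<mu> :: 'a::metric_space measure) (\<mu>Y :: 'b::metric_space measure) f g.
    qs_poincare Q C H H' R \<mu> \<mu>Y f g p\<^sub>0 C\<^sub>P \<Lambda> \<longrightarrow> A_inf \<alpha> c R \<mu> (distr \<mu>Y borel g)"
proof -
  define e where "e = A_inf_energy Q C H H' p\<^sub>0 C\<^sub>P \<Lambda>"
  have e: "e > 0" unfolding e_def using const by (rule A_inf_energy_pos)
  define A where "A = doubling_const Q C H"
  have A: "A > 0" using doubling_const_ge[of Q C H] by (simp add: A_def)
  define C3 where "C3 = (2 * H * A ^ 5) powr Q * C"
  define K where "K = C * 2 powr p\<^sub>0"
  define \<theta> where "\<theta> = p\<^sub>0 / Q"
  have \<theta>: "0 < \<theta>" "\<theta> < 1" using p0 by (auto simp: \<theta>_def)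
  have C3: "C3 > 0" and K: "K > 0" using const A by (auto simp: C3_def K_def)
  \<comment> \<open>The parameters \<open>a1\<close> and \<open>a2\<close> make the second and the third of the four terms in \<open>A_inf_core\<close> equal to a
    quarter of the left-hand side.\<close>
  define b1 b2 where "b1 = K * (C3 * C * 2 powr Q)" and "b2 = K * (2 powr Q * C\<^sup>2)"
  have b: "b1 > 0" "b2 > 0" using K C3 const by (auto simp: b1_def b2_def)
  define a1 a2 where "a1 = (e / (4 * b1)) powr (1 / (\<theta> - 1))" and "a2 = (e / (4 * b2)) powr (1 / \<theta>)"
  have a: "a1 > 0" "a2 > 0" using e b by (auto simp: a1_def a2_def)
  have a': "a1 powr (\<theta> - 1) = e / (4 * b1)" "a2 powr \<theta> = e / (4 * b2)"
    using e b \<theta> by (auto simp: a1_def a2_def powr_powr)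
  define K1 K2 where "K1 = K * a1 powr \<theta> * (2 powr Q * C)" and "K2 = K * a2 powr (\<theta> - 1) * C3"
  have K12: "K1 > 0" "K2 > 0" using K a C3 const by (auto simp: K1_def K2_def)
  define \<alpha> c where "\<alpha> = e / (4 * C * K1)" and "c = e / (4 * K2 * (C * 2 powr Q))"
  have pos: "\<alpha> > 0" "c > 0" using e K12 const by (auto simp: \<alpha>_def c_def)
  have "A_inf \<alpha> c R \<mu> (distr \<mu>Y borel g)"
    if "qs_poincare Q C H H' R \<mu> \<mu>Y f g p\<^sub>0 C\<^sub>P \<Lambda>"
    for R and \<mu> :: "'a measure" and \<mu>Y :: "'b measure" and f g
  proof -
    interpret qs_poincare Q C H H' R \<mu> \<mu>Y f g p\<^sub>0 C\<^sub>P \<Lambda> by (rule that)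
    show ?thesis
      unfolding A_inf_def \<nu>_def[symmetric]
    proof (intro allI impI, elim conjE)
      fix x :: 'a and r and E :: "'a set"
      let ?B = "ball x r"
      assume r: "0 < r" "r \<le> R" and E: "closed E"
        and le: "measure \<mu> (E \<inter> ?B) \<le> \<alpha> * measure \<mu> ?B"
      define L where "L = osc x r"
      have L: "L > 0" unfolding L_def by (rule osc_pos[OF r(1)])
      define N where "N = measure \<nu> (?B - E) / L powr Q"
      define d where "d = \<kappa> * (r / (2 * \<Lambda>)) / 2"
      have d: "d > 0" using \<kappa>_bounds r const by (simp add: d_def)
      let ?S = "\<lambda>n. {z \<in> ?B. \<exists>e\<in>E. dist z e < d / real (Suc n)}"
      have core: "e / 2 \<le> K1 * (measure \<mu> (?S n) / r powr Q) + K2 * N" for n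
      proof -
        have d': "0 < d / real (Suc n)" "2 * (d / real (Suc n)) \<le> \<kappa> * (r / (2 * \<Lambda>))"
        proof -
          have "d / real (Suc n) \<le> d / 1" using d by (intro divide_left_mono) auto
          then have "2 * (d / real (Suc n)) \<le> 2 * d" by simp
          also have "2 * d = \<kappa> * (r / (2 * \<Lambda>))" by (simp add: d_def)
          finally show "2 * (d / real (Suc n)) \<le> \<kappa> * (r / (2 * \<Lambda>))" .
        qed (use d in simp)
        have "e \<le> K * (a1 powr \<theta> * (2 powr Q * C * (measure \<mu> (?S n) / r powr Q))
            + a1 powr (\<theta> - 1) * (C3 * C * 2 powr Q) + a2 powr \<theta> * (2 powr Q * C\<^sup>2)
            + a2 powr (\<theta> - 1) * (C3 * N))"
          unfolding e_def K_def \<theta>_def C3_def A_def N_def L_def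
          using A_inf_core[OF r d' a borel_closed[OF E]] .
        also have "\<dots> = K1 * (measure \<mu> (?S n) / r powr Q) + a1 powr (\<theta> - 1) * b1
            + a2 powr \<theta> * b2 + K2 * N"
          by (simp add: K1_def K2_def b1_def b2_def algebra_simps)
        also have "a1 powr (\<theta> - 1) * b1 = e / 4" using a' b by simp
        also have "a2 powr \<theta> * b2 = e / 4" using a' b by simp
        finally show ?thesis by linarith
      qed
      have "(\<lambda>n. K1 * (measure \<mu> (?S n) / r powr Q) + K2 * N)
          \<longlonglongrightarrow> K1 * (measure \<mu> (E \<inter> ?B) / r powr Q) + K2 * N"
        using r by (intro tendsto_intros thickening_tendsto[OF finX E d]) auto
      then have "e / 2 \<le> K1 * (measure \<mu> (E \<inter> ?B) / r powr Q) + K2 * N"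
        using core by (intro LIMSEQ_le_const) auto
      moreover have "K1 * (measure \<mu> (E \<inter> ?B) / r powr Q) \<le> e / 4"
      proof -
        have "measure \<mu> (E \<inter> ?B) \<le> \<alpha> * (C * r powr Q)"
          using le \<mu>_upper[OF r(1), of x] pos by (meson mult_left_mono less_imp_le order_trans)
        then have "K1 * (measure \<mu> (E \<inter> ?B) / r powr Q) \<le> K1 * (\<alpha> * C)"
          using K12 r by (intro mult_left_mono) (auto simp: field_simps)
        also have "\<dots> = e / 4" using K12 const by (simp add: \<alpha>_def)
        finally show ?thesis .
      qed
      ultimately have N: "e / 4 \<le> K2 * N" by linarith
      have "c * measure \<nu> ?B \<le> c * (C * (2 * L) powr Q)"
        using \<nu>_upper[OF r(1), of x] pos by (intro mult_left_mono) (auto simp: L_def)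
      also have "\<dots> = e / 4 / K2 * L powr Q"
        using const K12 by (simp add: c_def powr_mult)
      also have "\<dots> \<le> N * L powr Q"
        using N K12 by (intro mult_right_mono) (auto simp: field_simps)
      also have "\<dots> = measure \<nu> (?B - E)" using L by (simp add: N_def)
      finally show "c * measure \<nu> ?B \<le> measure \<nu> (?B - E)" .
    qed
  qed
  then show ?thesis using pos by blast
qed

section \<open>Self-improvement to a power bound\<close>

lemma finite_vitali_covering:
  fixes r :: "'a::metric_space \<Rightarrow> real"
  assumes "finite K" "\<And>x. x \<in> K \<Longrightarrow> r x > 0"
  shows "\<exists>C\<subseteq>K. disjoint_family_on (\<lambda>x. ball x (r x)) C \<and>
    (\<Union>x\<in>K. ball x (r x)) \<subseteq> (\<Union>x\<in>C. ball x (3 * r x))"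
  using assms
proof (induction K rule: finite_psubset_induct)
  case (psubset K)
  show ?case
  proof (cases "K = {}")
    case True
    then show ?thesis by (auto simp: disjoint_family_on_def)
  next
    case False
    then have "Max (r ` K) \<in> r ` K" using psubset.hyps by (intro Max_in) auto
    then obtain x0 where "x0 \<in> K" "r x0 = Max (r ` K)" by force
    then have x0: "x0 \<in> K" "\<And>x. x \<in> K \<Longrightarrow> r x \<le> r x0" using psubset.hyps by auto
    define K' where "K' = {x \<in> K. ball x (r x) \<inter> ball x0 (r x0) = {}}"
    have "x0 \<notin> K'" using psubset.prems[OF x0(1)] by (auto simp: K'_def)
    moreover have "K' \<subseteq> K" by (auto simp: K'_def)
    ultimately have "K' \<subset> K" using x0(1) by blast
    then obtain C where C: "C \<subseteq> K'" "disjoint_family_on (\<lambda>x. ball x (r x)) C"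
      "(\<Union>x\<in>K'. ball x (r x)) \<subseteq> (\<Union>x\<in>C. ball x (3 * r x))"
      using psubset.IH[of K'] psubset.prems by (metis psubsetD)
    have "ball x (r x) \<subseteq> ball x0 (3 * r x0)" if xK: "x \<in> K" "x \<notin> K'" for x
    proof
      fix z assume z: "z \<in> ball x (r x)"
      obtain y where "dist x y < r x" "dist x0 y < r x0" using xK by (auto simp: K'_def)
      then have "dist x0 z < r x0 + r x + r x"
        using z dist_triangle[of x0 z y] dist_triangle3[of y z x] by auto
      then show "z \<in> ball x0 (3 * r x0)" using x0(2)[OF xK(1)] by auto
    qed
    then have "(\<Union>x\<in>K. ball x (r x)) \<subseteq> (\<Union>x\<in>insert x0 C. ball x (3 * r x))"
      using C(3) by blast
    moreover have "disjoint_family_on (\<lambda>x. ball x (r x)) (insert x0 C)"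
      using C(1,2) by (auto simp: disjoint_family_on_def K'_def)
    moreover have "insert x0 C \<subseteq> K" using C(1) x0(1) by (auto simp: K'_def)
    ultimately show ?thesis by blast
  qed
qed

definition doubling_on :: "real \<Rightarrow> real \<Rightarrow> 'a::metric_space measure \<Rightarrow> bool" where
  "doubling_on D R m \<longleftrightarrow> finite_on_balls m \<and> (\<forall>x r. 0 < r \<longrightarrow> 0 < measure m (ball x r)) \<and>
     (\<forall>x r. 0 < r \<and> r \<le> R \<longrightarrow> measure m (ball x (2 * r)) \<le> D * measure m (ball x r))"

lemma doubling_onD:
  assumes "doubling_on D R m"
  shows "finite_on_balls m" "0 < r \<Longrightarrow> 0 < measure m (ball x r)"
    "0 < r \<Longrightarrow> r \<le> R \<Longrightarrow> measure m (ball x (2 * r)) \<le> D * measure m (ball x r)"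
  using assms by (auto simp: doubling_on_def)

lemma doubling_on_4:
  assumes "doubling_on D R m" "D \<ge> 0" "0 < r" "2 * r \<le> R"
  shows "measure m (ball x (4 * r)) \<le> D\<^sup>2 * measure m (ball x r)"
proof -
  have "measure m (ball x (2 * (2 * r))) \<le> D * measure m (ball x (2 * r))"
    using assms by (intro doubling_onD(3)[OF assms(1)]) auto
  also have "\<dots> \<le> D * (D * measure m (ball x r))"
    using assms by (intro mult_left_mono doubling_onD(3)[OF assms(1)]) auto
  finally show ?thesis by (simp add: power2_eq_square mult.assoc)
qed

text \<open>Finite unions of closed balls are the sets on which the iteration runs. They are compact, and each of
their points sees them with a definite density at the scale of the ball that contains it; for general
compact sets this would need a density theorem.\<close>

definition cballs :: "('a::metric_space \<times> real) set \<Rightarrow> 'a set" where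
  "cballs P = (\<Union>(z, t)\<in>P. cball z t)"

text \<open>At the scale \<open>2 t\<close> the set fills a definite part of the ball around \<open>x\<close>, because it contains the ball around
\<open>z\<close>; at scales from \<open>\<rho>\<close> on it is too small to do so. A radius beyond half the supremum of the good
radii has the required property.\<close>

lemma stopping_radius:
  assumes dbl: "doubling_on D (2 * R) m" and D: "D \<ge> 1"
    and E: "E \<in> sets borel" "bounded E" and zt: "cball z t \<subseteq> E" "x \<in> cball z t" "0 < t" "t \<le> R"
    and \<gamma>: "0 < \<gamma>" "\<gamma> * D\<^sup>2 \<le> 1" and small: "measure m E < \<gamma> * measure m (ball x \<rho>)"
  shows "\<exists>s. 0 < s \<and> s < \<rho> \<and> \<gamma> * measure m (ball x s) \<le> measure m (E \<inter> ball x s) \<and>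
    (\<forall>t\<ge>2 * s. measure m (E \<inter> ball x t) < \<gamma> * measure m (ball x t))"
proof -
  note fin = doubling_onD(1)[OF dbl]
  define S where "S = {s. 0 < s \<and> \<gamma> * measure m (ball x s) \<le> measure m (E \<inter> ball x s)}"
  have S\<rho>: "s < \<rho>" if "s \<in> S" for s
  proof (rule ccontr)
    assume "\<not> s < \<rho>"
    then have "\<gamma> * measure m (ball x \<rho>) \<le> \<gamma> * measure m (ball x s)"
      using \<gamma>(1) by (intro mult_left_mono measure_mono_balls[OF fin] subset_ball) auto
    also have "\<dots> \<le> measure m (E \<inter> ball x s)" using that by (simp add: S_def)
    also have "\<dots> \<le> measure m E" using E by (intro measure_mono_balls[OF fin]) auto
    finally show False using small by simp
  qed
  have "2 * t \<in> S"
  proof -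
    have xz: "dist z x \<le> t" using zt by simp
    have "ball x (2 * t) \<subseteq> ball z (4 * t)"
    proof
      fix y assume "y \<in> ball x (2 * t)"
      then show "y \<in> ball z (4 * t)" using xz zt(3) dist_triangle[of z y x] by auto
    qed
    then have "measure m (ball x (2 * t)) \<le> measure m (ball z (4 * t))"
      by (intro measure_mono_balls[OF fin]) auto
    also have "\<dots> \<le> D\<^sup>2 * measure m (ball z t)"
      using D zt by (intro doubling_on_4[OF dbl]) auto
    finally have "\<gamma> * measure m (ball x (2 * t)) \<le> (\<gamma> * D\<^sup>2) * measure m (ball z t)"
      using \<gamma>(1) by (simp add: mult.assoc)
    also have "\<dots> \<le> 1 * measure m (ball z t)" using \<gamma> by (intro mult_right_mono) auto
    also have "\<dots> \<le> measure m (E \<inter> ball x (2 * t))"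
    proof -
      have "ball z t \<subseteq> E \<inter> ball x (2 * t)"
      proof
        fix y assume "y \<in> ball z t"
        then show "y \<in> E \<inter> ball x (2 * t)"
          using xz zt(1) dist_triangle3[of x y z] by auto
      qed
      then show ?thesis using E by (simp add: measure_mono_balls[OF fin] bounded_Int)
    qed
    finally show ?thesis using zt(3) by (simp add: S_def)
  qed
  have bdd: "bdd_above S" using S\<rho> by (intro bdd_aboveI2[of S "\<lambda>s. s" \<rho>, simplified] less_imp_le)
  have "0 < Sup S" using \<open>2 * t \<in> S\<close> zt(3) cSup_upper[OF _ bdd, of "2 * t"] by linarith
  then have "Sup S / 2 < Sup S" by simp
  then obtain s where s: "s \<in> S" "Sup S / 2 < s"
    using less_cSup_iff[OF _ bdd] \<open>2 * t \<in> S\<close> by blast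
  have "measure m (E \<inter> ball x t) < \<gamma> * measure m (ball x t)" if "t \<ge> 2 * s" for t
  proof -
    have "t \<notin> S" using that s(2) cSup_upper[OF _ bdd, of t] by fastforce
    moreover have "0 < t" using that s(1) by (auto simp: S_def)
    ultimately show ?thesis by (simp add: S_def)
  qed
  then show ?thesis using s(1) S\<rho>[OF s(1)] unfolding S_def by blast
qed

text \<open>Add to \<open>E = cballs P\<close> the stopping balls of a Vitali subfamily. On these balls \<open>E\<close> has \<open>m\<^sub>1\<close>-density at
least \<open>\<gamma>\<close>, so adding them costs at most the factor \<open>1 + D / \<gamma>\<close> in \<open>m\<^sub>1\<close>. At the doubled radius the density
is below \<open>\<gamma>\<close>, so the A-infinity condition applies and each ball contributes outside \<open>E\<close> a definite part
of the \<open>m\<^sub>2\<close>-measure of the enlarged balls, which together cover \<open>E\<close>.\<close>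

lemma A_inf_step:
  fixes P :: "('a::metric_space \<times> real) set"
  assumes proper: "proper_space TYPE('a)"
    and dbl: "doubling_on D (2 * R) m\<^sub>1" "doubling_on D (2 * R) m\<^sub>2" and D: "D \<ge> 1"
    and A: "A_inf \<alpha> c R m\<^sub>1 m\<^sub>2" and c: "0 < c"
    and \<gamma>: "0 < \<gamma>" "\<gamma> * D\<^sup>2 \<le> 1" "\<gamma> * D \<le> \<alpha>"
    and P: "finite P" "\<And>z t. (z, t) \<in> P \<Longrightarrow> 0 < t \<and> t \<le> R"
    and \<rho>: "\<rho> \<le> R" and small: "\<And>x. x \<in> cballs P \<Longrightarrow> measure m\<^sub>1 (cballs P) < \<gamma> * measure m\<^sub>1 (ball x \<rho>)"
  shows "\<exists>P'. finite P' \<and> (\<forall>z t. (z, t) \<in> P' \<longrightarrow> 0 < t \<and> t \<le> R) \<and>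
    cballs P' \<subseteq> (\<Union>x\<in>cballs P. cball x \<rho>) \<union> cballs P \<and>
    measure m\<^sub>1 (cballs P') \<le> (1 + D / \<gamma>) * measure m\<^sub>1 (cballs P) \<and>
    (1 + c / D\<^sup>2) * measure m\<^sub>2 (cballs P) \<le> measure m\<^sub>2 (cballs P')"
proof -
  define E where "E = cballs P"
  note fin1 = doubling_onD(1)[OF dbl(1)] and fin2 = doubling_onD(1)[OF dbl(2)]
  have comp: "compact (cball (x::'a) t)" for x t using proper by (simp add: proper_space_def)
  have compE: "compact E" unfolding E_def cballs_def using P(1) comp by (intro compact_UN) auto
  then have E: "E \<in> sets borel" "bounded E" "closed E"
    by (auto intro: compact_imp_bounded compact_imp_closed borel_compact)
  have "\<exists>s. 0 < s \<and> s < \<rho> \<and> \<gamma> * measure m\<^sub>1 (ball x s) \<le> measure m\<^sub>1 (E \<inter> ball x s) \<and>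
    (\<forall>t\<ge>2 * s. measure m\<^sub>1 (E \<inter> ball x t) < \<gamma> * measure m\<^sub>1 (ball x t))" if x: "x \<in> E" for x
  proof -
    obtain z t where zt: "(z, t) \<in> P" "x \<in> cball z t" using x by (auto simp: E_def cballs_def)
    have "cball z t \<subseteq> E" using zt(1) by (auto simp: E_def cballs_def)
    then show ?thesis
      using zt P(2)[OF zt(1)] small x
      by (intro stopping_radius[OF dbl(1) D E(1,2) _ zt(2) _ _ \<gamma>(1,2)]) (auto simp: E_def)
  qed
  then obtain \<sigma> where \<sigma>: "\<And>x. x \<in> E \<Longrightarrow> 0 < \<sigma> x" "\<And>x. x \<in> E \<Longrightarrow> \<sigma> x < \<rho>"
    "\<And>x. x \<in> E \<Longrightarrow> \<gamma> * measure m\<^sub>1 (ball x (\<sigma> x)) \<le> measure m\<^sub>1 (E \<inter> ball x (\<sigma> x))"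
    "\<And>x t. x \<in> E \<Longrightarrow> t \<ge> 2 * \<sigma> x \<Longrightarrow> measure m\<^sub>1 (E \<inter> ball x t) < \<gamma> * measure m\<^sub>1 (ball x t)"
    by metis
  have "E \<subseteq> (\<Union>x\<in>E. ball x (\<sigma> x))" using \<sigma>(1) by force
  then obtain K where K: "K \<subseteq> E" "finite K" "E \<subseteq> (\<Union>x\<in>K. ball x (\<sigma> x))"
    using compactE_image[OF compE, of E "\<lambda>x. ball x (\<sigma> x)"] by auto
  obtain V where V: "V \<subseteq> K" "disjoint_family_on (\<lambda>x. ball x (\<sigma> x)) V"
      "(\<Union>x\<in>K. ball x (\<sigma> x)) \<subseteq> (\<Union>x\<in>V. ball x (3 * \<sigma> x))"
    using finite_vitali_covering[of K \<sigma>] K \<sigma>(1) by (metis subsetD)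
  have VE: "x \<in> E" if "x \<in> V" for x using that V K by blast
  have finV: "finite V" using V(1) K(2) finite_subset by blast
  define P' where "P' = P \<union> (\<lambda>x. (x, \<sigma> x)) ` V"
  define E' where "E' = cballs P'"
  have E'_eq: "E' = E \<union> (\<Union>x\<in>V. cball x (\<sigma> x))"
    by (auto simp: E'_def E_def P'_def cballs_def)
  have E': "E' \<in> sets borel" "bounded E'"
    unfolding E'_eq using E finV by (auto intro!: sets.Un sets.finite_UN)
  have \<sigma>R: "0 < \<sigma> x" "\<sigma> x \<le> R" if "x \<in> V" for x
    using \<sigma>(1,2)[OF VE[OF that]] \<rho> by auto
  have meas1: "measure m\<^sub>1 E' \<le> (1 + D / \<gamma>) * measure m\<^sub>1 E"
  proof -
    have "measure m\<^sub>1 E' \<le> measure m\<^sub>1 E + measure m\<^sub>1 (\<Union>x\<in>V. cball x (\<sigma> x))"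
      unfolding E'_eq using E finV fin1 by (intro measure_Un_le) (auto simp: finite_on_balls_def)
    also have "measure m\<^sub>1 (\<Union>x\<in>V. cball x (\<sigma> x)) \<le> (\<Sum>x\<in>V. measure m\<^sub>1 (cball x (\<sigma> x)))"
      using finV fin1 by (intro measure_UNION_le) (auto simp: finite_on_balls_def)
    also have "\<dots> \<le> (\<Sum>x\<in>V. D / \<gamma> * measure m\<^sub>1 (E \<inter> ball x (\<sigma> x)))"
    proof (rule sum_mono)
      fix x assume x: "x \<in> V"
      have "cball x (\<sigma> x) \<subseteq> ball x (2 * \<sigma> x)" using \<sigma>R(1)[OF x] by auto
      then have "measure m\<^sub>1 (cball x (\<sigma> x)) \<le> measure m\<^sub>1 (ball x (2 * \<sigma> x))"
        by (intro measure_mono_balls[OF fin1]) auto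
      also have "\<dots> \<le> D * measure m\<^sub>1 (ball x (\<sigma> x))"
        using \<sigma>R[OF x] by (intro doubling_onD(3)[OF dbl(1)]) auto
      also have "\<dots> \<le> D / \<gamma> * measure m\<^sub>1 (E \<inter> ball x (\<sigma> x))"
        using \<sigma>(3)[OF VE[OF x]] D \<gamma>(1) by (simp add: field_simps mult_left_mono)
      finally show "measure m\<^sub>1 (cball x (\<sigma> x)) \<le> D / \<gamma> * measure m\<^sub>1 (E \<inter> ball x (\<sigma> x))" .
    qed
    also have "\<dots> = D / \<gamma> * (\<Sum>x\<in>V. measure m\<^sub>1 (E \<inter> ball x (\<sigma> x)))"
      by (simp add: sum_distrib_left)
    also have "(\<Sum>x\<in>V. measure m\<^sub>1 (E \<inter> ball x (\<sigma> x))) \<le> measure m\<^sub>1 E"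
      using E V(2) by (intro sum_measure_disjoint_le[OF fin1 finV]) (auto simp: disjoint_family_on_def)
    finally show ?thesis using D \<gamma>(1) by (simp add: algebra_simps mult_left_mono divide_right_mono)
  qed
  have meas2: "(1 + c / D\<^sup>2) * measure m\<^sub>2 E \<le> measure m\<^sub>2 E'"
  proof -
    have "measure m\<^sub>2 E \<le> (\<Sum>x\<in>V. measure m\<^sub>2 (ball x (3 * \<sigma> x)))"
      using E K(3) V(3) by (intro measure_finite_union_le[OF fin2 finV]) auto
    also have "\<dots> \<le> (\<Sum>x\<in>V. D\<^sup>2 / c * measure m\<^sub>2 (ball x (\<sigma> x) - E))"
    proof (rule sum_mono)
      fix x assume x: "x \<in> V"
      have "measure m\<^sub>2 (ball x (3 * \<sigma> x)) \<le> measure m\<^sub>2 (ball x (4 * \<sigma> x))"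
        using \<sigma>R(1)[OF x] by (intro measure_mono_balls[OF fin2] subset_ball) auto
      also have "\<dots> \<le> D\<^sup>2 * measure m\<^sub>2 (ball x (\<sigma> x))"
        using \<sigma>R[OF x] D by (intro doubling_on_4[OF dbl(2)]) auto
      also have "\<dots> \<le> D\<^sup>2 * (measure m\<^sub>2 (ball x (\<sigma> x) - E) / c)"
      proof (rule mult_left_mono)
        have "measure m\<^sub>1 (E \<inter> ball x (\<sigma> x)) \<le> measure m\<^sub>1 (E \<inter> ball x (2 * \<sigma> x))"
          using \<sigma>R(1)[OF x] E by (intro measure_mono_balls[OF fin1]) auto
        also have "\<dots> \<le> \<gamma> * measure m\<^sub>1 (ball x (2 * \<sigma> x))"
          using \<sigma>(4)[OF VE[OF x], of "2 * \<sigma> x"] by simp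
        also have "\<dots> \<le> \<gamma> * (D * measure m\<^sub>1 (ball x (\<sigma> x)))"
          using \<sigma>R[OF x] \<gamma>(1) by (intro mult_left_mono doubling_onD(3)[OF dbl(1)]) auto
        also have "\<dots> \<le> \<alpha> * measure m\<^sub>1 (ball x (\<sigma> x))"
          using \<gamma>(3) by (simp add: mult.assoc[symmetric] mult_right_mono)
        finally have "c * measure m\<^sub>2 (ball x (\<sigma> x)) \<le> measure m\<^sub>2 (ball x (\<sigma> x) - E)"
          using A \<sigma>R[OF x] E(3) unfolding A_inf_def by blast
        then show "measure m\<^sub>2 (ball x (\<sigma> x)) \<le> measure m\<^sub>2 (ball x (\<sigma> x) - E) / c"
          using c by (simp add: field_simps)
      qed simp
      finally show "measure m\<^sub>2 (ball x (3 * \<sigma> x)) \<le> D\<^sup>2 / c * measure m\<^sub>2 (ball x (\<sigma> x) - E)" by simp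
    qed
    also have "\<dots> = D\<^sup>2 / c * (\<Sum>x\<in>V. measure m\<^sub>2 (ball x (\<sigma> x) - E))"
      by (simp add: sum_distrib_left)
    also have "(\<Sum>x\<in>V. measure m\<^sub>2 (ball x (\<sigma> x) - E)) \<le> measure m\<^sub>2 (E' - E)"
      using E E' V(2) by (intro sum_measure_disjoint_le[OF fin2 finV])
        (auto simp: disjoint_family_on_def E'_eq intro: bounded_subset[OF E'(2)[unfolded E'_eq]])
    also have "measure m\<^sub>2 (E' - E) = measure m\<^sub>2 E' - measure m\<^sub>2 E"
      using finite_on_balls_fmeasurable[OF fin2] E E' by (intro measurable_measure_Diff)
        (auto simp: E'_eq fin2[unfolded finite_on_balls_def])
    finally have "measure m\<^sub>2 E \<le> D\<^sup>2 / c * (measure m\<^sub>2 E' - measure m\<^sub>2 E)"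
      using c by (simp add: divide_right_mono mult_left_mono)
    then show ?thesis using c D by (simp add: field_simps)
  qed
  have "finite P'" using P(1) finV by (simp add: P'_def)
  moreover have "\<forall>z t. (z, t) \<in> P' \<longrightarrow> 0 < t \<and> t \<le> R" using P(2) \<sigma>R by (auto simp: P'_def)
  moreover have "cballs P' \<subseteq> (\<Union>x\<in>cballs P. cball x \<rho>) \<union> cballs P"
  proof
    fix y assume "y \<in> cballs P'"
    then consider "y \<in> E" | x where "x \<in> V" "dist x y \<le> \<sigma> x" unfolding E'_def[symmetric] E'_eq by auto
    then show "y \<in> (\<Union>x\<in>cballs P. cball x \<rho>) \<union> cballs P"
    proof cases
      case (2 x)
      then have "x \<in> cballs P" "dist x y \<le> \<rho>" using VE[of x] \<sigma>(2)[of x] by (auto simp: E_def)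
      then show ?thesis by auto
    qed (simp add: E_def)
  qed
  ultimately show ?thesis using meas1 meas2 unfolding E_def E'_def by blast
qed

lemma compact_measure_ball_lower:
  fixes m :: "'a::metric_space measure"
  assumes fin: "finite_on_balls m" and pos: "\<And>x r. r > 0 \<Longrightarrow> measure m (ball x r) > 0"
    and K: "compact K" and r: "r > 0"
  shows "\<exists>a>0. \<forall>x\<in>K. a \<le> measure m (ball x r)"
proof -
  obtain k where k: "finite k" "K \<subseteq> (\<Union>x\<in>k. ball x (r / 2))"
    using K r unfolding compact_eq_totally_bounded by (metis half_gt_zero)
  define a where "a = Min (insert 1 ((\<lambda>z. measure m (ball z (r / 2))) ` k))"
  have "a > 0" unfolding a_def using k(1) pos r by (subst Min_gr_iff) auto
  moreover have "a \<le> measure m (ball x r)" if x: "x \<in> K" for x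
  proof -
    obtain z where z: "z \<in> k" "dist z x < r / 2" using k(2) x by auto
    have "ball z (r / 2) \<subseteq> ball x r"
    proof
      fix y assume "y \<in> ball z (r / 2)"
      then show "y \<in> ball x r" using z dist_triangle3[of x y z] by auto
    qed
    then have "measure m (ball z (r / 2)) \<le> measure m (ball x r)"
      by (intro measure_mono_balls[OF fin]) auto
    moreover have "a \<le> measure m (ball z (r / 2))"
      unfolding a_def using k(1) z(1) by (intro Min_le) auto
    ultimately show ?thesis by linarith
  qed
  ultimately show ?thesis by blast
qed

lemma doubling_on_iter:
  assumes dbl: "doubling_on D R m" and D: "D > 0" and r: "0 < r" "r \<le> 2 * R"
  shows "measure m (ball x r) \<le> D ^ k * measure m (ball x (r / 2 ^ k))"
proof (induction k)
  case (Suc k)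
  have "r / 2 ^ Suc k \<le> R"
  proof -
    have "r / 2 ^ Suc k \<le> r / 2 ^ 1" using r by (intro divide_left_mono power_increasing) auto
    then show ?thesis using r by simp
  qed
  then have "measure m (ball x (2 * (r / 2 ^ Suc k))) \<le> D * measure m (ball x (r / 2 ^ Suc k))"
    using r by (intro doubling_onD(3)[OF dbl]) auto
  then have "measure m (ball x (r / 2 ^ k)) \<le> D * measure m (ball x (r / 2 ^ Suc k))" by simp
  then have "D ^ k * measure m (ball x (r / 2 ^ k)) \<le> D ^ k * (D * measure m (ball x (r / 2 ^ Suc k)))"
    using D by (intro mult_left_mono) auto
  then show ?case using Suc.IH by (simp add: algebra_simps)
qed simp

lemma cballs_measure:
  fixes P :: "('a::metric_space \<times> real) set"
  assumes "finite P"
  shows "cballs P \<in> sets borel" "bounded (cballs P)"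
proof -
  have "closed (cballs P)" unfolding cballs_def using assms by (intro closed_UN) auto
  then show "cballs P \<in> sets borel" by (rule borel_closed)
  show "bounded (cballs P)" unfolding cballs_def using assms by (intro bounded_UN) auto
qed

text \<open>The number \<open>k\<close> counts the steps that are still available. Since \<open>D \<le> 1 + D / \<gamma>\<close>, a set with the stated
measure bound has stopping radii below \<open>R / 2\<^sup>k\<close>. Hence the enlargements of all steps together stay
within distance \<open>R\<close>.\<close>

lemma A_inf_iterate:
  fixes P :: "('a::metric_space \<times> real) set"
  assumes proper: "proper_space TYPE('a)" and R: "R > 0"
    and dbl: "doubling_on D (2 * R) m\<^sub>1" "doubling_on D (2 * R) m\<^sub>2" and D: "D \<ge> 1"
    and A: "A_inf \<alpha> c R m\<^sub>1 m\<^sub>2" and c: "0 < c"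
    and \<gamma>: "0 < \<gamma>" "\<gamma> * D\<^sup>2 \<le> 1" "\<gamma> * D \<le> \<alpha>"
    and a: "a > 0" "\<And>x. x \<in> cball o' (R' + R) \<Longrightarrow> a \<le> measure m\<^sub>1 (ball x R)"
    and P: "finite P" "\<And>z t. (z, t) \<in> P \<Longrightarrow> 0 < t \<and> t \<le> R"
    and sub: "cballs P \<subseteq> cball o' (R' + R / 2 ^ k)"
    and small: "measure m\<^sub>1 (cballs P) \<le> \<gamma> * a / 2 / (1 + D / \<gamma>) ^ k"
  shows "(1 + c / D\<^sup>2) ^ k * measure m\<^sub>2 (cballs P) \<le> measure m\<^sub>2 (cball o' (R' + R))"
  using P sub small
proof (induction k arbitrary: P)
  case 0
  then show ?case
    using cballs_measure[of P] by (auto intro!: measure_mono_balls[OF doubling_onD(1)[OF dbl(2)]])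
next
  case (Suc k)
  let ?\<Gamma> = "1 + D / \<gamma>" and ?\<rho> = "R / 2 ^ Suc k"
  have \<gamma>1: "\<gamma> \<le> 1"
  proof -
    have "\<gamma> * 1 \<le> \<gamma> * D\<^sup>2" using D \<gamma>(1) by (intro mult_left_mono) (auto simp: one_le_power)
    then show ?thesis using \<gamma>(2) by simp
  qed
  have "D * \<gamma> \<le> D * 1" using D \<gamma>1 by (intro mult_left_mono) auto
  then have "D \<le> D / \<gamma>" using \<gamma>(1) by (simp add: le_divide_eq)
  then have \<Gamma>D: "D \<le> ?\<Gamma>" by linarith
  have \<rho>: "?\<rho> \<le> R" "0 < ?\<rho>"
  proof -
    have "R / 2 ^ Suc k \<le> R / 1" using R by (intro divide_left_mono one_le_power) auto
    then show "?\<rho> \<le> R" "0 < ?\<rho>" using R by auto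
  qed
  have below: "measure m\<^sub>1 (cballs P) < \<gamma> * measure m\<^sub>1 (ball x ?\<rho>)" if x: "x \<in> cballs P" for x
  proof -
    have "x \<in> cball o' (R' + R)" using x Suc.prems(3) \<rho> by auto
    then have "a \<le> measure m\<^sub>1 (ball x R)" by (rule a(2))
    also have "\<dots> \<le> D ^ Suc k * measure m\<^sub>1 (ball x ?\<rho>)"
      using R D by (intro doubling_on_iter[OF dbl(1)]) auto
    also have "\<dots> \<le> ?\<Gamma> ^ Suc k * measure m\<^sub>1 (ball x ?\<rho>)"
      using \<Gamma>D D by (intro mult_right_mono power_mono) auto
    finally have le: "a / ?\<Gamma> ^ Suc k \<le> measure m\<^sub>1 (ball x ?\<rho>)"
      using \<Gamma>D D by (subst pos_divide_le_eq) (auto simp: mult.commute)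
    have "0 < a / ?\<Gamma> ^ Suc k" using a(1) \<Gamma>D D by simp
    then have "\<gamma> / 2 * (a / ?\<Gamma> ^ Suc k) < \<gamma> * (a / ?\<Gamma> ^ Suc k)"
      using \<gamma>(1) by (intro mult_strict_right_mono) auto
    also have "\<dots> \<le> \<gamma> * measure m\<^sub>1 (ball x ?\<rho>)" using le \<gamma>(1) by (intro mult_left_mono) auto
    finally show ?thesis using Suc.prems(4) by simp
  qed
  have "\<exists>P'. finite P' \<and> (\<forall>z t. (z, t) \<in> P' \<longrightarrow> 0 < t \<and> t \<le> R) \<and>
    cballs P' \<subseteq> (\<Union>x\<in>cballs P. cball x ?\<rho>) \<union> cballs P \<and>
    measure m\<^sub>1 (cballs P') \<le> ?\<Gamma> * measure m\<^sub>1 (cballs P) \<and>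
    (1 + c / D\<^sup>2) * measure m\<^sub>2 (cballs P) \<le> measure m\<^sub>2 (cballs P')"
  proof (rule A_inf_step[OF proper dbl D A c \<gamma> Suc.prems(1) _ \<rho>(1)])
    show "0 < t \<and> t \<le> R" if "(z, t) \<in> P" for z t using that by (rule Suc.prems(2))
    show "measure m\<^sub>1 (cballs P) < \<gamma> * measure m\<^sub>1 (ball x ?\<rho>)" if "x \<in> cballs P" for x
      using that by (rule below)
  qed
  then obtain P' where P'1: "finite P'" "\<forall>z t. (z, t) \<in> P' \<longrightarrow> 0 < t \<and> t \<le> R"
    and P'3: "cballs P' \<subseteq> (\<Union>x\<in>cballs P. cball x ?\<rho>) \<union> cballs P"
    and P'4: "measure m\<^sub>1 (cballs P') \<le> ?\<Gamma> * measure m\<^sub>1 (cballs P)"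
    and P'5: "(1 + c / D\<^sup>2) * measure m\<^sub>2 (cballs P) \<le> measure m\<^sub>2 (cballs P')"
    by (elim exE conjE)
  have "cballs P' \<subseteq> cball o' (R' + R / 2 ^ k)"
  proof
    fix y assume "y \<in> cballs P'"
    then obtain x where x: "x \<in> cballs P" "dist x y \<le> ?\<rho>"
      using P'3 \<rho>(2) by (force intro: less_imp_le)
    have "dist o' x \<le> R' + ?\<rho>" using x(1) Suc.prems(3) by auto
    then have "dist o' y \<le> R' + (?\<rho> + ?\<rho>)" using x(2) dist_triangle[of o' y x] by linarith
    then show "y \<in> cball o' (R' + R / 2 ^ k)" by simp
  qed
  moreover have "measure m\<^sub>1 (cballs P') \<le> \<gamma> * a / 2 / ?\<Gamma> ^ k"
  proof -
    have "?\<Gamma> * measure m\<^sub>1 (cballs P) \<le> ?\<Gamma> * (\<gamma> * a / 2 / ?\<Gamma> ^ Suc k)"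
      using Suc.prems(4) \<Gamma>D D by (intro mult_left_mono) auto
    also have "\<dots> = \<gamma> * a / 2 / ?\<Gamma> ^ k" using \<Gamma>D D by simp
    finally show ?thesis using P'4 by linarith
  qed
  ultimately have IH: "(1 + c / D\<^sup>2) ^ k * measure m\<^sub>2 (cballs P') \<le> measure m\<^sub>2 (cball o' (R' + R))"
    using P'1 by (intro Suc.IH) auto
  have "(1 + c / D\<^sup>2) ^ k * ((1 + c / D\<^sup>2) * measure m\<^sub>2 (cballs P))
      \<le> (1 + c / D\<^sup>2) ^ k * measure m\<^sub>2 (cballs P')"
    using P'5 c by (intro mult_left_mono) auto
  with IH show ?case by (simp add: mult.assoc mult.left_commute)
qed

lemma ex_power_interval:
  fixes b x :: real
  assumes "1 < b" "1 \<le> x"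
  shows "\<exists>k. b ^ k \<le> x \<and> x < b ^ Suc k"
proof -
  define n where "n = (LEAST n. x < b ^ n)"
  have "\<exists>n. x < b ^ n" using real_arch_pow[OF assms(1)] .
  then have n: "x < b ^ n" unfolding n_def by (rule LeastI_ex)
  then have "n \<noteq> 0" using assms(2) by (intro notI) simp
  then obtain k where k: "n = Suc k" using not0_implies_Suc by blast
  have "\<not> x < b ^ k" using not_less_Least[of k "\<lambda>n. x < b ^ n"] k by (simp add: n_def)
  then show ?thesis using n k by (intro exI[of _ k]) auto
qed

definition power_bound ::
  "real \<Rightarrow> real \<Rightarrow> 'a::metric_space set \<Rightarrow> 'a measure \<Rightarrow> 'a measure \<Rightarrow> bool" where
  "power_bound \<delta> R S m\<^sub>1 m\<^sub>2 \<longleftrightarrow> (\<exists>K\<ge>0. \<forall>P. finite P \<longrightarrow> (\<forall>z t. (z, t) \<in> P \<longrightarrow> 0 < t \<and> t \<le> R) \<longrightarrow>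
     cballs P \<subseteq> S \<longrightarrow> measure m\<^sub>2 (cballs P) \<le> K * measure m\<^sub>1 (cballs P) powr \<delta>)"

lemma power_bound_mono:
  assumes pb: "power_bound \<delta>' R S m\<^sub>1 m\<^sub>2" and \<delta>: "\<delta> \<le> \<delta>'"
    and fin: "finite_on_balls m\<^sub>1" and S: "S \<in> sets borel" "bounded S"
  shows "power_bound \<delta> R S m\<^sub>1 m\<^sub>2"
proof -
  obtain K where K: "K \<ge> 0" and le: "\<And>P. finite P \<Longrightarrow> (\<forall>z t. (z, t) \<in> P \<longrightarrow> 0 < t \<and> t \<le> R) \<Longrightarrow>
     cballs P \<subseteq> S \<Longrightarrow> measure m\<^sub>2 (cballs P) \<le> K * measure m\<^sub>1 (cballs P) powr \<delta>'"
    using pb unfolding power_bound_def by blast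
  have "measure m\<^sub>2 (cballs P) \<le> K * measure m\<^sub>1 S powr (\<delta>' - \<delta>) * measure m\<^sub>1 (cballs P) powr \<delta>"
    if P: "finite P" "\<forall>z t. (z, t) \<in> P \<longrightarrow> 0 < t \<and> t \<le> R" "cballs P \<subseteq> S" for P
  proof -
    let ?m = "measure m\<^sub>1 (cballs P)"
    have "?m \<le> measure m\<^sub>1 S" using P S cballs_measure[OF P(1)] by (intro measure_mono_balls[OF fin]) auto
    have "measure m\<^sub>2 (cballs P) \<le> K * ?m powr \<delta>'" by (rule le[OF P])
    also have "?m powr \<delta>' = ?m powr (\<delta>' - \<delta>) * ?m powr \<delta>" by (simp add: powr_add[symmetric])
    also have "K * (?m powr (\<delta>' - \<delta>) * ?m powr \<delta>) \<le> K * (measure m\<^sub>1 S powr (\<delta>' - \<delta>) * ?m powr \<delta>)"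
      using \<open>?m \<le> measure m\<^sub>1 S\<close> \<delta> K by (intro mult_left_mono mult_right_mono powr_mono2) auto
    finally show ?thesis by (simp add: mult.assoc)
  qed
  moreover have "0 \<le> K * measure m\<^sub>1 S powr (\<delta>' - \<delta>)" using K by simp
  ultimately show ?thesis unfolding power_bound_def by blast
qed

text \<open>Run \<open>k\<close> steps, where \<open>k\<close> is the largest number admitted by \<open>A_inf_iterate\<close>. Then \<open>\<Gamma>\<^sup>-\<^sup>k\<close> is comparable to
the \<open>m\<^sub>1\<close>-measure of the set, and \<open>\<beta>\<^sup>k\<close> times its \<open>m\<^sub>2\<close>-measure stays bounded. The exponent is fixed
before the measures, while the constant hidden in \<open>power_bound\<close> may depend on them and on the region.\<close>

lemma A_inf_power:
  assumes proper: "proper_space TYPE('a::metric_space)" and D: "D \<ge> 1" and \<alpha>: "0 < \<alpha>" and c: "0 < c"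
  shows "\<exists>\<delta>. 0 < \<delta> \<and> \<delta> < 1 \<and> (\<forall>R (m\<^sub>1 :: 'a measure) m\<^sub>2. R > 0 \<longrightarrow>
    doubling_on D (2 * R) m\<^sub>1 \<longrightarrow> doubling_on D (2 * R) m\<^sub>2 \<longrightarrow> A_inf \<alpha> c R m\<^sub>1 m\<^sub>2 \<longrightarrow>
    (\<forall>o' R'. power_bound \<delta> R (cball o' R') m\<^sub>1 m\<^sub>2))"
proof -
  \<comment> \<open>The minimum with 1 and the factor \<open>1 / 2\<close> in \<open>\<gamma>\<close> ensure \<open>\<beta> < \<Gamma>\<close>, that is \<open>\<delta> < 1\<close>.\<close>
  define c' where "c' = min c 1"
  define \<gamma> where "\<gamma> = min (\<alpha> / D) (1 / D\<^sup>2) / 2"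
  define \<Gamma> where "\<Gamma> = 1 + D / \<gamma>"
  define \<beta> where "\<beta> = 1 + c' / D\<^sup>2"
  define \<delta> where "\<delta> = log \<Gamma> \<beta>"
  have c': "0 < c'" "c' \<le> 1" "c' \<le> c" using c by (auto simp: c'_def)
  have D2: "D\<^sup>2 \<ge> 1" using D by (simp add: one_le_power)
  have \<gamma>: "0 < \<gamma>" "\<gamma> \<le> 1 / 2" "\<gamma> * D\<^sup>2 \<le> 1" "\<gamma> * D \<le> \<alpha>"
  proof -
    show "0 < \<gamma>" using D \<alpha> by (simp add: \<gamma>_def)
    have "1 / D\<^sup>2 \<le> 1" using D2 D by simp
    then have "min (\<alpha> / D) (1 / D\<^sup>2) \<le> 1" by (rule min.coboundedI2)
    then show "\<gamma> \<le> 1 / 2" by (simp add: \<gamma>_def)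
    have "2 * \<gamma> \<le> 1 / D\<^sup>2" "2 * \<gamma> \<le> \<alpha> / D" by (auto simp: \<gamma>_def)
    then have "\<gamma> \<le> 1 / D\<^sup>2" "\<gamma> \<le> \<alpha> / D" using \<open>0 < \<gamma>\<close> by linarith+
    then show "\<gamma> * D\<^sup>2 \<le> 1" "\<gamma> * D \<le> \<alpha>" using D D2 by (auto simp: pos_le_divide_eq)
  qed
  have "1 < D / \<gamma>" using \<gamma> D by (simp add: less_divide_eq)
  moreover have "c' / D\<^sup>2 \<le> 1" using c' D2 by (simp add: divide_le_eq)
  ultimately have \<beta>\<Gamma>: "1 < \<beta>" "\<beta> < \<Gamma>" "1 < \<Gamma>" 
    unfolding \<beta>_def \<Gamma>_def using c' D D2 by (simp, linarith, linarith)
  have \<delta>: "0 < \<delta>" "\<delta> < 1" using \<beta>\<Gamma> by (auto simp: \<delta>_def)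
  have \<Gamma>\<delta>: "(\<Gamma> ^ k) powr \<delta> = \<beta> ^ k" for k
  proof -
    have "(\<Gamma> ^ k) powr \<delta> = (\<Gamma> powr \<delta>) ^ k"
      using \<beta>\<Gamma> by (simp add: powr_powr powr_realpow[symmetric] mult.commute)
    also have "\<Gamma> powr \<delta> = \<beta>" using \<beta>\<Gamma> by (simp add: \<delta>_def)
    finally show ?thesis .
  qed
  have "power_bound \<delta> R (cball o' R') m\<^sub>1 m\<^sub>2"
    if R: "R > 0" and dbl: "doubling_on D (2 * R) m\<^sub>1" "doubling_on D (2 * R) m\<^sub>2"
      and A: "A_inf \<alpha> c R m\<^sub>1 m\<^sub>2" for R o' R' and m\<^sub>1 m\<^sub>2 :: "'a measure"
  proof -
    note fin1 = doubling_onD(1)[OF dbl(1)] and fin2 = doubling_onD(1)[OF dbl(2)]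
    have A': "A_inf \<alpha> c' R m\<^sub>1 m\<^sub>2"
      using A c'(3) unfolding A_inf_def by (meson measure_nonneg mult_right_mono order_trans)
    have "compact (cball o' (R' + R))" using proper by (simp add: proper_space_def)
    then obtain a where a: "a > 0" "\<And>x. x \<in> cball o' (R' + R) \<Longrightarrow> a \<le> measure m\<^sub>1 (ball x R)"
      using compact_measure_ball_lower[OF fin1 _ _ R] doubling_onD(2)[OF dbl(1)] by metis
    define \<omega> where "\<omega> = \<gamma> * a / 2"
    have \<omega>: "\<omega> > 0" using a \<gamma> by (simp add: \<omega>_def)
    define M where "M = measure m\<^sub>2 (cball o' (R' + R))"
    have "measure m\<^sub>2 (cballs P) \<le> M * (\<Gamma> / \<omega>) powr \<delta> * measure m\<^sub>1 (cballs P) powr \<delta>"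
      if P: "finite P" "\<And>z t. (z, t) \<in> P \<Longrightarrow> 0 < t \<and> t \<le> R" "cballs P \<subseteq> cball o' R'" for P
    proof (cases "P = {}")
      case True
      then show ?thesis by (simp add: cballs_def)
    next
      case False
      define m where "m = measure m\<^sub>1 (cballs P)"
      obtain z t where zt: "(z, t) \<in> P" using False by auto
      have "0 < measure m\<^sub>1 (ball z t)" using P(2)[OF zt] by (intro doubling_onD(2)[OF dbl(1)]) simp
      also have "measure m\<^sub>1 (ball z t) \<le> m"
      proof -
        have "cball z t \<subseteq> cballs P" using zt by (auto simp: cballs_def)
        then have "ball z t \<subseteq> cballs P" using ball_subset_cball by blast
        then show ?thesis
          unfolding m_def using cballs_measure[OF P(1)] by (intro measure_mono_balls[OF fin1]) auto
      qed
      finally have m: "0 < m" .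
      have eq: "(\<Gamma> / \<omega>) powr \<delta> * m powr \<delta> = (\<Gamma> * (m / \<omega>)) powr \<delta>"
        by (simp only: powr_mult[symmetric] times_divide_eq_left times_divide_eq_right)
      have sub: "cballs P \<subseteq> cball o' (R' + R / 2 ^ k)" for k
      proof -
        have "R' \<le> R' + R / 2 ^ k" using R by simp
        with P(3) show ?thesis by (meson order_trans subset_cball)
      qed
      have M0: "0 \<le> M" by (simp add: M_def)
      have "measure m\<^sub>2 (cballs P) \<le> M * (\<Gamma> * (m / \<omega>)) powr \<delta>"
      proof (cases "m \<le> \<omega>")
        case True
        then have "1 \<le> \<omega> / m" using m by simp
        then obtain k where k: "\<Gamma> ^ k \<le> \<omega> / m" "\<omega> / m < \<Gamma> ^ Suc k"
          using ex_power_interval[OF \<beta>\<Gamma>(3)] by blast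
        have "m \<le> \<omega> / \<Gamma> ^ k" using k(1) m \<beta>\<Gamma> by (simp add: field_simps)
        then have "\<beta> ^ k * measure m\<^sub>2 (cballs P) \<le> M"
          unfolding \<beta>_def M_def
          using sub by (intro A_inf_iterate[OF proper R dbl D A' c'(1) \<gamma>(1,3,4) a P(1,2)])
            (auto simp: \<omega>_def m_def \<Gamma>_def)
        moreover have "1 \<le> (\<Gamma> * (m / \<omega>)) powr \<delta> * \<beta> ^ k"
        proof -
          have "1 \<le> (\<Gamma> * (m / \<omega>)) * \<Gamma> ^ k"
            using k(2) m \<omega> by (simp add: field_simps)
          then have "1 \<le> ((\<Gamma> * (m / \<omega>)) * \<Gamma> ^ k) powr \<delta>"
            using \<delta> by (intro ge_one_powr_ge_zero) auto
          then show ?thesis by (simp only: powr_mult[of _ "\<Gamma> ^ k"] \<Gamma>\<delta>)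
        qed
        ultimately have "1 * measure m\<^sub>2 (cballs P) \<le> (\<Gamma> * (m / \<omega>)) powr \<delta> * \<beta> ^ k * measure m\<^sub>2 (cballs P)"
          "(\<Gamma> * (m / \<omega>)) powr \<delta> * (\<beta> ^ k * measure m\<^sub>2 (cballs P)) \<le> (\<Gamma> * (m / \<omega>)) powr \<delta> * M"
          by (intro mult_right_mono mult_left_mono; simp)+
        then show ?thesis by (simp add: mult.assoc mult.commute[of M])
      next
        case False
        have "measure m\<^sub>2 (cballs P) \<le> M"
          unfolding M_def using cballs_measure[OF P(1)] sub[of 0] by (intro measure_mono_balls[OF fin2]) auto
        moreover have "1 \<le> (\<Gamma> * (m / \<omega>)) powr \<delta>"
        proof (rule ge_one_powr_ge_zero)
          have "1 * 1 \<le> \<Gamma> * (m / \<omega>)" using False \<beta>\<Gamma> \<omega> by (intro mult_mono) auto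
          then show "1 \<le> \<Gamma> * (m / \<omega>)" by simp
        qed (use \<delta> in simp)
        then have "M * 1 \<le> M * (\<Gamma> * (m / \<omega>)) powr \<delta>" using M0 by (rule mult_left_mono)
        ultimately show ?thesis by simp
      qed
      then show ?thesis unfolding m_def[symmetric] by (simp only: mult.assoc eq)
    qed
    moreover have "0 \<le> M * (\<Gamma> / \<omega>) powr \<delta>" by (simp add: M_def)
    ultimately show ?thesis unfolding power_bound_def by blast
  qed
  then show ?thesis using \<delta> by blast
qed

section \<open>Counting points with a large distortion\<close>

text \<open>The points of \<open>I\<close> have \<open>s\<close>-separated images, and \<open>h\<close> moves some point within \<open>r\<close> of each of them by at
least \<open>s / 2\<close>. This discrete statement is all that the dimension estimate needs to know about \<open>h\<close>.\<close>

definition distorted_count :: "('a::metric_space \<Rightarrow> 'b::metric_space) \<Rightarrow> 'a set \<Rightarrow> real \<Rightarrow> real \<Rightarrow> bool" where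
  "distorted_count h E p Q \<longleftrightarrow> (\<exists>K s\<^sub>0 r\<^sub>0. K \<ge> 0 \<and> s\<^sub>0 > 0 \<and> r\<^sub>0 > 0 \<and>
     (\<forall>s r I. 0 < s \<and> s < s\<^sub>0 \<and> 0 < r \<and> r < r\<^sub>0 \<and> finite I \<and> I \<subseteq> E \<and>
        (\<forall>a\<in>I. \<forall>b\<in>I. a \<noteq> b \<longrightarrow> s \<le> dist (h a) (h b)) \<and>
        (\<forall>a\<in>I. \<exists>z. dist a z < r \<and> s / 2 \<le> dist (h a) (h z))
        \<longrightarrow> real (card I) \<le> K * s powr (- p) * r powr (p - Q)))"

text \<open>Solving \<open>n s\<^sup>Q \<le> K (n r\<^sup>Q)\<^sup>\<delta>\<close> for \<open>n\<close>; this is where \<open>p = Q / (1 - \<delta>)\<close> comes from.\<close>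

lemma count_from_power:
  fixes n :: nat
  assumes pos: "c\<^sub>1 > 0" "c\<^sub>2 > 0" "K \<ge> 0" "s > 0" "r > 0" and \<delta>: "0 < \<delta>" "\<delta> < 1"
    and le: "real n * (c\<^sub>1 * s powr Q) \<le> K * (real n * (c\<^sub>2 * r powr Q)) powr \<delta>"
  defines "p \<equiv> Q / (1 - \<delta>)"
  shows "real n \<le> (K * c\<^sub>2 powr \<delta> / c\<^sub>1) powr (1 / (1 - \<delta>)) * s powr (- p) * r powr (p - Q)"
proof (cases "n = 0")
  case False
  define B where "B = K * c\<^sub>2 powr \<delta> / c\<^sub>1"
  have n: "real n > 0" using False by simp
  have nn: "real n = real n powr (1 - \<delta>) * real n powr \<delta>" using n by (simp add: powr_add[symmetric])
  have e: "(- Q) * (1 / (1 - \<delta>)) = - p" "Q * \<delta> * (1 / (1 - \<delta>)) = p - Q"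
    using \<delta> by (auto simp: p_def field_simps)
  have "(real n powr (1 - \<delta>) * (c\<^sub>1 * s powr Q)) * real n powr \<delta> \<le> (K * (c\<^sub>2 powr \<delta> * r powr (Q * \<delta>))) * real n powr \<delta>"
    using le by (subst (asm) (1) nn) (simp add: powr_mult powr_powr mult_ac)
  then have "real n powr (1 - \<delta>) * (c\<^sub>1 * s powr Q) \<le> K * (c\<^sub>2 powr \<delta> * r powr (Q * \<delta>))"
    using n by (subst (asm) mult_le_cancel_right) auto
  then have "real n powr (1 - \<delta>) \<le> B * (s powr (- Q) * r powr (Q * \<delta>))"
    using pos by (simp add: B_def powr_minus field_simps)
  then have "(real n powr (1 - \<delta>)) powr (1 / (1 - \<delta>)) \<le> (B * (s powr (- Q) * r powr (Q * \<delta>))) powr (1 / (1 - \<delta>))"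
    using \<delta> by (intro powr_mono2) auto
  also have "(real n powr (1 - \<delta>)) powr (1 / (1 - \<delta>)) = real n" using \<delta> n by (simp add: powr_powr)
  also have "(B * (s powr (- Q) * r powr (Q * \<delta>))) powr (1 / (1 - \<delta>))
      = B powr (1 / (1 - \<delta>)) * (s powr (- p) * r powr (p - Q))"
    by (simp only: powr_mult powr_powr e)
  finally show ?thesis by (simp add: B_def mult.assoc)
qed simp

lemma count_disjoint_cballs:
  fixes z :: "'i \<Rightarrow> 'a::metric_space"
  assumes fin: "finite_on_balls m\<^sub>1" "finite_on_balls m\<^sub>2" and I: "finite I"
    and disj: "disjoint_family_on (\<lambda>i. cball (z i) (t i)) I"
    and lo: "\<And>i. i \<in> I \<Longrightarrow> b \<le> measure m\<^sub>2 (cball (z i) (t i))"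
    and up: "\<And>i. i \<in> I \<Longrightarrow> measure m\<^sub>1 (cball (z i) (t i)) \<le> a"
    and le: "measure m\<^sub>2 (cballs ((\<lambda>i. (z i, t i)) ` I)) \<le> K * measure m\<^sub>1 (cballs ((\<lambda>i. (z i, t i)) ` I)) powr \<delta>"
    and pos: "K \<ge> 0" "\<delta> \<ge> 0"
  shows "real (card I) * b \<le> K * (real (card I) * a) powr \<delta>"
proof -
  let ?S = "cballs ((\<lambda>i. (z i, t i)) ` I)"
  have S: "?S = (\<Union>i\<in>I. cball (z i) (t i))" by (auto simp: cballs_def)
  have Sm: "?S \<in> sets borel" "bounded ?S" using I by (auto intro!: cballs_measure)
  have "real (card I) * b \<le> (\<Sum>i\<in>I. measure m\<^sub>2 (cball (z i) (t i)))"
    using lo by (rule sum_bounded_below)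
  also have "\<dots> \<le> measure m\<^sub>2 ?S"
    by (rule sum_measure_disjoint_le[OF fin(2) I _ _ Sm disj]) (auto simp: S)
  also note le
  also have "K * measure m\<^sub>1 ?S powr \<delta> \<le> K * (real (card I) * a) powr \<delta>"
  proof (intro mult_left_mono powr_mono2 pos)
    have "measure m\<^sub>1 ?S \<le> (\<Sum>i\<in>I. measure m\<^sub>1 (cball (z i) (t i)))"
      by (rule measure_finite_union_le[OF fin(1) I _ _ _ Sm(1)]) (auto simp: S)
    also have "\<dots> \<le> real (card I) * a" using up by (rule sum_bounded_above)
    finally show "measure m\<^sub>1 ?S \<le> real (card I) * a" .
  qed simp
  finally show ?thesis .
qed

context qs_setting begin

text \<open>Halve \<open>r\<close> until the image of the ball fits into the ball of radius \<open>s / 2\<close>, which continuity guarantees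
to happen, but not at the start.\<close>

lemma ex_stopping_radius:
  assumes s: "s > 0" and r: "r > 0" and z: "dist a z < r" "s / 2 \<le> dist (f a) (f z)"
  shows "\<exists>\<rho>. 0 < \<rho> \<and> \<rho> < r \<and> (\<forall>b. dist a b \<le> \<rho> \<longrightarrow> dist (f a) (f b) < s / 2) \<and> s / 2 \<le> osc a (2 * \<rho>)"
proof -
  define P where "P k \<longleftrightarrow> (\<forall>b. dist a b \<le> r / 2 ^ k \<longrightarrow> dist (f a) (f b) < s / 2)" for k :: nat
  have "\<exists>d>0. \<forall>b. dist b a < d \<longrightarrow> dist (f b) (f a) < s / 2"
    using contf s unfolding continuous_on_iff by (metis UNIV_I half_gt_zero)
  then obtain d where d: "d > 0" "\<And>b. dist b a < d \<Longrightarrow> dist (f b) (f a) < s / 2" by blast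
  obtain k where k: "r / d < 2 ^ k" using real_arch_pow[of 2 "r / d"] by auto
  have "r / 2 ^ k < d" using k d(1) by (simp add: field_simps)
  then have "P k" unfolding P_def using d(2) by (metis dist_commute order_le_less_trans)
  define j where "j = (LEAST k. P k)"
  have Pj: "P j" unfolding j_def using \<open>P k\<close> by (rule LeastI)
  have "\<not> P 0" using z unfolding P_def by (auto simp: not_less intro!: exI[of _ z])
  then obtain i where i: "j = Suc i" using Pj not0_implies_Suc by metis
  have "\<not> P i" using not_less_Least[of i P] i by (simp add: j_def)
  then obtain b where b: "dist a b \<le> r / 2 ^ i" "s / 2 \<le> dist (f a) (f b)" by (auto simp: P_def not_less)
  have "dist a b \<le> 2 * (r / 2 ^ j)" using b(1) i by simp
  then have "s / 2 \<le> osc a (2 * (r / 2 ^ j))" using b(2) dist_le_osc by (meson order_trans)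
  moreover have "r / 2 ^ j < r"
  proof -
    have "(1::real) < 2 ^ j" unfolding i by (rule one_less_power) simp_all
    then have "r / 2 ^ j < r / 1" using r by (intro divide_strict_left_mono) auto
    then show ?thesis by simp
  qed
  ultimately show ?thesis using r Pj unfolding P_def by (intro exI[of _ "r / 2 ^ j"]) auto
qed

text \<open>Around each point take the ball of the stopping radius. The images lie in disjoint balls of radius
\<open>s / 2\<close>, while the oscillation on the ball of twice the radius, hence by doubling also on the ball
itself, is at least comparable to \<open>s\<close>.\<close>

lemma distorted_count_forward:
  assumes \<delta>: "0 < \<delta>" "\<delta> < 1"
    and pw: "power_bound \<delta> R\<^sub>0 (cball o' R') \<mu> \<nu>"
    and E: "E \<subseteq> cball o' (R' - R\<^sub>0)"
  shows "distorted_count f E (Q / (1 - \<delta>)) Q"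
proof -
  obtain K where K: "K \<ge> 0" and pwK: "\<And>P. finite P \<Longrightarrow> (\<forall>z t. (z, t) \<in> P \<longrightarrow> 0 < t \<and> t \<le> R\<^sub>0) \<Longrightarrow>
      cballs P \<subseteq> cball o' R' \<Longrightarrow> measure \<nu> (cballs P) \<le> K * measure \<mu> (cballs P) powr \<delta>"
    using pw unfolding power_bound_def by blast
  define c\<^sub>1 where "c\<^sub>1 = (1 / (4 * A * H)) powr Q / C"
  define c\<^sub>2 where "c\<^sub>2 = C * 2 powr Q"
  have c: "c\<^sub>1 > 0" "c\<^sub>2 > 0" "K \<ge> 0" using K C1 A2 H1 by (auto simp: c\<^sub>1_def c\<^sub>2_def )
  have "real (card I) \<le> (K * c\<^sub>2 powr \<delta> / c\<^sub>1) powr (1 / (1 - \<delta>)) * s powr (- (Q / (1 - \<delta>))) * r powr (Q / (1 - \<delta>) - Q)"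
    if s: "0 < s" and r: "0 < r" "r < R\<^sub>0" and I: "finite I" "I \<subseteq> E"
      and sep: "\<forall>a\<in>I. \<forall>b\<in>I. a \<noteq> b \<longrightarrow> s \<le> dist (f a) (f b)"
      and dist: "\<forall>a\<in>I. \<exists>z. dist a z < r \<and> s / 2 \<le> dist (f a) (f z)" for s r I
  proof (rule count_from_power[OF c s r(1) \<delta>])
    have "\<forall>a\<in>I. \<exists>\<rho>. 0 < \<rho> \<and> \<rho> < r \<and> (\<forall>b. dist a b \<le> \<rho> \<longrightarrow> dist (f a) (f b) < s / 2) \<and> s / 2 \<le> osc a (2 * \<rho>)"
      using ex_stopping_radius[OF s r(1)] dist by blast
    then obtain \<rho> where \<rho>: "\<And>a. a \<in> I \<Longrightarrow> 0 < \<rho> a" "\<And>a. a \<in> I \<Longrightarrow> \<rho> a < r"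
      "\<And>a b. a \<in> I \<Longrightarrow> dist a b \<le> \<rho> a \<Longrightarrow> dist (f a) (f b) < s / 2"
      "\<And>a. a \<in> I \<Longrightarrow> s / 2 \<le> osc a (2 * \<rho> a)" by metis
    show "real (card I) * (c\<^sub>1 * s powr Q) \<le> K * (real (card I) * (c\<^sub>2 * r powr Q)) powr \<delta>"
    proof (rule count_disjoint_cballs[OF finX fin\<nu> I(1), of "\<lambda>a. a" \<rho>])
      show "disjoint_family_on (\<lambda>i. cball i (\<rho> i)) I"
        unfolding disjoint_family_on_def
      proof (intro ballI impI equals0I)
        fix a b x assume ab: "a \<in> I" "b \<in> I" "a \<noteq> b" and x: "x \<in> cball a (\<rho> a) \<inter> cball b (\<rho> b)"
        have "dist (f a) (f x) < s / 2" "dist (f b) (f x) < s / 2" using x \<rho>(3) ab by auto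
        then have "dist (f a) (f b) < s" using dist_triangle2[of "f a" "f b" "f x"] by linarith
        then show False using sep ab by fastforce
      qed
    next
      fix a assume a: "a \<in> I"
      have "s / 2 \<le> A * osc a (\<rho> a)" using \<rho>(4)[OF a] osc_doubling[OF \<rho>(1)[OF a]] by (rule order_trans)
      then have "1 / (4 * A * H) * s \<le> osc a (\<rho> a) / (2 * H)" using A2 H1 by (simp add: field_simps)
      then have "(1 / (4 * A * H) * s) powr Q \<le> (osc a (\<rho> a) / (2 * H)) powr Q"
        using s A2 H1 Q0 by (intro powr_mono2) auto
      then have "c\<^sub>1 * s powr Q \<le> (osc a (\<rho> a) / (2 * H)) powr Q / C"
        using C1 by (simp only: c\<^sub>1_def powr_mult) (simp add: divide_right_mono)
      also have "\<dots> \<le> measure \<nu> (ball a (\<rho> a))" by (rule \<nu>_lower[OF \<rho>(1)[OF a]])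
      also have "\<dots> \<le> measure \<nu> (cball a (\<rho> a))"
        by (intro measure_mono_balls[OF fin\<nu>] ball_subset_cball) auto
      finally show "c\<^sub>1 * s powr Q \<le> measure \<nu> (cball a (\<rho> a))" .
      have "cball a (\<rho> a) \<subseteq> ball a (2 * r)" using \<rho>(2)[OF a] r by auto
      then have "measure \<mu> (cball a (\<rho> a)) \<le> measure \<mu> (ball a (2 * r))"
        by (intro measure_mono_balls[OF finX]) auto
      also have "\<dots> \<le> C * (2 * r) powr Q" using r by (intro \<mu>_upper) simp
      also have "\<dots> = c\<^sub>2 * r powr Q" by (simp add: c\<^sub>2_def powr_mult)
      finally show "measure \<mu> (cball a (\<rho> a)) \<le> c\<^sub>2 * r powr Q" .
    next
      let ?P = "(\<lambda>i. (i, \<rho> i)) ` I"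
      have "cballs ?P \<subseteq> cball o' R'"
      proof
        fix y assume "y \<in> cballs ?P"
        then obtain a where a: "a \<in> I" "dist a y \<le> \<rho> a" by (auto simp: cballs_def)
        have "dist o' a \<le> R' - R\<^sub>0" using a I E by auto
        then show "y \<in> cball o' R'" using a \<rho>(2)[OF a(1)] r dist_triangle[of o' y a] by auto
      qed
      moreover have "\<forall>z t. (z, t) \<in> ?P \<longrightarrow> 0 < t \<and> t \<le> R\<^sub>0" using \<rho>(1,2) r by fastforce
      ultimately show "measure \<nu> (cballs ?P) \<le> K * measure \<mu> (cballs ?P) powr \<delta>"
        using I by (intro pwK) auto
    qed (use c \<delta> in auto)
  qed
  then show ?thesis
    unfolding distorted_count_def using R0
    by (intro exI[of _ "(K * c\<^sub>2 powr \<delta> / c\<^sub>1) powr (1 / (1 - \<delta>))"] exI[of _ 1] exI[of _ R\<^sub>0]) auto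
qed

text \<open>For the inverse map no stopping radius is needed: the balls of radius \<open>s / (4 H')\<close> around the image points
are balls of \<open>X\<close> already, and weak quasisymmetry of the inverse map puts their images under \<open>f\<close> into
balls of radius \<open>r\<close>.\<close>

lemma distorted_count_inverse:
  assumes \<delta>: "0 < \<delta>" "\<delta> < 1"
    and pw: "power_bound \<delta> R\<^sub>0 (cball o' R') \<nu> \<mu>"
    and E: "E \<subseteq> cball o' (R' - R\<^sub>0)"
  shows "distorted_count g (f ` E) (Q / (1 - \<delta>)) Q"
proof -
  obtain K where K: "K \<ge> 0" and pwK: "\<And>P. finite P \<Longrightarrow> (\<forall>z t. (z, t) \<in> P \<longrightarrow> 0 < t \<and> t \<le> R\<^sub>0) \<Longrightarrow>
      cballs P \<subseteq> cball o' R' \<Longrightarrow> measure \<mu> (cballs P) \<le> K * measure \<nu> (cballs P) powr \<delta>"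
    using pw unfolding power_bound_def by blast
  define c\<^sub>1 where "c\<^sub>1 = (1 / (4 * H')) powr Q / C"
  have c: "c\<^sub>1 > 0" "C > 0" "K \<ge> 0" using K C1 H'1 by (auto simp: c\<^sub>1_def )
  have "real (card I) \<le> (K * C powr \<delta> / c\<^sub>1) powr (1 / (1 - \<delta>)) * s powr (- (Q / (1 - \<delta>))) * r powr (Q / (1 - \<delta>) - Q)"
    if s: "0 < s" "s < R\<^sub>0" and r: "0 < r" and I: "finite I" "I \<subseteq> f ` E"
      and sep: "\<forall>a\<in>I. \<forall>b\<in>I. a \<noteq> b \<longrightarrow> s \<le> dist (g a) (g b)"
      and dist: "\<forall>a\<in>I. \<exists>z. dist a z < r \<and> s / 2 \<le> dist (g a) (g z)" for s r I
  proof (rule count_from_power[OF c s(1) r(1) \<delta>])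
    define t where "t = s / (4 * H')"
    have t: "0 < t" "t \<le> s / 4" "t \<le> R\<^sub>0" "t < 4 * R\<^sub>0" "H' * t = s / 4"
    proof -
      have "s / (4 * H') \<le> s / 4" using s H'1 by (intro divide_left_mono) auto
      then show "0 < t" "t \<le> s / 4" "t \<le> R\<^sub>0" "t < 4 * R\<^sub>0" "H' * t = s / 4"
        using s H'1 R0 by (auto simp: t_def)
    qed
    show "real (card I) * (c\<^sub>1 * s powr Q) \<le> K * (real (card I) * (C * r powr Q)) powr \<delta>"
    proof (rule count_disjoint_cballs[OF fin\<nu> finX I(1), of g "\<lambda>_. t"])
      show "disjoint_family_on (\<lambda>i. cball (g i) t) I"
        unfolding disjoint_family_on_def
      proof (intro ballI impI equals0I)
        fix a b x assume ab: "a \<in> I" "b \<in> I" "a \<noteq> b" and x: "x \<in> cball (g a) t \<inter> cball (g b) t"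
        then have "dist (g a) (g b) \<le> t + t" using dist_triangle2[of "g a" "g b" x] by auto
        then have "dist (g a) (g b) < s" using t s by linarith
        then show False using sep ab by fastforce
      qed
    next
      fix a assume a: "a \<in> I"
      have "c\<^sub>1 * s powr Q = (1 / (4 * H') * s) powr Q / C" by (simp only: c\<^sub>1_def powr_mult) simp
      also have "1 / (4 * H') * s = t" by (simp add: t_def)
      also have "t powr Q / C \<le> measure \<mu> (ball (g a) t)" using t by (intro \<mu>_lower) auto
      also have "\<dots> \<le> measure \<mu> (cball (g a) t)"
        by (intro measure_mono_balls[OF finX] ball_subset_cball) auto
      finally show "c\<^sub>1 * s powr Q \<le> measure \<mu> (cball (g a) t)" .
      obtain w where w: "dist a w < r" "s / 2 \<le> dist (g a) (g w)" using dist a by blast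
      have "f ` cball (g a) t \<subseteq> ball a r"
      proof (clarify, rule ccontr)
        fix b assume b: "b \<in> cball (g a) t" and nb: "f b \<notin> ball a r"
        have "dist a w \<le> dist a (f b)" using w nb by simp
        from weak_qsD[OF qsg this] have "dist (g a) (g w) \<le> H' * dist (g a) b" by simp
        also have "\<dots> \<le> H' * t" using b H'1 by (intro mult_left_mono) auto
        finally show False using w t s by linarith
      qed
      then have "measure \<nu> (cball (g a) t) \<le> measure \<mu>Y (ball a r)"
        by (subst measure_\<nu>) (auto intro!: measure_mono_balls[OF finY] image_borel)
      also have "\<dots> \<le> C * r powr Q" by (rule regular_boundsD(4)[OF regY r])
      finally show "measure \<nu> (cball (g a) t) \<le> C * r powr Q" .
    next
      let ?P = "(\<lambda>i. (g i, t)) ` I"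
      have "cballs ?P \<subseteq> cball o' R'"
      proof
        fix y assume "y \<in> cballs ?P"
        then obtain a where a: "a \<in> I" "dist (g a) y \<le> t" by (auto simp: cballs_def)
        obtain e where "e \<in> E" "a = f e" using a I by auto
        then have "dist o' (g a) \<le> R' - R\<^sub>0" using E by auto
        then show "y \<in> cball o' R'" using a t dist_triangle[of o' y "g a"] by auto
      qed
      moreover have "\<forall>z u. (z, u) \<in> ?P \<longrightarrow> 0 < u \<and> u \<le> R\<^sub>0" using t by auto
      ultimately show "measure \<mu> (cballs ?P) \<le> K * measure \<nu> (cballs ?P) powr \<delta>"
        using I by (intro pwK) auto
    qed (use c \<delta> in auto)
  qed
  then show ?thesis
    unfolding distorted_count_def using R0
    by (intro exI[of _ "(K * C powr \<delta> / c\<^sub>1) powr (1 / (1 - \<delta>))"] exI[of _ R\<^sub>0] exI[of _ 1]) auto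
qed

end

section \<open>Minkowski dimension under maps with few distorted points\<close>

lemma card_separated_le_covering_number:
  assumes F: "finite F" "F \<subseteq> E" "separated r F" and \<rho>: "0 \<le> \<rho>" "\<rho> < r"
  shows "enat (card F) \<le> covering_number E \<rho>"
  unfolding covering_number_def
proof (rule INF_greatest, clarify)
  fix \<C> assume \<C>: "finite \<C>" "E \<subseteq> \<Union>\<C>" "\<forall>A\<in>\<C>. ediameter A \<le> ennreal \<rho>"
  have "\<forall>a\<in>F. \<exists>A\<in>\<C>. a \<in> A" using F \<C> by blast
  then obtain c where c: "\<And>a. a \<in> F \<Longrightarrow> c a \<in> \<C> \<and> a \<in> c a" by metis
  have "inj_on c F"
  proof (rule inj_onI, rule ccontr)
    fix a b assume ab: "a \<in> F" "b \<in> F" "c a = c b" "a \<noteq> b"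
    have "b \<in> c a" using c[OF ab(2)] ab(3) by simp
    then have "ennreal (dist a b) \<le> ediameter (c a)" using c[OF ab(1)] by (intro dist_le_ediameter) auto
    also have "\<dots> \<le> ennreal \<rho>" using \<C>(3) c[OF ab(1)] by blast
    finally have "dist a b \<le> \<rho>" using \<rho> by (simp add: ennreal_le_iff)
    moreover have "r \<le> dist a b" using F(3) ab by (simp add: separated_def)
    ultimately show False using \<rho> by linarith
  qed
  then have "card F \<le> card \<C>" using c \<C>(1) by (intro card_inj_on_le[of c]) auto
  then show "enat (card F) \<le> enat (card \<C>)" by simp
qed

lemma covering_number_le_card:
  assumes "finite F" "S \<subseteq> (\<Union>a\<in>F. ball a s)"
  shows "covering_number S (2 * s) \<le> enat (card F)"
proof -
  let ?\<C> = "(\<lambda>a. ball a s) ` F"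
  have "covering_number S (2 * s) \<le> enat (card ?\<C>)"
    unfolding covering_number_def
  proof (rule INF_lower, clarify, intro conjI)
    show "\<forall>A\<in>?\<C>. ediameter A \<le> ennreal (2 * s)"
    proof (clarify, rule ediameter_leI, rule ennreal_leI)
      fix a x y assume "x \<in> ball a s" "y \<in> ball a s"
      then show "dist x y \<le> 2 * s" using dist_triangle3[of x y a] by auto
    qed
  qed (use assms in auto)
  also have "\<dots> \<le> enat (card F)" using card_image_le[OF assms(1)] by simp
  finally show ?thesis .
qed

lemma ln_enat_quotient_lessE:
  assumes "0 < \<rho>" "\<rho> < 1" "ln_enat N / ereal (ln (1 / \<rho>)) < ereal d"
  obtains n where "N = enat n" "real n \<le> \<rho> powr (- d)"
proof (cases N)
  case (enat n)
  have l: "ln (1 / \<rho>) > 0" using assms by simp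
  have "real n \<le> \<rho> powr (- d)"
  proof (cases "n = 0")
    case False
    then have "ln (real n) / ln (1 / \<rho>) < d" using assms(3) enat l by (simp add: ln_enat_def)
    then have "ln (real n) < d * ln (1 / \<rho>)" using l by (simp only: pos_divide_less_eq)
    also have "ln (1 / \<rho>) = - ln \<rho>" using assms(1) by (simp add: ln_div)
    finally have "ln (real n) < - d * ln \<rho>" by simp
    also have "- d * ln \<rho> = ln (\<rho> powr (- d))" using assms(1) by (simp add: ln_powr)
    finally have "real n < \<rho> powr (- d)"
      by (rule ln_less_cancel_iff[THEN iffD1, rotated 2]) (use False assms(1) in auto)
    then show ?thesis by simp
  qed simp
  with enat that show ?thesis by blast
next
  case infinity
  have l: "ln (1 / \<rho>) > 0" using assms by simp
  then show ?thesis using assms(3) infinity by (simp add: ln_enat_def)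
qed

lemma ln_enat_quotient_le:
  assumes N: "N \<le> enat n" "real n \<le> B" and B: "B \<ge> 1" and t: "0 < t" "t < 1"
    and le: "ln B \<le> D * ln (1 / t)"
  shows "ln_enat N / ereal (ln (1 / t)) \<le> ereal D"
proof -
  obtain k where k: "N = enat k" "k \<le> n" using N(1) by (cases N) auto
  have l: "ln (1 / t) > 0" using t by simp
  show ?thesis
  proof (cases "k = 0")
    case True
    then show ?thesis using k l by (simp add: ln_enat_def zero_enat_def)
  next
    case False
    have "ln (real k) \<le> ln B" using False k N(2) B by (intro ln_mono) auto
    then have "ln (real k) / ln (1 / t) \<le> D" using le l by (simp add: divide_le_eq)
    then show ?thesis using k False l by (simp add: ln_enat_def)
  qed
qed

text \<open>With \<open>r = s powr (p / (p - Q + d))\<close> both the number \<open>r powr (- d)\<close> of undistorted points and the number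
\<open>s powr (- p) * r powr (p - Q)\<close> of distorted ones become \<open>s powr (- D)\<close>. The strict inequality for the
dimension of \<open>E\<close> gives the covering bound with the exponent \<open>d\<close> itself at all small scales.\<close>

lemma minkowski_dim_image_le:
  fixes h :: "'a::metric_space \<Rightarrow> 'b::metric_space"
  assumes cnt: "distorted_count h E p Q" and Q: "Q < p" "0 < p" and d: "0 < d"
    and dim: "minkowski_dim E < ereal d"
  shows "minkowski_dim (h ` E) \<le> ereal (p * d / (p - Q + d))"
proof -
  define q where "q = p - Q + d"
  define D where "D = p * d / q"
  have q: "q > 0" and D: "D > 0" using Q d by (auto simp: q_def D_def)
  obtain K s\<^sub>0 r\<^sub>0 where K: "K \<ge> 0" and s0: "s\<^sub>0 > 0" and r0: "r\<^sub>0 > 0"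
    and bound: "\<And>s r I. 0 < s \<Longrightarrow> s < s\<^sub>0 \<Longrightarrow> 0 < r \<Longrightarrow> r < r\<^sub>0 \<Longrightarrow> finite I \<Longrightarrow> I \<subseteq> E \<Longrightarrow>
        (\<forall>a\<in>I. \<forall>b\<in>I. a \<noteq> b \<longrightarrow> s \<le> dist (h a) (h b)) \<Longrightarrow>
        (\<forall>a\<in>I. \<exists>z. dist a z < r \<and> s / 2 \<le> dist (h a) (h z)) \<Longrightarrow>
        real (card I) \<le> K * s powr (- p) * r powr (p - Q)"
    using cnt unfolding distorted_count_def by metis
  have "eventually (\<lambda>\<rho>. ln_enat (covering_number E \<rho>) / ereal (ln (1 / \<rho>)) < ereal d) (at_right 0)"
    using dim unfolding minkowski_dim_def by (rule Limsup_lessD)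
  then obtain \<rho>\<^sub>1 where \<rho>1: "\<rho>\<^sub>1 > 0"
    and cov: "\<And>\<rho>. 0 < \<rho> \<Longrightarrow> \<rho> < \<rho>\<^sub>1 \<Longrightarrow> ln_enat (covering_number E \<rho>) / ereal (ln (1 / \<rho>)) < ereal d"
    unfolding eventually_at_right_field by auto
  define K\<^sub>1 where "K\<^sub>1 = 2 powr d + K"
  have K1: "K\<^sub>1 \<ge> 1"
  proof -
    have "1 \<le> 2 powr d" using d by (intro ge_one_powr_ge_zero) auto
    then show ?thesis using K by (simp add: K\<^sub>1_def)
  qed
  have separated_card: "real (card F) \<le> K\<^sub>1 * s powr (- D)"
    if s: "0 < s" "s < s\<^sub>0" and r: "s powr (p / q) < min r\<^sub>0 (min \<rho>\<^sub>1 1)"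
      and F: "finite F" "F \<subseteq> h ` E" "separated s F" for s F
  proof -
    define r where "r = s powr (p / q)"
    have r': "0 < r" "r < r\<^sub>0" "r / 2 < \<rho>\<^sub>1" "r / 2 < 1"
    proof -
      have "r < r\<^sub>0" "r < \<rho>\<^sub>1" "r < 1" "0 < r" using s r by (auto simp: r_def)
      then show "0 < r" "r < r\<^sub>0" "r / 2 < \<rho>\<^sub>1" "r / 2 < 1" by linarith+
    qed
    obtain J where J: "J \<subseteq> E" "finite J" "F = h ` J" "inj_on h J"
      using finite_subset_image[OF F(1,2)] subset_image_inj[of F h E] F by (metis finite_imageD)
    have sep: "s \<le> dist (h a) (h b)" if "a \<in> J" "b \<in> J" "a \<noteq> b" for a b
      using F(3) J(3,4) that by (auto simp: separated_def inj_on_def)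
    define I where "I = {a \<in> J. \<exists>z. dist a z < r \<and> s / 2 \<le> dist (h a) (h z)}"
    have "real (card I) \<le> K * s powr (- p) * r powr (p - Q)"
      using J sep by (intro bound s r') (auto simp: I_def)
    also have "\<dots> = K * s powr (- D)"
    proof -
      have "- p + p / q * (p - Q) = - D" using q by (simp add: D_def q_def field_simps)
      then show ?thesis using s by (simp add: r_def powr_powr powr_add[symmetric])
    qed
    finally have cI: "real (card I) \<le> K * s powr (- D)" .
    \<comment> \<open>Two undistorted points closer than \<open>r\<close> would have images closer than \<open>s / 2\<close>.\<close>
    have "separated r (J - I)"
      unfolding separated_def
    proof (intro ballI impI, rule ccontr)
      fix a b assume ab: "a \<in> J - I" "b \<in> J - I" "a \<noteq> b" "\<not> r \<le> dist a b"
      have "\<not> (dist a b < r \<and> s / 2 \<le> dist (h a) (h b))" using ab(1) by (auto simp: I_def)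
      then have "dist (h a) (h b) < s / 2" using ab(4) by linarith
      moreover have "s \<le> dist (h a) (h b)" using ab by (intro sep) auto
      ultimately show False using s by linarith
    qed
    then have le: "enat (card (J - I)) \<le> covering_number E (r / 2)"
      using J(1,2) r' by (intro card_separated_le_covering_number[of _ _ r]) auto
    obtain n where "covering_number E (r / 2) = enat n" "real n \<le> (r / 2) powr (- d)"
      using ln_enat_quotient_lessE[OF _ r'(4) cov[OF _ r'(3)]] r'(1) by auto
    then have "real (card (J - I)) \<le> (r / 2) powr (- d)" using le by auto
    also have "\<dots> = 2 powr d * s powr (- D)"
    proof -
      have "(r / 2) powr (- d) = 2 powr d * r powr (- d)"
        using r'(1) by (simp add: powr_divide powr_minus divide_simps)
      moreover have "p / q * (- d) = - D" by (simp add: D_def)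
      ultimately show ?thesis by (simp only: r_def powr_powr)
    qed
    finally have "real (card (J - I)) \<le> 2 powr d * s powr (- D)" .
    moreover have "card F = card I + card (J - I)"
    proof -
      have "card J = card I + card (J - I)"
        using J(2) by (subst card_Un_disjoint[symmetric]) (auto simp: I_def intro: arg_cong[of _ _ card])
      then show ?thesis using J by (simp add: card_image)
    qed
    ultimately show ?thesis using cI by (simp add: K\<^sub>1_def algebra_simps)
  qed
  have cover: "\<exists>n. covering_number (h ` E) (2 * s) \<le> enat n \<and> real n \<le> K\<^sub>1 * s powr (- D)"
    if s: "0 < s" "s < s\<^sub>0" and r: "s powr (p / q) < min r\<^sub>0 (min \<rho>\<^sub>1 1)" for s
  proof -
    have "card F \<le> nat \<lfloor>K\<^sub>1 * s powr (- D)\<rfloor>" if "finite F" "F \<subseteq> h ` E" "separated s F" for F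
      using separated_card[OF s r that] by (simp add: le_nat_floor)
    then obtain F where F: "finite F" "F \<subseteq> h ` E" "separated s F" "h ` E \<subseteq> (\<Union>a\<in>F. ball a s)"
      using ex_maximal_separated[of "h ` E" s, OF _ s(1)] by metis
    then show ?thesis using covering_number_le_card[OF F(1,4)] separated_card[OF s r F(1-3)] by blast
  qed
  have "minkowski_dim (h ` E) \<le> ereal D + ereal e" if e: "e > 0" for e
  proof -
    have "eventually (\<lambda>s. 0 \<le> s) (at_right (0::real))"
      using eventually_at_right_less[of "0::real"] by (rule eventually_mono) simp
    then have "((\<lambda>s. s powr (p / q)) \<longlongrightarrow> 0 powr (p / q)) (at_right 0)"
      using Q q by (intro tendsto_powr' tendsto_intros) auto
    then have "((\<lambda>s. s powr (p / q)) \<longlongrightarrow> 0) (at_right 0)" by simp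
    then have ev1: "eventually (\<lambda>s. s powr (p / q) < min r\<^sub>0 (min \<rho>\<^sub>1 1)) (at_right 0)"
      using r0 \<rho>1 by (intro order_tendstoD(2)) auto
    obtain \<sigma> where \<sigma>: "\<sigma> > 0" "\<And>s. 0 < s \<Longrightarrow> s < \<sigma> \<Longrightarrow> s powr (p / q) < min r\<^sub>0 (min \<rho>\<^sub>1 1)"
      using ev1 unfolding eventually_at_right_field by auto
    define L where "L = (ln K\<^sub>1 + D * ln 2) / e"
    define \<tau> where "\<tau> = min (min \<sigma> s\<^sub>0) (min 1 (exp (- L)))"
    have \<tau>: "\<tau> > 0" using \<sigma>(1) s0 by (simp add: \<tau>_def)
    have "ln_enat (covering_number (h ` E) t) / ereal (ln (1 / t)) \<le> ereal (D + e)" if t: "0 < t" "t < \<tau>" for t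
    proof -
      have t': "0 < t / 2" "t / 2 < s\<^sub>0" "t / 2 < \<sigma>" "t < 1" "t < exp (- L)"
        using t by (auto simp: \<tau>_def)
      obtain n where n: "covering_number (h ` E) (2 * (t / 2)) \<le> enat n" "real n \<le> K\<^sub>1 * (t / 2) powr (- D)"
        using cover[OF t'(1,2) \<sigma>(2)[OF t'(1,3)]] by blast
      have pw: "1 \<le> (t / 2) powr (- D)"
      proof -
        have "(t / 2) powr D \<le> 1" using t' D by (intro powr_le1) auto
        then show ?thesis using t' by (simp add: powr_minus one_le_inverse_iff)
      qed
      have B: "1 \<le> K\<^sub>1 * (t / 2) powr (- D)" using mult_mono[OF K1 pw] K1 by simp
      have "ln t < - L" using t' t by (metis exp_less_cancel_iff exp_ln)
      then have "L < ln (1 / t)" using t by (simp add: ln_div)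
      then have "L * e < ln (1 / t) * e" using e by (rule mult_strict_right_mono)
      then have "ln K\<^sub>1 + D * ln 2 \<le> e * ln (1 / t)" using e by (simp add: L_def mult.commute)
      moreover have "ln (K\<^sub>1 * (t / 2) powr (- D)) = ln K\<^sub>1 + D * ln 2 + D * ln (1 / t)"
        using K1 t by (simp add: ln_mult ln_powr ln_div algebra_simps)
      ultimately have "ln (K\<^sub>1 * (t / 2) powr (- D)) \<le> (D + e) * ln (1 / t)"
        by (simp add: algebra_simps)
      with n B t t' show ?thesis by (intro ln_enat_quotient_le[of _ n "K\<^sub>1 * (t / 2) powr (- D)"]) auto
    qed
    then have "eventually (\<lambda>t. ln_enat (covering_number (h ` E) t) / ereal (ln (1 / t)) \<le> ereal (D + e)) (at_right 0)"
      using \<tau> unfolding eventually_at_right_field by blast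
    then have "minkowski_dim (h ` E) \<le> ereal (D + e)" unfolding minkowski_dim_def by (rule Limsup_bounded)
    then show ?thesis by simp
  qed
  then have "minkowski_dim (h ` E) \<le> ereal D" by (rule ereal_le_epsilon2)
  then show ?thesis by (simp add: D_def q_def)
qed

section \<open>The distortion of dimension by quasisymmetric maps\<close>

text \<open>A continuous injective function on an interval takes at an inner point a value strictly between the
values at the ends. As all values are nonnegative and 0 is attained, it is attained at 0, and then
the function increases.\<close>

lemma half_line_homeomorphism:
  assumes "homeomorphic_map (top_of_set {0..}) (top_of_set {0..}) (\<eta> :: real \<Rightarrow> real)"
  shows "\<And>a b. 0 \<le> a \<Longrightarrow> a < b \<Longrightarrow> \<eta> a < \<eta> b"
    and "0 < inv_into {0..} \<eta> 1" and "\<eta> (inv_into {0..} \<eta> 1) = 1"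
proof -
  have cont: "continuous_on {0..} \<eta>"
    using homeomorphic_imp_continuous_map[OF assms] by (simp add: continuous_map_in_subtopology)
  have surj: "\<eta> ` {0..} = {0..}" using homeomorphic_imp_surjective_map[OF assms] by simp
  have inj: "inj_on \<eta> {0..}" using homeomorphic_imp_injective_map[OF assms] by simp
  have nonneg: "0 \<le> \<eta> t" if "0 \<le> t" for t using surj that by auto
  have between: "(\<eta> 0 < \<eta> x \<and> \<eta> x < \<eta> b) \<or> (\<eta> b < \<eta> x \<and> \<eta> x < \<eta> 0)" if "0 < x" "x < b" for x b
    using that by (intro continuous_inj_imp_mono)
      (auto intro: continuous_on_subset[OF cont] inj_on_subset[OF inj])
  obtain z where z: "0 \<le> z" "\<eta> z = 0" using surj by (metis atLeast_iff imageE order_refl)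
  have "z = 0"
  proof (rule ccontr)
    assume "z \<noteq> 0"
    then have "(\<eta> 0 < \<eta> z \<and> \<eta> z < \<eta> (z + 1)) \<or> (\<eta> (z + 1) < \<eta> z \<and> \<eta> z < \<eta> 0)"
      using z(1) by (intro between) auto
    then show False using nonneg[of 0] nonneg[of "z + 1"] z by auto
  qed
  then have \<eta>0: "\<eta> 0 = 0" using z by simp
  show mono: "\<eta> a < \<eta> b" if "0 \<le> a" "a < b" for a b
  proof (cases "a = 0")
    case True
    have "\<eta> b \<noteq> \<eta> 0" using inj that True by (auto dest: inj_onD)
    then show ?thesis using nonneg[of b] that True \<eta>0 by simp
  next
    case False
    then show ?thesis using between[of a b] that nonneg[of b] nonneg[of a] \<eta>0 by auto
  qed
  have "1 \<in> \<eta> ` {0..}" using surj by simp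
  then show t0: "\<eta> (inv_into {0..} \<eta> 1) = 1" by (rule f_inv_into_f)
  have "0 \<le> inv_into {0..} \<eta> 1" using inv_into_into[OF \<open>1 \<in> \<eta> ` {0..}\<close>] by simp
  moreover have "inv_into {0..} \<eta> 1 \<noteq> 0" using t0 \<eta>0 by auto
  ultimately show "0 < inv_into {0..} \<eta> 1" by simp
qed

lemma quasisymmetric_weak_qs:
  fixes f :: "'a::metric_space \<Rightarrow> 'b::metric_space"
  assumes qs: "quasisymmetric \<eta> f" and inj: "inj f"
  shows "weak_qs (max 1 (\<eta> 1)) f"
  unfolding weak_qs_def
proof (intro allI impI)
  fix x y z :: 'a assume le: "dist x y \<le> dist x z"
  note mono = half_line_homeomorphism(1)[of \<eta>]
  have hom: "homeomorphic_map (top_of_set {0..}) (top_of_set {0..}) \<eta>"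
    and ineq: "\<And>x y z. x \<noteq> y \<Longrightarrow> y \<noteq> z \<Longrightarrow> x \<noteq> z \<Longrightarrow>
        dist (f x) (f y) / dist (f z) (f y) \<le> \<eta> (dist x y / dist z y)"
    using qs unfolding quasisymmetric_def by blast+
  let ?H = "max 1 (\<eta> 1)"
  show "dist (f x) (f y) \<le> ?H * dist (f x) (f z)"
  proof (cases "x = y \<or> y = z \<or> x = z")
    case True
    have "1 * dist (f x) (f z) \<le> ?H * dist (f x) (f z)" by (intro mult_right_mono) auto
    then show ?thesis using True le by auto
  next
    case False
    then have pos: "dist (f z) (f x) > 0" "dist z x > 0" using inj by (auto dest: injD)
    have "dist (f y) (f x) / dist (f z) (f x) \<le> \<eta> (dist y x / dist z x)"
      using False by (intro ineq) auto
    also have "\<dots> \<le> \<eta> 1"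
    proof (cases "dist y x / dist z x = 1")
      case True
      then show ?thesis by (simp only: order_refl)
    next
      case False
      then have "dist y x / dist z x < 1" using le pos by (simp add: dist_commute divide_less_eq less_le)
      then show ?thesis using mono[OF hom] by (intro less_imp_le) auto
    qed
    also have "\<dots> \<le> ?H" by simp
    finally show ?thesis using pos by (simp add: divide_le_eq dist_commute)
  qed
qed

text \<open>Strict monotonicity enters here: distances in \<open>X\<close> with ratio below \<open>\<eta>\<^sup>-\<^sup>1(1)\<close> have images with ratio
strictly below 1.\<close>

lemma quasisymmetric_inverse_weak_qs:
  fixes f :: "'a::metric_space \<Rightarrow> 'b::metric_space"
  assumes qs: "quasisymmetric \<eta> f" and gf: "\<And>x. g (f x) = x" and fg: "\<And>y. f (g y) = y"
  shows "weak_qs (max 1 (1 / inv_into {0..} \<eta> 1)) g"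
  unfolding weak_qs_def
proof (intro allI impI)
  fix u v w :: 'b assume le: "dist u v \<le> dist u w"
  define x y z where "x = g u" and "y = g v" and "z = g w"
  have uvw: "u = f x" "v = f y" "w = f z" by (simp_all add: x_def y_def z_def fg)
  let ?t = "inv_into {0..} \<eta> 1" and ?H = "max 1 (1 / inv_into {0..} \<eta> 1)"
  have hom: "homeomorphic_map (top_of_set {0..}) (top_of_set {0..}) \<eta>"
    and ineq: "\<And>x y z. x \<noteq> y \<Longrightarrow> y \<noteq> z \<Longrightarrow> x \<noteq> z \<Longrightarrow>
        dist (f x) (f y) / dist (f z) (f y) \<le> \<eta> (dist x y / dist z y)"
    using qs unfolding quasisymmetric_def by blast+
  note mono = half_line_homeomorphism(1)[OF hom] and t = half_line_homeomorphism(2,3)[OF hom]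
  have "dist x y \<le> ?H * dist x z"
  proof (cases "x = y \<or> y = z \<or> x = z")
    case True
    have "1 * dist x z \<le> ?H * dist x z" by (intro mult_right_mono) auto
    then show ?thesis using True le uvw gf by (auto simp: zero_le_dist) (metis dist_eq_0_iff dist_self gf order_antisym zero_le_dist)
  next
    case False
    then have pos: "dist (f y) (f x) > 0" "dist y x > 0" using gf by (metis zero_less_dist_iff)+
    show ?thesis
    proof (rule ccontr)
      assume "\<not> dist x y \<le> ?H * dist x z"
      moreover have "1 / ?t * dist x z \<le> ?H * dist x z" by (intro mult_right_mono) auto
      ultimately have "1 / ?t * dist x z < dist x y" by linarith
      then have "dist z x / dist y x < ?t" using pos t by (simp add: field_simps dist_commute)
      then have "\<eta> (dist z x / dist y x) < \<eta> ?t" by (intro mono) auto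
      moreover have "dist (f z) (f x) / dist (f y) (f x) \<le> \<eta> (dist z x / dist y x)"
        using False by (intro ineq) auto
      ultimately have "dist (f z) (f x) / dist (f y) (f x) < 1" using t by simp
      then show False using le pos uvw by (simp add: dist_commute)
    qed
  qed
  then show "dist (g u) (g v) \<le> ?H * dist (g u) (g w)" by (simp add: x_def y_def z_def)
qed

text \<open>If the space were the union of two disjoint nonempty open sets, the indicator function of one of them
would have the upper gradient 0, since curves are connected. By the Poincare inequality it would then
be almost everywhere constant on a ball that meets both sets.\<close>

lemma poincare_connected:
  fixes \<mu> :: "'a::metric_space measure"
  assumes P: "supports_poincare p \<mu>" and mms: "metric_measure_space \<mu>"
  shows "connected (UNIV :: 'a set)"
proof (rule connectedI)
  fix U V :: "'a set"
  assume op: "open U" "open V" and ne: "U \<inter> UNIV \<noteq> {}" "V \<inter> UNIV \<noteq> {}"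
    and dj: "U \<inter> V \<inter> UNIV = {}" and cov: "UNIV \<subseteq> U \<union> V"
  obtain x y where xy: "x \<in> U" "y \<in> V" using ne by auto
  have sets: "sets \<mu> = sets borel" and pos: "\<And>x r. r > 0 \<Longrightarrow> 0 < emeasure \<mu> (ball x r)"
    and fin: "\<And>x r. r > 0 \<Longrightarrow> emeasure \<mu> (ball x r) < \<infinity>"
    using mms unfolding metric_measure_space_def by blast+
  define r where "r = dist x y + 1"
  have r: "r > 0" by (simp add: r_def add_nonneg_pos)
  let ?u = "indicat_real U" and ?B = "ball x r"
  have ug: "upper_gradient (\<lambda>_. 0) ?u"
    unfolding upper_gradient_def
  proof (intro conjI allI impI)
    fix \<gamma> :: "real \<Rightarrow> 'a" assume "rectifiable \<gamma>"
    then have "connected (\<gamma> ` {0..1})"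
      by (intro connected_continuous_image) (auto simp: rectifiable_def path_def)
    from connectedD[OF this op] have "U \<inter> \<gamma> ` {0..1} = {} \<or> V \<inter> \<gamma> ` {0..1} = {}"
      using dj cov by blast
    moreover have "\<gamma> 0 \<in> \<gamma> ` {0..1}" "\<gamma> 1 \<in> \<gamma> ` {0..1}" by auto
    ultimately have "\<gamma> 0 \<in> U \<longleftrightarrow> \<gamma> 1 \<in> U" using cov by blast
    then have "?u (\<gamma> 0) = ?u (\<gamma> 1)" by (simp add: indicator_def)
    then show "ennreal \<bar>?u (\<gamma> 0) - ?u (\<gamma> 1)\<bar> \<le> curve_integral \<gamma> (\<lambda>_. 0)" by simp
  qed simp
  have int: "set_integrable \<mu> ?B ?u"
    unfolding set_integrable_def
  proof (rule integrableI_bounded_set[of ?B _ _ 1])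
    show "?B \<in> sets \<mu>" by (simp add: sets)
    show "(\<lambda>z. indicat_real ?B z *\<^sub>R ?u z) \<in> borel_measurable \<mu>"
      unfolding real_scaleR_def using op
      by (intro borel_measurable_times borel_measurable_indicator) (simp_all add: sets)
  qed (use fin[OF r] in \<open>auto simp: indicator_def\<close>)
  obtain C \<Lambda> where "C > 0" and ineq: "(\<integral>\<^sup>+ z \<in> ?B. ennreal \<bar>?u z - ball_average \<mu> ?B ?u\<bar> \<partial>\<mu>)
               / emeasure \<mu> ?B
           \<le> ennreal C * ediameter ?B *
             ennpowr ((\<integral>\<^sup>+ z \<in> ball x (\<Lambda> * r). ennpowr 0 p \<partial>\<mu>)
                         / emeasure \<mu> (ball x (\<Lambda> * r))) (1 / p)"
    using P ug int r unfolding supports_poincare_def by blast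
  have "ennpowr 0 a = 0" for a by (simp add: ennpowr_def)
  then have "(\<integral>\<^sup>+ z \<in> ?B. ennreal \<bar>?u z - ball_average \<mu> ?B ?u\<bar> \<partial>\<mu>) / emeasure \<mu> ?B = 0"
    using ineq by simp
  then have zero: "(\<integral>\<^sup>+ z \<in> ?B. ennreal \<bar>?u z - ball_average \<mu> ?B ?u\<bar> \<partial>\<mu>) = 0"
    using fin[OF r, of x] by (auto simp: ennreal_divide_eq_0_iff)
  have ball_pos: "0 < emeasure \<mu> (W \<inter> ?B)" if W: "open W" "w \<in> W" "w \<in> ?B" for W w
  proof -
    have "open (W \<inter> ?B)" using W by auto
    then obtain e where e: "e > 0" "ball w e \<subseteq> W \<inter> ?B" using W openE[of "W \<inter> ?B" w] by auto
    have "0 < emeasure \<mu> (ball w e)" by (rule pos[OF e(1)])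
    also have "\<dots> \<le> emeasure \<mu> (W \<inter> ?B)" using e W by (intro emeasure_mono) (auto simp: sets)
    finally show ?thesis .
  qed
  define c where "c = min (emeasure \<mu> (V \<inter> ?B)) (emeasure \<mu> (U \<inter> ?B))"
  have "0 < c" unfolding c_def using ball_pos[OF op(2) xy(2)] ball_pos[OF op(1) xy(1)] r
    by (auto simp: r_def)
  have "ennreal (1 / 2 / 2) * c \<le> (\<integral>\<^sup>+ z \<in> ?B. ennreal \<bar>?u z - ball_average \<mu> ?B ?u\<bar> \<partial>\<mu>)"
    using op dj by (intro nn_integral_deviation_ge[of "V \<inter> ?B" _ "U \<inter> ?B"]) (auto simp: sets c_def indicator_def)
  then have "c = 0" using zero by simp
  then show False using \<open>0 < c\<close> by simp
qed

text \<open>The condition for \<open>(\<mu>, \<nu>)\<close> gives an exponent for the map, the swapped one for \<open>(\<nu>, \<mu>)\<close> an exponent for its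
inverse; the smaller one serves for both.\<close>

lemma ex_distortion_exponent:
  fixes \<mu> :: "'a::metric_space measure" and \<mu>Y :: "'b::metric_space measure"
  assumes const: "C \<ge> 1" "H \<ge> 1" "H' \<ge> 1" "C\<^sub>P > 0" "\<Lambda> \<ge> 1" and p0: "1 < p\<^sub>0" "p\<^sub>0 < Q"
    and proper: "proper_space TYPE('a)"
  shows "\<exists>p>Q. \<forall>R f g E. qs_poincare Q C H H' R \<mu> \<mu>Y f g p\<^sub>0 C\<^sub>P \<Lambda> \<longrightarrow> bounded E \<longrightarrow>
    distorted_count f E p Q \<and> distorted_count g (f ` E) p Q"
proof -
  obtain \<alpha> c where \<alpha>: "\<alpha> > 0" and c: "c > 0"
    and Ai: "\<And>R f g. qs_poincare Q C H H' R \<mu> \<mu>Y f g p\<^sub>0 C\<^sub>P \<Lambda> \<Longrightarrow> A_inf \<alpha> c R \<mu> (distr \<mu>Y borel g)"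
    using quasisymmetric_A_inf[where 'a = 'a and 'b = 'b, OF const _ p0(2)] p0(1) by (metis order_less_trans zero_less_one)
  define D where "D = C\<^sup>2 * (4 * doubling_const Q C H * H) powr Q"
  have "2 * 1 \<le> doubling_const Q C H * H"
    using const doubling_const_ge[of Q C H] by (intro mult_mono) auto
  then have "2 \<le> 4 * doubling_const Q C H * H" by linarith
  then have DC: "C\<^sup>2 * 2 powr Q \<le> D"
    unfolding D_def using p0 by (intro mult_left_mono powr_mono2) auto
  have "1 * 1 \<le> C\<^sup>2 * 2 powr Q"
    using const p0 by (intro mult_mono ge_one_powr_ge_zero) (auto simp: one_le_power)
  then have D: "D \<ge> 1" using DC by simp
  have c2: "c / 2 > 0" using c by simp
  obtain \<delta>\<^sub>1 where \<delta>1: "0 < \<delta>\<^sub>1" "\<delta>\<^sub>1 < 1" and pw1: "\<And>R (m\<^sub>1 :: 'a measure) m\<^sub>2 o' R'. R > 0 \<Longrightarrow>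
    doubling_on D (2 * R) m\<^sub>1 \<Longrightarrow> doubling_on D (2 * R) m\<^sub>2 \<Longrightarrow> A_inf \<alpha> c R m\<^sub>1 m\<^sub>2 \<Longrightarrow>
    power_bound \<delta>\<^sub>1 R (cball o' R') m\<^sub>1 m\<^sub>2"
    using A_inf_power[OF proper D \<alpha> c] by (elim exE conjE) blast
  obtain \<delta>\<^sub>2 where \<delta>2: "0 < \<delta>\<^sub>2" "\<delta>\<^sub>2 < 1" and pw2: "\<And>R (m\<^sub>1 :: 'a measure) m\<^sub>2 o' R'. R > 0 \<Longrightarrow>
    doubling_on D (2 * R) m\<^sub>1 \<Longrightarrow> doubling_on D (2 * R) m\<^sub>2 \<Longrightarrow> A_inf (c / 2) \<alpha> R m\<^sub>1 m\<^sub>2 \<Longrightarrow>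
    power_bound \<delta>\<^sub>2 R (cball o' R') m\<^sub>1 m\<^sub>2"
    using A_inf_power[OF proper D c2 \<alpha>] by (elim exE conjE) blast
  define \<delta> where "\<delta> = min \<delta>\<^sub>1 \<delta>\<^sub>2"
  have \<delta>: "0 < \<delta>" "\<delta> < 1" "\<delta> \<le> \<delta>\<^sub>1" "\<delta> \<le> \<delta>\<^sub>2" using \<delta>1 \<delta>2 by (auto simp: \<delta>_def)
  have "Q < Q / (1 - \<delta>)" using \<delta> p0 by (simp add: less_divide_eq)
  moreover have "distorted_count f E (Q / (1 - \<delta>)) Q \<and> distorted_count g (f ` E) (Q / (1 - \<delta>)) Q"
    if qp: "qs_poincare Q C H H' R \<mu> \<mu>Y f g p\<^sub>0 C\<^sub>P \<Lambda>" and E: "bounded E" for R f g E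
  proof -
    interpret qs_poincare Q C H H' R \<mu> \<mu>Y f g p\<^sub>0 C\<^sub>P \<Lambda> by (rule qp)
    have dbl\<mu>: "doubling_on D (2 * R) \<mu>"
      unfolding doubling_on_def
    proof (intro conjI allI impI)
      fix x r assume r: "0 < r \<and> r \<le> 2 * R"
      have "measure \<mu> (ball x (2 * r)) \<le> C\<^sup>2 * 2 powr Q * measure \<mu> (ball x r)"
        using r R0 by (intro \<mu>_doubling) auto
      also have "\<dots> \<le> D * measure \<mu> (ball x r)" using DC by (rule mult_right_mono) simp
      finally show "measure \<mu> (ball x (2 * r)) \<le> D * measure \<mu> (ball x r)" .
    qed (use finX \<mu>_pos in auto)
    have dbl\<nu>: "doubling_on D (2 * R) \<nu>"
      unfolding doubling_on_def D_def using fin\<nu> \<nu>_pos \<nu>_doubling by blast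
    have A1: "A_inf \<alpha> c R \<mu> \<nu>" using Ai[OF qp] by (simp add: \<nu>_def)
    have A2: "A_inf (c / 2) \<alpha> R \<nu> \<mu>" by (rule A_inf_swap[OF A1 c finX fin\<nu> \<nu>_pos])
    obtain o' b where "E \<subseteq> ball o' b" using bounded_subset_ballD[OF E] by blast
    then have "E \<subseteq> cball o' b" using ball_subset_cball by blast
    \<comment> \<open>The power bound is used in a region that contains all balls of radius \<open>R\<close> around points of \<open>E\<close>.\<close>
    then have Eb: "E \<subseteq> cball o' ((b + R) - R)" by simp
    have "power_bound \<delta> R (cball o' (b + R)) \<mu> \<nu>"
      by (rule power_bound_mono[OF pw1[OF R0 dbl\<mu> dbl\<nu> A1] \<delta>(3) finX]) auto
    moreover have "power_bound \<delta> R (cball o' (b + R)) \<nu> \<mu>"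
      by (rule power_bound_mono[OF pw2[OF R0 dbl\<nu> dbl\<mu> A2] \<delta>(4) fin\<nu>]) auto
    ultimately show ?thesis
      using distorted_count_forward[OF \<delta>(1,2) _ Eb] distorted_count_inverse[OF \<delta>(1,2) _ Eb] by blast
  qed
  ultimately show ?thesis by blast
qed

text \<open>In a one-point space no set has positive dimension, so that the theorem is vacuous there.\<close>

lemma minkowski_dim_single:
  fixes E :: "'a::metric_space set"
  assumes "\<And>x y :: 'a. x = y"
  shows "minkowski_dim E \<le> 0"
proof -
  have "ln_enat (covering_number E t) / ereal (ln (1 / t)) \<le> ereal 0" if t: "0 < t" "t < 1" for t
  proof (rule ln_enat_quotient_le[of _ 1 1])
    have "E \<subseteq> (\<Union>a\<in>{undefined}. ball a (t / 2))"
    proof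
      fix x :: 'a
      have "x = undefined" by (rule assms)
      with t show "x \<in> (\<Union>a\<in>{undefined}. ball a (t / 2))" by simp
    qed
    from covering_number_le_card[OF _ this] show "covering_number E t \<le> enat 1" by simp
  qed (use t in auto)
  then have "eventually (\<lambda>t. ln_enat (covering_number E t) / ereal (ln (1 / t)) \<le> ereal 0) (at_right 0)"
    unfolding eventually_at_right_field by (intro exI[of _ 1]) auto
  then show ?thesis unfolding minkowski_dim_def zero_ereal_def by (rule Limsup_bounded)
qed

text \<open>The dimension estimate needs a strict bound for the dimension of the set. For the upper bound it is
applied with exponents \<open>e > d\<close>, which then tend to \<open>d\<close>; for the lower bound with an exponent between
the dimension of \<open>f E\<close> and the claimed bound, which leads to a contradiction.\<close>

lemma distortion_bounds:
  assumes cf: "distorted_count f E p Q" and cg: "distorted_count g (f ` E) p Q"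
    and gf: "\<And>x. g (f x) = x" and Q: "0 < Q" "Q < p"
    and dim: "minkowski_dim E = ereal d" and d: "0 < d" "d < Q"
  shows "0 < (p - Q) * d / (p - d) \<and>
    ereal ((p - Q) * d / (p - d)) \<le> minkowski_dim (f ` E) \<and>
    minkowski_dim (f ` E) \<le> ereal (p * d / (p - Q + d)) \<and> p * d / (p - Q + d) < Q"
proof (intro conjI)
  show pos: "0 < (p - Q) * d / (p - d)" using Q d by simp
  have "d * (p - Q) < Q * (p - Q)" using Q d by (intro mult_strict_right_mono) auto
  then have "p * d < Q * (p - Q + d)" by (simp add: algebra_simps)
  then show "p * d / (p - Q + d) < Q" using Q d by (simp add: pos_divide_less_eq)
  have up: "minkowski_dim (f ` E) \<le> ereal (p * e / (p - Q + e))" if "d < e" for e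
    using that d Q dim by (intro minkowski_dim_image_le[OF cf]) auto
  have "((\<lambda>e. ereal (p * e / (p - Q + e))) \<longlongrightarrow> ereal (p * d / (p - Q + d))) (at_right d)"
    using Q d by (intro tendsto_intros) auto
  moreover have "eventually (\<lambda>e. minkowski_dim (f ` E) \<le> ereal (p * e / (p - Q + e))) (at_right d)"
    using eventually_at_right_less[of d] up by (rule eventually_mono)
  ultimately show "minkowski_dim (f ` E) \<le> ereal (p * d / (p - Q + d))"
    by (rule tendsto_lowerbound) simp
  show "ereal ((p - Q) * d / (p - d)) \<le> minkowski_dim (f ` E)"
  proof (rule ccontr)
    assume "\<not> ereal ((p - Q) * d / (p - d)) \<le> minkowski_dim (f ` E)"
    then have "max (minkowski_dim (f ` E)) 0 < ereal ((p - Q) * d / (p - d))" using pos by (simp add: zero_ereal_def)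
    then obtain e where e: "max (minkowski_dim (f ` E)) 0 < ereal e" "ereal e < ereal ((p - Q) * d / (p - d))"
      using ereal_dense2 by blast
    have e0: "0 < e" "e < (p - Q) * d / (p - d)" using e by (auto simp: zero_ereal_def)
    have "g ` f ` E = E" using gf by (simp add: image_image)
    moreover have "minkowski_dim (g ` f ` E) \<le> ereal (p * e / (p - Q + e))"
      using Q e0 e by (intro minkowski_dim_image_le[OF cg]) auto
    ultimately have "d \<le> p * e / (p - Q + e)" using dim by simp
    then have "d * (p - Q + e) \<le> p * e" using Q e0 by (simp add: pos_le_divide_eq)
    moreover have "e * (p - d) < (p - Q) * d" using e0 Q d by (simp add: pos_less_divide_eq)
    ultimately show False by (simp add: algebra_simps)
  qed
qed

theorem corollary1p3:
  fixes Q p0 :: real and \<mu> :: "'a::metric_space measure"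
  assumes "Q > 1"
    and "proper_space TYPE('a)"
    and "ahlfors_regular Q \<mu>"
    and "1 < p0" "p0 < Q"
    and "supports_poincare p0 \<mu>"
    and "ahlfors_regular_space Q TYPE('b::metric_space)"
  shows "\<exists>P :: real \<Rightarrow> real \<Rightarrow> real. \<forall>(\<eta> :: real \<Rightarrow> real) (f :: 'a \<Rightarrow> 'b).
    quasisymmetric \<eta> f \<and> homeomorphic_map euclidean euclidean f \<longrightarrow>
      (let p = P (\<eta> 1) (inv_into {0..} \<eta> 1) in
         p > Q \<and>
         (\<forall>(E :: 'a set) (d :: real).
            bounded E \<and> minkowski_dim E = ereal d \<and> 0 < d \<and> d < Q \<longrightarrow>
              0 < (p - Q) * d / (p - d) \<and>
              ereal ((p - Q) * d / (p - d)) \<le> minkowski_dim (f ` E) \<and>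
              minkowski_dim (f ` E) \<le> ereal (p * d / (p - Q + d)) \<and>
              p * d / (p - Q + d) < Q))"
proof -
  have "\<exists>p>Q. \<forall>(\<eta> :: real \<Rightarrow> real) (f :: 'a \<Rightarrow> 'b) E d.
    quasisymmetric \<eta> f \<and> homeomorphic_map euclidean euclidean f \<and> \<eta> 1 = a \<and> inv_into {0..} \<eta> 1 = b \<and>
    bounded E \<and> minkowski_dim E = ereal d \<and> 0 < d \<and> d < Q \<longrightarrow>
              0 < (p - Q) * d / (p - d) \<and>
              ereal ((p - Q) * d / (p - d)) \<le> minkowski_dim (f ` E) \<and>
              minkowski_dim (f ` E) \<le> ereal (p * d / (p - Q + d)) \<and>
              p * d / (p - Q + d) < Q" for a b
  proof (cases "\<exists>x\<^sub>0 y\<^sub>0 :: 'a. x\<^sub>0 \<noteq> y\<^sub>0")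
    case False
    have "\<not> (minkowski_dim E = ereal d \<and> 0 < d)" for E :: "'a set" and d
      using minkowski_dim_single[of E] False by (auto simp: zero_ereal_def)
    then show ?thesis by (intro exI[of _ "Q + 1"]) auto
  next
    case True
    then obtain x\<^sub>0 y\<^sub>0 :: 'a where xy: "x\<^sub>0 \<noteq> y\<^sub>0" by blast
    show ?thesis
    proof (cases "\<exists>u v :: 'b. u \<noteq> v")
      case False
      have "\<not> homeomorphic_map euclidean euclidean (f :: 'a \<Rightarrow> 'b)" for f
      proof
        assume "homeomorphic_map euclidean euclidean f"
        then have "inj f" using homeomorphic_imp_injective_map by fastforce
        moreover have "f x\<^sub>0 = f y\<^sub>0" using False by blast
        ultimately show False using xy by (auto dest: injD)
      qed
      then show ?thesis by (intro exI[of _ "Q + 1"]) auto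
    next
      case True
      then obtain u v :: 'b where uv: "u \<noteq> v" by blast
      obtain C\<^sub>1 where C1: "regular_bounds Q C\<^sub>1 \<mu>" using ahlfors_regular_bounds[OF assms(3) xy] by blast
      obtain \<mu>Y :: "'b measure" where "ahlfors_regular Q \<mu>Y"
        using assms(7) unfolding ahlfors_regular_space_def by blast
      then obtain C\<^sub>2 where C2: "regular_bounds Q C\<^sub>2 \<mu>Y" using ahlfors_regular_bounds[OF _ uv] by blast
      define C where "C = max C\<^sub>1 C\<^sub>2"
      have reg: "regular_bounds Q C \<mu>" "regular_bounds Q C \<mu>Y"
        using regular_bounds_mono[OF C1, of C] regular_bounds_mono[OF C2, of C] by (auto simp: C_def)
      obtain C\<^sub>P \<Lambda> where CP: "C\<^sub>P > 0" "\<Lambda> \<ge> 1" and poincare: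
        "\<forall>u h. upper_gradient h u \<longrightarrow> (\<forall>x r. r > 0 \<and> set_integrable \<mu> (ball x r) u \<longrightarrow>
           (\<integral>\<^sup>+ z \<in> ball x r. ennreal \<bar>u z - ball_average \<mu> (ball x r) u\<bar> \<partial>\<mu>) / emeasure \<mu> (ball x r)
           \<le> ennreal C\<^sub>P * ediameter (ball x r) *
             ennpowr ((\<integral>\<^sup>+ z \<in> ball x (\<Lambda> * r). ennpowr (h z) p0 \<partial>\<mu>)
                         / emeasure \<mu> (ball x (\<Lambda> * r))) (1 / p0))"
        using assms(6) unfolding supports_poincare_def by blast
      \<comment> \<open>Every point has distance at least \<open>4 R\<close> from \<open>x\<^sub>0\<close> or from \<open>y\<^sub>0\<close>.\<close>
      define R where "R = dist x\<^sub>0 y\<^sub>0 / 8"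
      have R: "R > 0" using xy by (simp add: R_def)
      have far: "\<exists>z. 4 * R \<le> dist x z" for x :: 'a
      proof (rule ccontr)
        assume "\<nexists>z. 4 * R \<le> dist x z"
        then have "dist x x\<^sub>0 < 4 * R" "dist x y\<^sub>0 < 4 * R" by (auto simp: not_le)
        then show False using dist_triangle3[of x\<^sub>0 y\<^sub>0 x] by (simp add: R_def)
      qed
      have conn: "connected (UNIV :: 'a set)"
        using poincare_connected[OF assms(6)] assms(3) by (simp add: ahlfors_regular_def)
      let ?H = "max 1 a" and ?H' = "max 1 (1 / b)"
      obtain p where p: "p > Q" and cnt: "\<And>R f g E. qs_poincare Q C ?H ?H' R \<mu> \<mu>Y f g p0 C\<^sub>P \<Lambda> \<Longrightarrow>
          bounded E \<Longrightarrow> distorted_count f E p Q \<and> distorted_count g (f ` E) p Q"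
        using ex_distortion_exponent[of C ?H ?H' C\<^sub>P \<Lambda> p0 Q \<mu> \<mu>Y] regular_boundsD(3)[OF reg(1)] CP assms(2,4,5)
        by auto
      have "0 < (p - Q) * d / (p - d) \<and>
              ereal ((p - Q) * d / (p - d)) \<le> minkowski_dim (f ` E) \<and>
              minkowski_dim (f ` E) \<le> ereal (p * d / (p - Q + d)) \<and>
              p * d / (p - Q + d) < Q"
        if qs: "quasisymmetric \<eta> f" and hom: "homeomorphic_map euclidean euclidean f"
          and ab: "\<eta> 1 = a" "inv_into {0..} \<eta> 1 = b"
          and E: "bounded E" "minkowski_dim E = ereal d" "0 < d" "d < Q"
        for \<eta> and f :: "'a \<Rightarrow> 'b" and E d
      proof -
        obtain g where "homeomorphic_maps euclidean euclidean f g"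
          using hom unfolding homeomorphic_map_maps by blast
        then have cont: "continuous_on UNIV f" "continuous_on UNIV g"
          and gf: "\<And>x. g (f x) = x" and fg: "\<And>y. f (g y) = y"
          by (auto simp: homeomorphic_maps_def)
        have "inj f" using gf by (metis injI)
        have "qs_poincare Q C ?H ?H' R \<mu> \<mu>Y f g p0 C\<^sub>P \<Lambda>"
        proof unfold_locales
          show "weak_qs ?H f" using quasisymmetric_weak_qs[OF qs \<open>inj f\<close>] ab by simp
          show "weak_qs ?H' g" using quasisymmetric_inverse_weak_qs[OF qs gf fg] ab by simp
        qed (use reg conn assms(2,4,5) cont gf fg R far CP poincare in auto)
        from cnt[OF this E(1)] show ?thesis
          using gf p assms(1) E(2-4) by (intro distortion_bounds) auto
      qed
      then show ?thesis using p by blast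
    qed
  qed
  then obtain P where P: "\<And>a b. P a b > Q" "\<And>a b (\<eta> :: real \<Rightarrow> real) (f :: 'a \<Rightarrow> 'b) E d.
    quasisymmetric \<eta> f \<and> homeomorphic_map euclidean euclidean f \<and> \<eta> 1 = a \<and> inv_into {0..} \<eta> 1 = b \<and>
    bounded E \<and> minkowski_dim E = ereal d \<and> 0 < d \<and> d < Q \<Longrightarrow>
              0 < (P a b - Q) * d / (P a b - d) \<and>
              ereal ((P a b - Q) * d / (P a b - d)) \<le> minkowski_dim (f ` E) \<and>
              minkowski_dim (f ` E) \<le> ereal (P a b * d / (P a b - Q + d)) \<and>
              P a b * d / (P a b - Q + d) < Q"
    by metis
  show ?thesis
    unfolding Let_def by (intro exI[of _ P] allI impI conjI P(1)) (use P(2) in blast)+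
qed

end
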